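(* Let $q\in GL_n(A)$ be split, let $n=2r\geq 2$, and let $(\varphi_{p\bar p'})$ be the $(1,1)$-curvature of the Chern connection attached to $q$ with respect to the trivial adelic connection. Then for all $p,p'\in\mathcal V$ we have $\varphi^{(1)}_{p\bar p'}=0$ and $\varphi^{(2)}_{p\bar p'}\neq 0$. In particular $\varphi_{p\bar p'}\neq 0$.
   Context: Let $M$ be an even positive integer, $N\geq 1$, $\zeta_N$ a primitive $N$-th root of unity, and $A=\mathbb{Z}[1/M,\zeta_N]$. Let $\mathcal V$ be a (possibly infinite) set of rational primes not dividing $MN$. For a ring $B$, $B^{\widehat{p}}$ denotes its $p$-adic completion. For $p\in\mathcal V$ there is a unique ring endomorphism $\phi_p$ of $A$ lifting the $p$-power Frobenius of $A/pA$; it extends to $A^{\widehat p}$. A $p$-derivation on a $p$-torsion free ring $B$ is a map $\delta_p:B\to B$ such that $\phi_p(b):=b^p+p\delta_p(b)$ is a ring homomorphism (its Frobenius lift). Let $G=GL_n$ over $A$, $\mathcal O(G)=A[x,\det(x)^{-1}]$ with $x$ an $n\times n$ matrix of indeterminates; $u^t$ denotes transpose and $u^{(p)}$ the entrywise $p$-th power of a matrix $u$. An adelic connection is a family $(\delta_p)_{p\in\mathcal V}$ of $p$-derivations on $\mathcal O(G)^{\widehat p}$. Let $T=x-1$, and $I$ the ideal of $A[[T]]$ generated by the entries of $T$. A connection is global along $1$ if each Frobenius lift maps the ideal generated by the entries of $T$ into itself (inducing an endomorphism of $A^{\widehat p}[[T]]$) and maps $A[[T]]$ into $A[[T]]$.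 The trivial adelic connection $\bar\delta=(\delta_{\bar p})$ has $\delta_{\bar p}x=0$; its Frobenius lift $\phi_{\bar p}$ extends $\phi_p$ on $A$ and sends $x\mapsto x^{(p)}$, i.e. $T\mapsto(1+T)^{(p)}-1$ on $A[[T]]$. For a connection $\delta$ global along $1$ with Frobenius lifts $\phi_p$ on $A[[T]]$, its $(1,1)$-curvature with respect to $\bar\delta$ is the family of $\mathbb{Z}$-module endomorphisms of $A[[T]]$ given by $\varphi_{p\bar p'}:=\frac{1}{pp'}(\phi_p\phi_{\bar p'}-\phi_{\bar p'}\phi_p)$ for $p\neq p'$ and $\varphi_{p\bar p}:=\frac{1}{p}(\phi_p\phi_{\bar p}-\phi_{\bar p}\phi_p)$; for $\nu\geq 1$, $\varphi^{(\nu)}_{p\bar p'}$ denotes the induced map $I/I^{\nu+1}\to I/I^{\nu+1}$. For $q\in GL_n(A)$ with $q^t=\pm q$, the Chern connection attached to $q$ has Frobenius lifts $\phi_p$ extending $\phi_p$ on $A^{\widehat p}$ with $\phi_p(x)=x^{(p)}\{(x^{(p)t}\phi_p(q)x^{(p)})^{-1}(x^tqx)^{(p)}\}^{1/2}$ (square root via the binomial series $(1+u)^{1/2}=1+\sum_{i\ge1}\binom{1/2}{i}u^i$); for split $q$ it is global along $1$. A matrix $q$ with $n=2r$ is split if it is $\begin{pmatrix}0&1_r\\-1_r&0\end{pmatrix}$ or $\begin{pmatrix}0&1_r\\1_r&0\end{pmatrix}$, $1_r$ the $r\times r$ identity. *)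

theory Defs
  imports
    "HOL-Algebra.QuotRing" "HOL-Algebra.Generated_Rings" "HOL-Algebra.Ideal_Product"
    "HOL-Combinatorics.Permutations" "HOL-Library.Multiset"
    "HOL-Computational_Algebra.Primes" Complex_Main
begin

section \<open>The coefficient ring\<close>

definition complex_ring :: "complex ring" where
  "complex_ring = \<lparr>carrier = UNIV, monoid.mult = (*), monoid.one = 1, ring.zero = 0, ring.add = (+)\<rparr>"

definition primitive_root_of_one :: "nat \<Rightarrow> complex \<Rightarrow> bool" where
  "primitive_root_of_one N \<zeta> \<longleftrightarrow> \<zeta> ^ N = 1 \<and> (\<forall>k. 0 < k \<and> k < N \<longrightarrow> \<zeta> ^ k \<noteq> 1)"

text \<open>The ring \<open>\<int>[1/M, \<zeta>]\<close>, as a subring of the complex numbers.\<close>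

definition cyclotomic_ring :: "nat \<Rightarrow> complex \<Rightarrow> complex ring" where
  "cyclotomic_ring M \<zeta> =
     complex_ring\<lparr>carrier := generate_ring complex_ring {1 / of_nat M, \<zeta>}\<rparr>"


section \<open>\<open>p\<close>-adic completion, Frobenius lifts and \<open>p\<close>-derivations\<close>

definition p_ideal :: "'a ring \<Rightarrow> nat \<Rightarrow> nat \<Rightarrow> 'a set" where
  "p_ideal R p k = PIdl\<^bsub>R\<^esub> (add_pow R (p ^ k) \<one>\<^bsub>R\<^esub>)"

text \<open>
  The inverse limit of the rings \<open>R / p^k R\<close>. Since the elements of \<open>R / p^k R\<close> are cosets, the
  transition map sends a coset of \<open>p^(k+1) R\<close> to the unique coset of \<open>p^k R\<close> containing it.
\<close>

definition padic_completion :: "'a ring \<Rightarrow> nat \<Rightarrow> (nat \<Rightarrow> 'a set) ring" where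
  "padic_completion R p =
     \<lparr>carrier = {X. \<forall>k. X k \<in> carrier (R Quot p_ideal R p k) \<and> X (Suc k) \<subseteq> X k},
      monoid.mult = (\<lambda>X Y k. X k \<otimes>\<^bsub>R Quot p_ideal R p k\<^esub> Y k),
      monoid.one = (\<lambda>k. \<one>\<^bsub>R Quot p_ideal R p k\<^esub>),
      ring.zero = (\<lambda>k. \<zero>\<^bsub>R Quot p_ideal R p k\<^esub>),
      ring.add = (\<lambda>X Y k. X k \<oplus>\<^bsub>R Quot p_ideal R p k\<^esub> Y k)\<rparr>"

definition to_completion :: "'a ring \<Rightarrow> nat \<Rightarrow> 'a \<Rightarrow> (nat \<Rightarrow> 'a set)" where
  "to_completion R p a = (\<lambda>k. p_ideal R p k +>\<^bsub>R\<^esub> a)"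

text \<open>
  The map from the completion of \<open>R\<close> to the completion of \<open>S\<close> induced by an additive map
  \<open>f : R \<rightarrow> S\<close> with \<open>f (p^k R) \<subseteq> p^k S\<close>; all the cosets in the union then coincide.
\<close>

definition completion_map :: "'b ring \<Rightarrow> nat \<Rightarrow> ('a \<Rightarrow> 'b) \<Rightarrow> (nat \<Rightarrow> 'a set) \<Rightarrow> (nat \<Rightarrow> 'b set)" where
  "completion_map S p f X = (\<lambda>k. \<Union>a\<in>X k. p_ideal S p k +>\<^bsub>S\<^esub> f a)"

definition frobenius_lift :: "'a ring \<Rightarrow> nat \<Rightarrow> ('a \<Rightarrow> 'a) \<Rightarrow> bool" where
  "frobenius_lift R p \<phi> \<longleftrightarrow> \<phi> \<in> ring_hom R R \<and>
     (\<forall>a\<in>carrier R. \<phi> a \<ominus>\<^bsub>R\<^esub> a [^]\<^bsub>R\<^esub> p \<in> p_ideal R p 1)"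

definition frob :: "'a ring \<Rightarrow> nat \<Rightarrow> ('a \<Rightarrow> 'a) \<Rightarrow> 'a \<Rightarrow> 'a" where
  "frob B p \<delta> b = b [^]\<^bsub>B\<^esub> p \<oplus>\<^bsub>B\<^esub> add_pow B p (\<delta> b)"

definition p_derivation :: "'a ring \<Rightarrow> nat \<Rightarrow> ('a \<Rightarrow> 'a) \<Rightarrow> bool" where
  "p_derivation B p \<delta> \<longleftrightarrow> \<delta> \<in> carrier B \<rightarrow> carrier B \<and> frob B p \<delta> \<in> ring_hom B B"


section \<open>Matrices\<close>

type_synonym ('n, 'a) matrix = "'n \<Rightarrow> 'n \<Rightarrow> 'a"

definition mat_ring :: "'a ring \<Rightarrow> ('n::finite, 'a) matrix ring" where
  "mat_ring R =
     \<lparr>carrier = {a. \<forall>i j. a i j \<in> carrier R},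
      monoid.mult = (\<lambda>a b i j. \<Oplus>\<^bsub>R\<^esub>k\<in>UNIV. a i k \<otimes>\<^bsub>R\<^esub> b k j),
      monoid.one = (\<lambda>i j. if i = j then \<one>\<^bsub>R\<^esub> else \<zero>\<^bsub>R\<^esub>),
      ring.zero = (\<lambda>i j. \<zero>\<^bsub>R\<^esub>),
      ring.add = (\<lambda>a b i j. a i j \<oplus>\<^bsub>R\<^esub> b i j)\<rparr>"

definition mat_transpose :: "('n, 'a) matrix \<Rightarrow> ('n, 'a) matrix" where
  "mat_transpose a = (\<lambda>i j. a j i)"

definition mat_det :: "'a ring \<Rightarrow> ('n::finite, 'a) matrix \<Rightarrow> 'a" where
  "mat_det R a =
     (\<Oplus>\<^bsub>R\<^esub>\<sigma>\<in>{\<sigma>. \<sigma> permutes UNIV}. add_pow R (sign \<sigma>) (\<Otimes>\<^bsub>R\<^esub>i\<in>UNIV. a i (\<sigma> i)))"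

definition entrywise_pow :: "'a ring \<Rightarrow> ('n, 'a) matrix \<Rightarrow> nat \<Rightarrow> ('n, 'a) matrix" where
  "entrywise_pow R a p = (\<lambda>i j. a i j [^]\<^bsub>R\<^esub> p)"

text \<open>
  \<open>s\<close> is the \<open>p\<close>-adic sum of the binomial series of \<open>w\<^sup>1\<^sup>/\<^sup>2 = (1 + (w - 1))\<^sup>1\<^sup>/\<^sup>2\<close>. The map \<open>c\<close> embeds the
  scalars, among them the rational numbers \<open>1/2 gchoose l\<close>, into \<open>B\<close>.
\<close>

definition binomial_sqrt ::
    "'b ring \<Rightarrow> nat \<Rightarrow> (complex \<Rightarrow> 'b) \<Rightarrow> ('n::finite, 'b) matrix \<Rightarrow> ('n, 'b) matrix \<Rightarrow> bool" where
  "binomial_sqrt B p c w s \<longleftrightarrow> s \<in> carrier (mat_ring B) \<and>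
     (\<forall>k. \<exists>m0. \<forall>m\<ge>m0. \<forall>i j.
        (s \<ominus>\<^bsub>mat_ring B\<^esub>
          (\<Oplus>\<^bsub>mat_ring B\<^esub>l\<in>{..m}.
             (\<lambda>i' j'. c ((1/2) gchoose l) \<otimes>\<^bsub>B\<^esub>
                ((w \<ominus>\<^bsub>mat_ring B\<^esub> \<one>\<^bsub>mat_ring B\<^esub>) [^]\<^bsub>mat_ring B\<^esub> l) i' j'))) i j
          \<in> p_ideal B p k)"

text \<open>
  The two split matrices of size \<open>2r\<close>; the index type is the disjoint union of two copies of a
  type with \<open>r\<close> elements, corresponding to the two blocks.
\<close>

definition split_form :: "complex \<Rightarrow> ('r + 'r, complex) matrix" where
  "split_form \<epsilon> = (\<lambda>i j. case (i, j) of
      (Inl a, Inr b) \<Rightarrow> (if a = b then 1 else 0)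
    | (Inr a, Inl b) \<Rightarrow> (if a = b then \<epsilon> else 0)
    | _ \<Rightarrow> 0)"

definition split_matrix :: "('r + 'r, complex) matrix \<Rightarrow> bool" where
  "split_matrix q \<longleftrightarrow> q = split_form (- 1) \<or> q = split_form 1"


section \<open>Power series and the coordinate ring of \<open>GL\<^sub>n\<close>\<close>

text \<open>
  Formal power series over \<open>R\<close> in the indeterminates \<open>T\<^sub>v\<close>, where \<open>v\<close> ranges over a (finite) type;
  a monomial is a multiset of indeterminates.
\<close>

type_synonym ('v, 'a) pseries = "'v multiset \<Rightarrow> 'a"

definition pseries_ring :: "'a ring \<Rightarrow> ('v, 'a) pseries ring" where
  "pseries_ring R =
     \<lparr>carrier = {f. \<forall>m. f m \<in> carrier R},
      monoid.mult = (\<lambda>f g m. \<Oplus>\<^bsub>R\<^esub>k\<in>{k. k \<subseteq># m}. f k \<otimes>\<^bsub>R\<^esub> g (m - k)),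
      monoid.one = (\<lambda>m. if m = {#} then \<one>\<^bsub>R\<^esub> else \<zero>\<^bsub>R\<^esub>),
      ring.zero = (\<lambda>m. \<zero>\<^bsub>R\<^esub>),
      ring.add = (\<lambda>f g m. f m \<oplus>\<^bsub>R\<^esub> g m)\<rparr>"

definition pseries_const :: "'a ring \<Rightarrow> 'a \<Rightarrow> ('v, 'a) pseries" where
  "pseries_const R a = (\<lambda>m. if m = {#} then a else \<zero>\<^bsub>R\<^esub>)"

definition pseries_var :: "'a ring \<Rightarrow> 'v \<Rightarrow> ('v, 'a) pseries" where
  "pseries_var R v = (\<lambda>m. if m = {#v#} then \<one>\<^bsub>R\<^esub> else \<zero>\<^bsub>R\<^esub>)"

definition T_ideal :: "'a ring \<Rightarrow> ('v, 'a) pseries set" where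
  "T_ideal R = Idl\<^bsub>pseries_ring R\<^esub> (range (pseries_var R))"

primrec ideal_power :: "'a ring \<Rightarrow> 'a set \<Rightarrow> nat \<Rightarrow> 'a set" where
  "ideal_power R J 0 = carrier R"
| "ideal_power R J (Suc k) = ideal_prod R J (ideal_power R J k)"

definition T_power :: "'a ring \<Rightarrow> nat \<Rightarrow> ('v, 'a) pseries set" where
  "T_power R k = ideal_power (pseries_ring R) (T_ideal R) k"

text \<open>The generic matrix \<open>x = 1 + T\<close>.\<close>

definition coord_matrix :: "'a ring \<Rightarrow> ('n, ('n \<times> 'n, 'a) pseries) matrix" where
  "coord_matrix R = (\<lambda>i j. pseries_var R (i, j) \<oplus>\<^bsub>pseries_ring R\<^esub>
      (if i = j then \<one>\<^bsub>pseries_ring R\<^esub> else \<zero>\<^bsub>pseries_ring R\<^esub>))"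

text \<open>
  \<open>\<O>(GL\<^sub>n) = R[x, det(x)\<^sup>-\<^sup>1]\<close>. The entries of \<open>x = 1 + T\<close> are algebraically independent over \<open>R\<close> and
  \<open>det(x)\<close> is a unit of \<open>R[[T]]\<close>, so this ring is realised inside \<open>R[[T]]\<close>.
\<close>

definition GL_coord :: "'a ring \<Rightarrow> ('n::finite \<times> 'n, 'a) pseries ring" where
  "GL_coord R = (pseries_ring R)
     \<lparr>carrier := generate_ring (pseries_ring R)
        (pseries_const R ` carrier R
         \<union> (\<lambda>(i, j). coord_matrix R i j) ` UNIV
         \<union> {inv\<^bsub>pseries_ring R\<^esub> (mat_det (pseries_ring R) (coord_matrix R))})\<rparr>"


section \<open>Adelic connections on \<open>GL\<^sub>n\<close>\<close>

type_synonym ('n, 'a) GL_hat = "nat \<Rightarrow> ('n \<times> 'n, 'a) pseries set"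

abbreviation GL_completion :: "'a ring \<Rightarrow> nat \<Rightarrow> ('n::finite, 'a) GL_hat ring" where
  "GL_completion R p \<equiv> padic_completion (GL_coord R) p"

definition GL_scalar :: "'a ring \<Rightarrow> nat \<Rightarrow> 'a \<Rightarrow> ('n::finite, 'a) GL_hat" where
  "GL_scalar R p a = to_completion (GL_coord R) p (pseries_const R a)"

definition GL_x :: "'a ring \<Rightarrow> nat \<Rightarrow> ('n::finite, ('n, 'a) GL_hat) matrix" where
  "GL_x R p = (\<lambda>i j. to_completion (GL_coord R) p (coord_matrix R i j))"

definition adelic_connection ::
    "'a ring \<Rightarrow> nat set \<Rightarrow> (nat \<Rightarrow> ('n::finite, 'a) GL_hat \<Rightarrow> ('n, 'a) GL_hat) \<Rightarrow> bool" where
  "adelic_connection A V \<delta> \<longleftrightarrow> (\<forall>p\<in>V. p_derivation (GL_completion A p) p (\<delta> p))"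

text \<open>
  The endomorphism \<open>\<Phi>\<close> of the completion of \<open>\<O>(GL\<^sub>n)\<close> extends the endomorphism of the completion
  of \<open>A\<close> induced by \<open>\<phi> : A \<rightarrow> A\<close>.
\<close>

definition extends_base ::
    "'a ring \<Rightarrow> nat \<Rightarrow> ('a \<Rightarrow> 'a) \<Rightarrow> (('n::finite, 'a) GL_hat \<Rightarrow> ('n, 'a) GL_hat) \<Rightarrow> bool" where
  "extends_base A p \<phi> \<Phi> \<longleftrightarrow> (\<forall>a\<in>carrier (padic_completion A p).
     \<Phi> (completion_map (GL_coord A) p (pseries_const A) a) =
       completion_map (GL_coord A) p (pseries_const A) (completion_map A p \<phi> a))"

definition trivial_connection ::
    "'a ring \<Rightarrow> nat set \<Rightarrow> (nat \<Rightarrow> 'a \<Rightarrow> 'a) \<Rightarrow>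
     (nat \<Rightarrow> ('n::finite, 'a) GL_hat \<Rightarrow> ('n, 'a) GL_hat) \<Rightarrow> bool" where
  "trivial_connection A V \<phi> \<delta> \<longleftrightarrow> adelic_connection A V \<delta> \<and>
     (\<forall>p\<in>V. extends_base A p (\<phi> p) (frob (GL_completion A p) p (\<delta> p)) \<and>
        (\<forall>i j. \<delta> p (GL_x A p i j) = \<zero>\<^bsub>GL_completion A p\<^esub>))"

definition chern_connection ::
    "complex ring \<Rightarrow> nat set \<Rightarrow> (nat \<Rightarrow> complex \<Rightarrow> complex) \<Rightarrow> ('n::finite, complex) matrix \<Rightarrow>
     (nat \<Rightarrow> ('n, complex) GL_hat \<Rightarrow> ('n, complex) GL_hat) \<Rightarrow> bool" where
  "chern_connection A V \<phi> q \<delta> \<longleftrightarrow> adelic_connection A V \<delta> \<and>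
     (\<forall>p\<in>V.
        let B = GL_completion A p;
            Mat = mat_ring B;
            \<Phi> = frob B p (\<delta> p);
            x = GL_x A p;
            xp = entrywise_pow B x p;
            Q = (\<lambda>i j. GL_scalar A p (q i j));
            \<phi>Q = (\<lambda>i j. GL_scalar A p (\<phi> p (q i j)));
            w = inv\<^bsub>Mat\<^esub> (mat_transpose xp \<otimes>\<^bsub>Mat\<^esub> \<phi>Q \<otimes>\<^bsub>Mat\<^esub> xp) \<otimes>\<^bsub>Mat\<^esub>
                  entrywise_pow B (mat_transpose x \<otimes>\<^bsub>Mat\<^esub> Q \<otimes>\<^bsub>Mat\<^esub> x) p
        in extends_base A p (\<phi> p) \<Phi> \<and>
           (\<exists>s. binomial_sqrt B p (GL_scalar A p) w s \<and>
                (\<lambda>i j. \<Phi> (x i j)) = xp \<otimes>\<^bsub>Mat\<^esub> s))"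


section \<open>Frobenius lifts on power series and the curvature\<close>

text \<open>The natural maps from the completion of \<open>\<O>(GL\<^sub>n)\<close>, and from \<open>A[[T]]\<close>, to power series over the
  completion of \<open>A\<close>.\<close>

definition GL_taylor :: "'a ring \<Rightarrow> nat \<Rightarrow> ('n, 'a) GL_hat \<Rightarrow> ('n \<times> 'n, nat \<Rightarrow> 'a set) pseries" where
  "GL_taylor A p h = (\<lambda>m. completion_map A p (\<lambda>f. f m) h)"

definition pseries_to_completion ::
    "'a ring \<Rightarrow> nat \<Rightarrow> ('v, 'a) pseries \<Rightarrow> ('v, nat \<Rightarrow> 'a set) pseries" where
  "pseries_to_completion A p f = (\<lambda>m. to_completion A p (f m))"

text \<open>
  The endomorphism of power series over the completion of \<open>A\<close> induced by an endomorphism \<open>\<Phi>\<close> of the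
  completion of \<open>\<O>(GL\<^sub>n)\<close> preserving the ideal generated by the entries of \<open>T\<close>: it is obtained from
  \<open>\<Phi>\<close> by passing to the limit modulo the powers of that ideal.
\<close>

definition induced_endo ::
    "'a ring \<Rightarrow> nat \<Rightarrow> (('n::finite, 'a) GL_hat \<Rightarrow> ('n, 'a) GL_hat) \<Rightarrow>
     ('n \<times> 'n, nat \<Rightarrow> 'a set) pseries \<Rightarrow> ('n \<times> 'n, nat \<Rightarrow> 'a set) pseries" where
  "induced_endo A p \<Phi> F = (let S = pseries_ring (padic_completion A p) in
     THE G. G \<in> carrier S \<and>
       (\<forall>k. \<forall>h\<in>carrier (GL_completion A p).
          F \<ominus>\<^bsub>S\<^esub> GL_taylor A p h \<in> T_power (padic_completion A p) k \<longrightarrow>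
          G \<ominus>\<^bsub>S\<^esub> GL_taylor A p (\<Phi> h) \<in> T_power (padic_completion A p) k))"

text \<open>
  The Frobenius lift on \<open>A[[T]]\<close> of a connection that is global along the identity, i.e. one whose
  induced endomorphism exists and maps \<open>A[[T]]\<close> into \<open>A[[T]]\<close>.
\<close>

definition frob_at_one ::
    "'a ring \<Rightarrow> (nat \<Rightarrow> ('n::finite, 'a) GL_hat \<Rightarrow> ('n, 'a) GL_hat) \<Rightarrow> nat \<Rightarrow>
     ('n \<times> 'n, 'a) pseries \<Rightarrow> ('n \<times> 'n, 'a) pseries" where
  "frob_at_one A \<delta> p f = (THE g. g \<in> carrier (pseries_ring A) \<and>
     pseries_to_completion A p g =
       induced_endo A p (frob (GL_completion A p) p (\<delta> p)) (pseries_to_completion A p f))"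

text \<open>
  The division is carried out on complex coefficients; the result is again in \<open>A[[T]]\<close>, because
  Frobenius lifts commute modulo the primes in question.
\<close>

definition curvature ::
    "complex ring \<Rightarrow> (nat \<Rightarrow> ('n::finite, complex) GL_hat \<Rightarrow> ('n, complex) GL_hat) \<Rightarrow>
     (nat \<Rightarrow> ('n, complex) GL_hat \<Rightarrow> ('n, complex) GL_hat) \<Rightarrow> nat \<Rightarrow> nat \<Rightarrow>
     ('n \<times> 'n, complex) pseries \<Rightarrow> ('n \<times> 'n, complex) pseries" where
  "curvature A \<delta> \<delta>' p p' f = (\<lambda>m.
     (frob_at_one A \<delta> p (frob_at_one A \<delta>' p' f) m - frob_at_one A \<delta>' p' (frob_at_one A \<delta> p f) m)
       / of_nat (if p = p' then p else p * p'))"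

definition T_quotient :: "'a ring \<Rightarrow> nat \<Rightarrow> ('v, 'a) pseries set set" where
  "T_quotient A \<nu> = (\<lambda>f. T_power A (\<nu> + 1) +>\<^bsub>pseries_ring A\<^esub> f) ` T_ideal A"

text \<open>The map on \<open>I / I\<^sup>\<nu>\<^sup>+\<^sup>1\<close> induced by an additive map \<open>F\<close> preserving \<open>I\<close> and \<open>I\<^sup>\<nu>\<^sup>+\<^sup>1\<close>.\<close>

definition T_quotient_map ::
    "'a ring \<Rightarrow> nat \<Rightarrow> (('v, 'a) pseries \<Rightarrow> ('v, 'a) pseries) \<Rightarrow> ('v, 'a) pseries set \<Rightarrow> ('v, 'a) pseries set" where
  "T_quotient_map A \<nu> F X = (\<Union>f\<in>X. T_power A (\<nu> + 1) +>\<^bsub>pseries_ring A\<^esub> F f)"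

end

theory Submission
  imports Defs "HOL-Analysis.Determinants" "HOL-Computational_Algebra.Formal_Power_Series"
begin

text \<open>
  The Frobenius lift of the Chern connection acts on \<open>A[[T]]\<close> as a substitution: the entries of \<open>x\<close>
  go to those of \<open>x\<^sup>(\<^sup>p\<^sup>) \<sigma>\<close>, where \<open>\<sigma>\<close> is the \<open>T\<close>-adic binomial series of the square root of
  \<open>w = (x\<^sup>(\<^sup>p\<^sup>)\<^sup>t q x\<^sup>(\<^sup>p\<^sup>))\<^sup>-\<^sup>1 (x\<^sup>t q x)\<^sup>(\<^sup>p\<^sup>)\<close>; it has coefficients in \<open>A\<close> because \<open>w \<equiv> 1\<close> modulo \<open>I\<close> and
  \<open>1/2 \<in> A\<close>. A split form is \<open>q i j = (if j = i' then e i else 0)\<close> for an involution \<open>i \<mapsto> i'\<close> without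
  fixed points and signs \<open>e i\<close>. Modulo \<open>I\<^sup>3\<close> the matrix \<open>w - 1\<close> is diagonal with entries \<open>p S i\<close>, where \<open>S i\<close>
  is the sum of \<open>e i' \<cdot> e k \<cdot> T k i' \<cdot> T k' i\<close> over \<open>k \<noteq> i'\<close>. Hence the Chern lift agrees with the trivial
  one modulo \<open>I\<^sup>2\<close>, and the linear parts \<open>T i i \<mapsto> p \<cdot> T i i\<close>, \<open>T i j \<mapsto> 0\<close> commute for any two primes.
  Modulo \<open>I\<^sup>3\<close> the trivial lift kills \<open>S i\<close>, so the commutator maps \<open>T i i\<close> to \<open>(p p' / 2) S i\<close>, and the
  coefficient of \<open>T i i' \<cdot> T i' i\<close> in \<open>S i\<close> is a sign. Divisibility of the commutator by \<open>p\<close> and \<open>p'\<close> holds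
  because both substitutions are Frobenius lifts on \<open>A[[T]]\<close>.
\<close>

section \<open>Rings of formal power series\<close>

text \<open>The connections live on different completions, one for \<open>p\<close> and one for
  \<open>p'\<close>, and are given there only as abstract ring homomorphisms, whereas the curvature
  composes their descents to \<open>A[[T]]\<close>. Identifying each lift with a substitution over
  \<open>A\<close> also justifies the definite descriptions in \<open>induced_endo\<close> and
  \<open>frob_at_one\<close>. It rests on two facts: a ring homomorphism preserves divisibility by
  \<open>p ^ k\<close>, so it is automatically continuous, and \<open>A\<close> is
  \<open>p\<close>-adically separated, so \<open>A[[T]]\<close> embeds in its completion. The square
  root is a second obstacle: the definition sums the binomial series \<open>p\<close>-adically, the
  substitution sums it \<open>T\<close>-adically. The two sums are compared one coefficient at a
  time, since a single coefficient of the \<open>T\<close>-adic sum is reached after finitely many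
  terms. Moreover \<open>inv\<close> in the Chern formula carries information only for a unit, so
  \<open>x^(p)\<close> has to be shown invertible over the completion. That \<open>M\<close> is even
  serves twice: \<open>1/2\<close> lies in \<open>A\<close>, and every prime in \<open>V\<close> is
  at least \<open>3\<close>, which pushes the \<open>p\<close>-th powers of off-diagonal entries
  into \<open>I^3\<close>.\<close>

lemma (in abelian_monoid) finsum_Sigma:
  assumes "finite A" "\<And>a. a \<in> A \<Longrightarrow> finite (B a)"
    and f: "\<And>a b. a \<in> A \<Longrightarrow> b \<in> B a \<Longrightarrow> f a b \<in> carrier G"
  shows "(\<Oplus>a\<in>A. \<Oplus>b\<in>B a. f a b) = (\<Oplus>x\<in>Sigma A B. f (fst x) (snd x))"
proof -
  have "(\<Oplus>x\<in>Sigma A B. f (fst x) (snd x)) = (\<Oplus>x\<in>(\<Union>a\<in>A. Pair a ` B a). f (fst x) (snd x))"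
    by (rule arg_cong[where f = "finsum G _"]) auto
  also have "\<dots> = (\<Oplus>a\<in>A. \<Oplus>x\<in>Pair a ` B a. f (fst x) (snd x))"
    by (rule add.finprod_UN_disjoint) (auto simp: assms pairwise_def disjnt_def)
  also have "\<dots> = (\<Oplus>a\<in>A. \<Oplus>b\<in>B a. f a b)"
  proof (rule finsum_cong')
    fix a assume a: "a \<in> A"
    have "(\<Oplus>x\<in>Pair a ` B a. f (fst x) (snd x)) = (\<Oplus>b\<in>B a. f (fst (Pair a b)) (snd (Pair a b)))"
      by (rule finsum_reindex) (auto simp: a f inj_on_def)
    then show "(\<Oplus>x\<in>Pair a ` B a. f (fst x) (snd x)) = (\<Oplus>b\<in>B a. f a b)" by simp
  qed (auto simp: f intro!: finsum_closed)
  finally show ?thesis by simp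
qed

lemma finite_sub_mset: "finite {k. k \<subseteq># (m :: 'a multiset)}"
proof (induction m)
  case (add x m)
  have "{k. k \<subseteq># add_mset x m} \<subseteq> {k. k \<subseteq># m} \<union> add_mset x ` {k. k \<subseteq># m}"
  proof
    fix k assume k: "k \<in> {k. k \<subseteq># add_mset x m}"
    show "k \<in> {k. k \<subseteq># m} \<union> add_mset x ` {k. k \<subseteq># m}"
    proof (cases "x \<in># k")
      case True
      then obtain l where l: "k = add_mset x l" by (metis multi_member_split)
      then show ?thesis using k by auto
    next
      case False
      then have "k \<subseteq># m" using k
        by (metis mem_Collect_eq diff_single_trivial subset_eq_diff_conv add_mset_add_single diff_subset_eq_self subset_mset.order_trans add_mset_remove_trivial)
      then show ?thesis by simp
    qed
  qed
  then show ?case using add by (meson finite_Un finite_imageI finite_subset)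
qed simp

lemma finite_mset_size_le: "finite {m :: 'v::finite multiset. size m \<le> n}"
proof (induction n)
  case (Suc n)
  have "{m :: 'v multiset. size m \<le> Suc n} \<subseteq> insert {#} (case_prod add_mset ` (UNIV \<times> {m. size m \<le> n}))"
  proof
    fix m :: "'v multiset" assume "m \<in> {m. size m \<le> Suc n}"
    then show "m \<in> insert {#} (case_prod add_mset ` (UNIV \<times> {m. size m \<le> n}))"
      by (cases m) (auto simp: image_iff)
  qed
  then show ?case by (rule finite_subset) (simp add: Suc)
qed simp


lemma mset_double_diff: "k \<subseteq># m \<Longrightarrow> m - (m - k) = (k :: 'a multiset)"
  by (metis add_diff_cancel_right' subset_mset.add_diff_inverse)

lemma pseries_simps [simp]:
  "f \<in> carrier (pseries_ring R) \<longleftrightarrow> (\<forall>m. f m \<in> carrier R)"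
  "(f \<otimes>\<^bsub>pseries_ring R\<^esub> g) = (\<lambda>m. \<Oplus>\<^bsub>R\<^esub>k\<in>{k. k \<subseteq># m}. f k \<otimes>\<^bsub>R\<^esub> g (m - k))"
  "\<one>\<^bsub>pseries_ring R\<^esub> = (\<lambda>m. if m = {#} then \<one>\<^bsub>R\<^esub> else \<zero>\<^bsub>R\<^esub>)"
  "\<zero>\<^bsub>pseries_ring R\<^esub> = (\<lambda>m. \<zero>\<^bsub>R\<^esub>)"
  "f \<oplus>\<^bsub>pseries_ring R\<^esub> g = (\<lambda>m. f m \<oplus>\<^bsub>R\<^esub> g m)"
  by (simp_all add: pseries_ring_def)

locale plain_cring = cring R for R :: "'a ring" (structure)
begin

lemma finsum_sub_mset_swap:
  assumes F: "\<And>k l. F k l \<in> carrier R"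
  shows "(\<Oplus>k\<in>{k. k \<subseteq># m}. F k (m - k)) = (\<Oplus>k\<in>{k. k \<subseteq># m}. F (m - k) k)"
proof -
  have "(\<Oplus>k\<in>((-) m) ` {k. k \<subseteq># m}. F k (m - k)) = (\<Oplus>k\<in>{k. k \<subseteq># m}. F (m - k) (m - (m - k)))"
    by (rule finsum_reindex)
      (auto simp: F inj_on_def, metis mset_double_diff)
  moreover have "((-) m) ` {k. k \<subseteq># m} = {k. k \<subseteq># m}"
    by (auto simp: image_iff) (metis mset_double_diff diff_subset_eq_self)
  ultimately show ?thesis by (simp add: F mset_double_diff cong: finsum_cong)
qed

lemma pseries_mult_comm:
  assumes "\<And>m. f m \<in> carrier R" "\<And>m. g m \<in> carrier R"
  shows "f \<otimes>\<^bsub>pseries_ring R\<^esub> g = g \<otimes>\<^bsub>pseries_ring R\<^esub> f"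
proof
  fix m
  show "(f \<otimes>\<^bsub>pseries_ring R\<^esub> g) m = (g \<otimes>\<^bsub>pseries_ring R\<^esub> f) m"
    using finsum_sub_mset_swap[of "\<lambda>k l. f k \<otimes> g l" m] assms
    by (simp add: m_comm)
qed

text \<open>Both sides sum over the factorisations of \<open>m\<close> into three monomials.
  \<open>?L\<close> encodes one by nested divisors of \<open>m\<close>, \<open>?R\<close> by its
  first two factors, and the bijection \<open>?c\<close> sends \<open>(l, j)\<close> to
  \<open>(l + j, l)\<close>.\<close>

lemma pseries_mult_assoc:
  assumes f: "\<And>m. f m \<in> carrier R" and g: "\<And>m. g m \<in> carrier R" and h: "\<And>m. h m \<in> carrier R"
  shows "(f \<otimes>\<^bsub>pseries_ring R\<^esub> g) \<otimes>\<^bsub>pseries_ring R\<^esub> h = f \<otimes>\<^bsub>pseries_ring R\<^esub> (g \<otimes>\<^bsub>pseries_ring R\<^esub> h)"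
proof
  fix m
  let ?S = "\<lambda>m. {k. k \<subseteq># (m :: 'b multiset)}"
  let ?L = "Sigma (?S m) (\<lambda>k. ?S k)" and ?R = "Sigma (?S m) (\<lambda>l. ?S (m - l))"
  let ?c = "\<lambda>p. (fst p + snd p, fst p)"
  have "((f \<otimes>\<^bsub>pseries_ring R\<^esub> g) \<otimes>\<^bsub>pseries_ring R\<^esub> h) m
      = (\<Oplus>k\<in>?S m. \<Oplus>l\<in>?S k. f l \<otimes> g (k - l) \<otimes> h (m - k))"
    by (simp add: f g h finsum_ldistr finite_sub_mset cong: finsum_cong)
  also have "\<dots> = (\<Oplus>p\<in>?L. f (snd p) \<otimes> g (fst p - snd p) \<otimes> h (m - fst p))"
    by (subst finsum_Sigma) (auto simp: f g h finite_sub_mset)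
  also have "?L = ?c ` ?R"
  proof (intro equalityI subsetI)
    fix x assume "x \<in> ?L"
    then have "snd x \<subseteq># fst x" "fst x \<subseteq># m" by auto
    then obtain i j where ij: "fst x = snd x + j" "m = fst x + i" by (metis mset_subset_eq_exists_conv)
    then have "snd x \<subseteq># m" "fst x - snd x \<subseteq># m - snd x" "snd x + (fst x - snd x) = fst x"
      by (auto simp: add.assoc)
    then show "x \<in> ?c ` ?R"
      by (intro image_eqI[of _ _ "(snd x, fst x - snd x)"]) auto
  next
    fix x assume "x \<in> ?c ` ?R"
    then obtain l j where x: "x = (l + j, l)" and lj: "l \<subseteq># m" "j \<subseteq># m - l" by auto
    from lj have "l + j \<subseteq># m" by (metis mset_subset_eq_mono_add_left_cancel subset_mset.add_diff_inverse)
    then show "x \<in> ?L" by (simp add: x)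
  qed
  also have "(\<Oplus>p\<in>?c ` ?R. f (snd p) \<otimes> g (fst p - snd p) \<otimes> h (m - fst p))
      = (\<Oplus>p\<in>?R. f (snd (?c p)) \<otimes> g (fst (?c p) - snd (?c p)) \<otimes> h (m - fst (?c p)))"
    by (rule finsum_reindex) (auto simp: f g h inj_on_def)
  also have "\<dots> = (\<Oplus>p\<in>?R. f (fst p) \<otimes> (g (snd p) \<otimes> h (m - fst p - snd p)))"
    by (rule finsum_cong) (auto simp: f g h m_assoc)
  also have "\<dots> = (\<Oplus>l\<in>?S m. \<Oplus>j\<in>?S (m - l). f l \<otimes> (g j \<otimes> h (m - l - j)))"
    by (subst finsum_Sigma) (auto simp: f g h finite_sub_mset)
  also have "\<dots> = (f \<otimes>\<^bsub>pseries_ring R\<^esub> (g \<otimes>\<^bsub>pseries_ring R\<^esub> h)) m"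
    by (simp add: f g h finsum_rdistr finite_sub_mset cong: finsum_cong)
  finally show "((f \<otimes>\<^bsub>pseries_ring R\<^esub> g) \<otimes>\<^bsub>pseries_ring R\<^esub> h) m = (f \<otimes>\<^bsub>pseries_ring R\<^esub> (g \<otimes>\<^bsub>pseries_ring R\<^esub> h)) m" .
qed

lemma pseries_one_mult:
  assumes f: "\<And>m. f m \<in> carrier R"
  shows "\<one>\<^bsub>pseries_ring R\<^esub> \<otimes>\<^bsub>pseries_ring R\<^esub> f = f"
proof
  fix m
  have "(\<one>\<^bsub>pseries_ring R\<^esub> \<otimes>\<^bsub>pseries_ring R\<^esub> f) m
      = (\<Oplus>k\<in>{k. k \<subseteq># m}. if {#} = k then f (m - k) else \<zero>)"
    by (auto simp: f intro!: finsum_cong')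
  also have "\<dots> = f (m - {#})"
    by (rule finsum_singleton) (auto simp: f finite_sub_mset)
  finally show "(\<one>\<^bsub>pseries_ring R\<^esub> \<otimes>\<^bsub>pseries_ring R\<^esub> f) m = f m" by simp
qed

lemma pseries_cring: "cring (pseries_ring R :: ('v, 'a) pseries ring)"
proof (rule cringI)
  let ?P = "pseries_ring R :: ('v, 'a) pseries ring"
  show "abelian_group (?P)"
  proof (rule abelian_groupI)
    fix x assume "x \<in> carrier (?P)"
    then show "\<exists>y\<in>carrier (?P). y \<oplus>\<^bsub>?P\<^esub> x = \<zero>\<^bsub>?P\<^esub>"
      by (intro bexI[of _ "\<lambda>m. \<ominus> x m"]) (auto simp: l_neg)
  qed (auto simp: a_assoc intro: a_comm)
  show "comm_monoid (?P)"
  proof (rule comm_monoidI)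
    fix x y assume xy: "x \<in> carrier (?P)" "y \<in> carrier (?P)"
    then show "x \<otimes>\<^bsub>?P\<^esub> y \<in> carrier (?P)" by auto
    show "x \<otimes>\<^bsub>?P\<^esub> y = y \<otimes>\<^bsub>?P\<^esub> x"
      by (rule pseries_mult_comm) (use xy in auto)
  next
    fix x y z assume "x \<in> carrier (?P)" "y \<in> carrier (?P)" "z \<in> carrier (?P)"
    then show "(x \<otimes>\<^bsub>?P\<^esub> y) \<otimes>\<^bsub>?P\<^esub> z = x \<otimes>\<^bsub>?P\<^esub> (y \<otimes>\<^bsub>?P\<^esub> z)"
      by (intro pseries_mult_assoc) auto
  next
    fix x assume "x \<in> carrier (?P)"
    then show "\<one>\<^bsub>?P\<^esub> \<otimes>\<^bsub>?P\<^esub> x = x" by (intro pseries_one_mult) auto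
  qed auto
  fix x y z assume "x \<in> carrier (?P)" "y \<in> carrier (?P)" "z \<in> carrier (?P)"
  then show "(x \<oplus>\<^bsub>?P\<^esub> y) \<otimes>\<^bsub>?P\<^esub> z =
        x \<otimes>\<^bsub>?P\<^esub> z \<oplus>\<^bsub>?P\<^esub> y \<otimes>\<^bsub>?P\<^esub> z"
    by (auto simp: l_distr finsum_addf)
qed

lemma pseries_minus [simp]:
  fixes f :: "('v, 'a) pseries"
  assumes f: "\<And>m. f m \<in> carrier R"
  shows "\<ominus>\<^bsub>pseries_ring R\<^esub> f = (\<lambda>m. \<ominus> f m)"
proof -
  interpret P: cring "pseries_ring R :: ('v, 'a) pseries ring" by (rule pseries_cring)
  show ?thesis
    by (rule P.minus_equality) (auto simp: f l_neg)
qed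

lemma pseries_diff:
  fixes f :: "('v, 'a) pseries"
  assumes f: "\<And>m. f m \<in> carrier R" and g: "\<And>m. g m \<in> carrier R"
  shows "f \<ominus>\<^bsub>pseries_ring R\<^esub> g = (\<lambda>m. f m \<ominus> g m)"
  by (simp add: f g a_minus_def)


lemma finsum_pseries:
  fixes F :: "'i \<Rightarrow> ('v, 'a) pseries"
  assumes "\<And>i m. F i m \<in> carrier R"
  shows "finsum (pseries_ring R) F A = (\<lambda>m. \<Oplus>i\<in>A. F i m)"
proof -
  interpret P: cring "pseries_ring R :: ('v, 'a) pseries ring" by (rule pseries_cring)
  show ?thesis
    by (induction A rule: infinite_finite_induct) (auto simp: assms)
qed

section \<open>The \<open>I\<close>-adic filtration read off from coefficients\<close>

definition pseries_ord :: "nat \<Rightarrow> ('v, 'a) pseries set" where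
  "pseries_ord k = {f. (\<forall>m. f m \<in> carrier R) \<and> (\<forall>m. size m < k \<longrightarrow> f m = \<zero>)}"

lemma pseries_ord_mult:
  fixes f g :: "('v, 'a) pseries"
  assumes f: "f \<in> pseries_ord i" and g: "g \<in> pseries_ord j"
  shows "f \<otimes>\<^bsub>pseries_ring R\<^esub> g \<in> pseries_ord (i + j)"
proof -
  have c: "f m \<in> carrier R" "g m \<in> carrier R" for m using f g by (auto simp: pseries_ord_def)
  have z: "f k \<otimes> g (m - k) = \<zero>" if "size m < i + j" "k \<subseteq># m" for m k
  proof -
    have "size k + size (m - k) = size m" using that(2) by (metis size_union subset_mset.add_diff_inverse)
    then have "size k < i \<or> size (m - k) < j" using that(1) by linarith
    then show ?thesis using f g c by (auto simp: pseries_ord_def)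
  qed
  have "(\<Oplus>k\<in>{k. k \<subseteq># m}. f k \<otimes> g (m - k)) = \<zero>" if "size m < i + j" for m
    using z[OF that] by (simp add: c cong: finsum_cong)
  then show ?thesis by (auto simp: pseries_ord_def c intro!: finsum_closed)
qed

declare pseries_simps [simp del]

lemma pseries_ord_ideal: "ideal (pseries_ord k :: ('v, 'a) pseries set) (pseries_ring R)"
proof -
  let ?P = "pseries_ring R :: ('v, 'a) pseries ring"
  let ?O = "pseries_ord k :: ('v, 'a) pseries set"
  interpret P: cring ?P by (rule pseries_cring)
  note pseries_simps [simp]
  show ?thesis
  proof (rule idealI)
    show "ring ?P" by (rule P.ring_axioms)
    show "subgroup ?O (add_monoid ?P)"
    proof (rule P.add.subgroupI)
      show "?O \<noteq> {}" by (auto simp: pseries_ord_def)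
      fix a assume a: "a \<in> ?O"
      then show "\<ominus>\<^bsub>?P\<^esub> a \<in> ?O" by (auto simp: pseries_ord_def)
    qed (auto simp: pseries_ord_def)
    fix a x assume a: "a \<in> ?O" and x: "x \<in> carrier ?P"
    then have "x \<in> pseries_ord 0" by (simp add: pseries_ord_def)
    from pseries_ord_mult[OF this a] pseries_ord_mult[OF a this]
    show "x \<otimes>\<^bsub>?P\<^esub> a \<in> ?O" "a \<otimes>\<^bsub>?P\<^esub> x \<in> ?O" by (simp_all del: pseries_simps)
  qed
qed

lemma pseries_var_closed: "pseries_var R v m \<in> carrier R"
  by (simp add: pseries_var_def)

lemma pseries_var_ord: "pseries_var R v \<in> pseries_ord 1"
  by (auto simp: pseries_ord_def pseries_var_def)

lemma pseries_var_mult: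
  assumes h: "\<And>m. h m \<in> carrier R"
  shows "pseries_var R v \<otimes>\<^bsub>pseries_ring R\<^esub> h = (\<lambda>m. if v \<in># m then h (m - {#v#}) else \<zero>)"
proof
  fix m
  have "(pseries_var R v \<otimes>\<^bsub>pseries_ring R\<^esub> h) m
      = (\<Oplus>k\<in>{k. k \<subseteq># m}. if {#v#} = k then h (m - k) else \<zero>)"
    by (auto simp: h pseries_simps pseries_var_def intro!: finsum_cong')
  also have "\<dots> = (if v \<in># m then h (m - {#v#}) else \<zero>)"
  proof (cases "v \<in># m")
    case True
    then show ?thesis using finsum_singleton[of "{#v#}" "{k. k \<subseteq># m}" "\<lambda>k. h (m - k)"]
      by (simp add: h finite_sub_mset)
  next
    case False
    then have "(\<Oplus>k\<in>{k. k \<subseteq># m}. if {#v#} = k then h (m - k) else \<zero>) = (\<Oplus>k\<in>{k. k \<subseteq># m}. \<zero>)"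
      by (intro finsum_cong') auto
    then show ?thesis using False by simp
  qed
  finally show "(pseries_var R v \<otimes>\<^bsub>pseries_ring R\<^esub> h) m = (if v \<in># m then h (m - {#v#}) else \<zero>)" .
qed

text \<open>Each monomial of positive degree is divided by one chosen variable occurring in it.\<close>

lemma pseries_ord_Suc_decomp:
  fixes f :: "('v::finite, 'a) pseries"
  assumes f: "f \<in> pseries_ord (Suc k)"
  obtains g where "\<And>v. g v \<in> pseries_ord k"
    "f = (\<Oplus>\<^bsub>pseries_ring R\<^esub>v\<in>UNIV. pseries_var R v \<otimes>\<^bsub>pseries_ring R\<^esub> g v)"
proof -
  define pick where "pick = (\<lambda>m :: 'v multiset. SOME v. v \<in># m)"
  have pick: "pick m \<in># m" if "m \<noteq> {#}" for m
    using that unfolding pick_def by (meson multiset_nonemptyE someI_ex)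
  define g where "g = (\<lambda>v m. if pick (add_mset v m) = v then f (add_mset v m) else \<zero>)"
  have fc: "f m \<in> carrier R" for m using f by (auto simp: pseries_ord_def)
  have g: "g v \<in> pseries_ord k" for v using f by (auto simp: pseries_ord_def g_def)
  have gc: "g v m \<in> carrier R" for v m by (simp add: g_def fc)
  have "f m = (\<Oplus>v\<in>UNIV. if v \<in># m then g v (m - {#v#}) else \<zero>)" for m
  proof (cases "m = {#}")
    case True
    then show ?thesis using f by (auto simp: pseries_ord_def)
  next
    case False
    have "(\<Oplus>v\<in>UNIV. if v \<in># m then g v (m - {#v#}) else \<zero>) = (\<Oplus>v\<in>UNIV. if pick m = v then f m else \<zero>)"
      by (rule finsum_cong') (use pick[OF False] in \<open>auto simp: g_def fc\<close>)
    also have "\<dots> = f m" by (subst finsum_singleton) (auto simp: fc)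
    finally show ?thesis by simp
  qed
  then have "f = (\<Oplus>\<^bsub>pseries_ring R\<^esub>v\<in>UNIV. pseries_var R v \<otimes>\<^bsub>pseries_ring R\<^esub> g v)"
    by (subst finsum_pseries) (auto simp: gc pseries_var_mult)
  with g that show ?thesis by blast
qed

lemma ideal_prod_finsum:
  assumes "\<And>i. i \<in> A \<Longrightarrow> F i \<in> ideal_prod R I J" "ideal I R" "ideal J R"
  shows "finsum R F A \<in> ideal_prod R I J"
proof -
  interpret K: ideal "ideal_prod R I J" R by (rule ideal_prod_is_ideal) fact+
  show ?thesis using assms(1)
  proof (induction A rule: infinite_finite_induct)
    case (insert x A)
    have "F \<in> A \<rightarrow> carrier R" "F x \<in> carrier R" using insert.prems K.Icarr by auto
    then show ?case using insert by simp
  qed simp_all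
qed

end

text \<open>Finiteness of the index type enters here: a series without constant term is a finite
  combination of the variables. Together with \<open>T_power_eq\<close> this turns membership in a
  power of the ideal into the vanishing of all coefficients of small degree.\<close>

lemma (in plain_cring) T_ideal_eq: "T_ideal R = (pseries_ord 1 :: ('v::finite, 'a) pseries set)"
proof -
  let ?P = "pseries_ring R :: ('v, 'a) pseries ring"
  interpret P: plain_cring ?P by (simp add: plain_cring_def pseries_cring)
  have "f \<in> T_ideal R" if f: "f \<in> pseries_ord (Suc 0)" for f :: "('v, 'a) pseries"
  proof -
    obtain g where g: "\<And>v. g v \<in> pseries_ord 0"
      and fg: "f = (\<Oplus>\<^bsub>?P\<^esub>v\<in>UNIV. pseries_var R v \<otimes>\<^bsub>?P\<^esub> g v)"
      using pseries_ord_Suc_decomp[OF f] by blast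
    have s: "range (pseries_var R) \<subseteq> carrier ?P" by (auto simp: pseries_var_closed pseries_simps)
    interpret I: ideal "T_ideal R" ?P unfolding T_ideal_def by (rule P.genideal_ideal[OF s])
    have v: "pseries_var R v \<in> T_ideal R" for v :: 'v
      unfolding T_ideal_def using P.genideal_self[OF s] by blast
    have i: "pseries_var R v \<otimes>\<^bsub>?P\<^esub> g v \<in> T_ideal R" for v
      by (rule I.I_r_closed[OF v]) (use g[of v] in \<open>auto simp: pseries_ord_def pseries_simps\<close>)
    have "(\<Oplus>\<^bsub>?P\<^esub>v\<in>A. pseries_var R v \<otimes>\<^bsub>?P\<^esub> g v) \<in> T_ideal R" if "finite A" for A
      using that
    proof (induction A)
      case (insert x A)
      have "(\<lambda>v. pseries_var R v \<otimes>\<^bsub>?P\<^esub> g v) \<in> A \<rightarrow> carrier ?P" using i I.Icarr by blast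
      then show ?case using insert i I.Icarr by simp
    qed simp
    then show ?thesis unfolding fg by simp
  qed
  moreover have "T_ideal R \<subseteq> (pseries_ord 1 :: ('v, 'a) pseries set)"
    unfolding T_ideal_def by (rule P.genideal_minimal[OF pseries_ord_ideal]) (use pseries_var_ord in auto)
  ultimately show ?thesis by auto
qed

lemma (in plain_cring) T_power_eq: "T_power R k = (pseries_ord k :: ('v::finite, 'a) pseries set)"
proof (induction k)
  case 0
  show ?case by (auto simp: T_power_def pseries_ord_def pseries_simps)
next
  case (Suc k)
  let ?P = "pseries_ring R :: ('v, 'a) pseries ring"
  interpret P: plain_cring ?P by (simp add: plain_cring_def pseries_cring)
  have e: "T_power R (Suc k) = ideal_prod ?P (pseries_ord 1) (pseries_ord k)"
    using Suc by (simp add: T_power_def T_ideal_eq)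
  have "f \<in> pseries_ord (Suc k)" if "f \<in> ideal_prod ?P (pseries_ord 1) (pseries_ord k)" for f
    using that
  proof induction
    case (prod i j)
    then show ?case using pseries_ord_mult[of i 1 j k] by simp
  next
    case (sum s1 s2)
    then show ?case by (auto simp: pseries_ord_def pseries_simps)
  qed
  moreover have "f \<in> ideal_prod ?P (pseries_ord 1) (pseries_ord k)" if f: "f \<in> pseries_ord (Suc k)" for f
  proof -
    obtain g where g: "\<And>v. g v \<in> pseries_ord k"
      and fg: "f = (\<Oplus>\<^bsub>?P\<^esub>v\<in>UNIV. pseries_var R v \<otimes>\<^bsub>?P\<^esub> g v)"
      using pseries_ord_Suc_decomp[OF f] by blast
    show ?thesis unfolding fg
      by (intro P.ideal_prod_finsum ideal_prod.prod pseries_var_ord g pseries_ord_ideal)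
  qed
  ultimately show ?case by (auto simp: e)
qed

section \<open>Completions\<close>

context plain_cring
begin

lemma p_ideal_ideal: "ideal (p_ideal R p k) R"
  unfolding p_ideal_def by (rule cgenideal_ideal) simp

lemma p_ideal_iff: "x \<in> p_ideal R p k \<longleftrightarrow> (\<exists>c\<in>carrier R. x = [(p ^ k :: nat)] \<cdot> c)"
proof -
  have "c \<otimes> [(p ^ k :: nat)] \<cdot> \<one> = [(p ^ k :: nat)] \<cdot> c" if "c \<in> carrier R" for c
    using that by (simp add: add_pow_rdistr)
  then show ?thesis by (auto simp: p_ideal_def cgenideal_def) metis
qed

lemma p_ideal_antimono: "p_ideal R p (Suc k) \<subseteq> p_ideal R p k"
proof
  fix x assume "x \<in> p_ideal R p (Suc k)"
  then obtain c where c: "c \<in> carrier R" "x = [(p ^ Suc k :: nat)] \<cdot> c" by (auto simp: p_ideal_iff)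
  then have "x = [(p ^ k :: nat)] \<cdot> ([p] \<cdot> c)" by (simp add: add.nat_pow_pow)
  then show "x \<in> p_ideal R p k" using c by (auto simp: p_ideal_iff)
qed

text \<open>A member of the coset in position \<open>k\<close> is an approximation modulo \<open>p\<^sup>k\<close>; the lemmas below
  express the ring operations of the completion through approximations.\<close>

lemma padic_carrier_iff:
  "X \<in> carrier (padic_completion R p) \<longleftrightarrow>
     (\<forall>k. (\<exists>a\<in>carrier R. X k = p_ideal R p k +> a) \<and> X (Suc k) \<subseteq> X k)"
  by (auto simp: padic_completion_def FactRing_def A_RCOSETS_defs a_r_coset_def r_coset_def)

lemma padic_mem:
  assumes X: "X \<in> carrier (padic_completion R p)" and a: "a \<in> X k"
  shows "a \<in> carrier R" "X k = p_ideal R p k +> a"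
proof -
  interpret I: ideal "p_ideal R p k" R by (rule p_ideal_ideal)
  obtain b where b: "b \<in> carrier R" "X k = p_ideal R p k +> b" using X unfolding padic_carrier_iff by blast
  then show "a \<in> carrier R" using a a_r_coset_subset_G[OF I.a_subset b(1)] by auto
  show "X k = p_ideal R p k +> a"
    using a b a_repr_independence[OF _ b(1) I.a_subgroup] by simp
qed

lemma padic_ex:
  assumes X: "X \<in> carrier (padic_completion R p)"
  obtains a where "a \<in> X k"
proof -
  interpret I: ideal "p_ideal R p k" R by (rule p_ideal_ideal)
  show ?thesis using X I.a_rcos_self that by (metis padic_carrier_iff)
qed

lemma padic_ex': "X \<in> carrier (padic_completion R p) \<Longrightarrow> \<exists>a. a \<in> X k"
  by (rule padic_ex) auto

lemma padic_mem_iff: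
  assumes X: "X \<in> carrier (padic_completion R p)" and a: "a \<in> X k" and b: "b \<in> carrier R"
  shows "b \<in> X k \<longleftrightarrow> b \<ominus> a \<in> p_ideal R p k"
proof -
  interpret I: ideal "p_ideal R p k" R by (rule p_ideal_ideal)
  show ?thesis using padic_mem[OF X a] I.a_rcos_module[of a b] b by (simp add: a_minus_def)
qed

lemma padic_eqI:
  assumes X: "X \<in> carrier (padic_completion R p)" and Y: "Y \<in> carrier (padic_completion R p)"
    and "\<And>k. \<exists>a. a \<in> X k \<and> a \<in> Y k"
  shows "X = Y"
proof
  fix k
  obtain a where "a \<in> X k" "a \<in> Y k" using assms by blast
  then show "X k = Y k" using padic_mem(2)[OF X] padic_mem(2)[OF Y] by metis
qed

lemma padic_mem_mono:
  assumes X: "X \<in> carrier (padic_completion R p)" and "a \<in> X (k + l)"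
  shows "a \<in> X k"
  using assms(2) by (induction l) (use X in \<open>auto simp: padic_carrier_iff\<close>)

lemma padic_carrierI:
  assumes "\<And>k. \<exists>a\<in>carrier R. \<exists>b\<in>carrier R. X k = p_ideal R p k +> a \<and>
    X (Suc k) = p_ideal R p (Suc k) +> b \<and> b \<ominus> a \<in> p_ideal R p k"
  shows "X \<in> carrier (padic_completion R p)"
  unfolding padic_carrier_iff
proof (intro allI conjI)
  fix k
  interpret I: ideal "p_ideal R p k" R by (rule p_ideal_ideal)
  obtain a b where ab: "a \<in> carrier R" "b \<in> carrier R" "X k = p_ideal R p k +> a"
    "X (Suc k) = p_ideal R p (Suc k) +> b" "b \<ominus> a \<in> p_ideal R p k" using assms by blast
  then show "\<exists>a\<in>carrier R. X k = p_ideal R p k +> a" by blast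
  have "b \<in> p_ideal R p k +> a" using ab I.a_rcos_module[of a b] by (simp add: a_minus_def)
  then have "p_ideal R p k +> a = p_ideal R p k +> b"
    using a_repr_independence[OF _ ab(1) I.a_subgroup] by simp
  then show "X (Suc k) \<subseteq> X k"
    using ab p_ideal_antimono[of p k] by (auto simp: a_r_coset_def r_coset_def)
qed

lemma p_ideal_minus_self: "a \<in> carrier R \<Longrightarrow> a \<ominus> a \<in> p_ideal R p k"
  by (simp add: a_minus_def r_neg additive_subgroup.zero_closed[OF ideal.axioms(1)[OF p_ideal_ideal]])

lemma padic_add:
  assumes X: "X \<in> carrier (padic_completion R p)" and Y: "Y \<in> carrier (padic_completion R p)"
    and a: "a \<in> X k" and b: "b \<in> Y k"
  shows "(X \<oplus>\<^bsub>padic_completion R p\<^esub> Y) k = p_ideal R p k +> (a \<oplus> b)"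
proof -
  interpret I: ideal "p_ideal R p k" R by (rule p_ideal_ideal)
  note [simp] = padic_mem[OF X a] padic_mem[OF Y b]
  show ?thesis by (simp add: padic_completion_def FactRing_def I.a_rcos_sum)
qed

lemma padic_mult:
  assumes X: "X \<in> carrier (padic_completion R p)" and Y: "Y \<in> carrier (padic_completion R p)"
    and a: "a \<in> X k" and b: "b \<in> Y k"
  shows "(X \<otimes>\<^bsub>padic_completion R p\<^esub> Y) k = p_ideal R p k +> (a \<otimes> b)"
proof -
  interpret I: ideal "p_ideal R p k" R by (rule p_ideal_ideal)
  note [simp] = padic_mem[OF X a] padic_mem[OF Y b]
  show ?thesis by (simp add: padic_completion_def FactRing_def I.rcoset_mult_add)
qed

lemma padic_zero: "\<zero>\<^bsub>padic_completion R p\<^esub> k = p_ideal R p k +> \<zero>"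
proof -
  interpret I: ideal "p_ideal R p k" R by (rule p_ideal_ideal)
  show ?thesis using I.a_subset by (simp add: padic_completion_def FactRing_def)
qed

lemma padic_one: "\<one>\<^bsub>padic_completion R p\<^esub> k = p_ideal R p k +> \<one>"
  by (simp add: padic_completion_def FactRing_def)

lemma p_ideal_rcos_self: "a \<in> carrier R \<Longrightarrow> a \<in> p_ideal R p k +> a"
  by (rule abelian_subgroup.a_rcos_self)
    (auto simp: abelian_subgroupI3 ideal.axioms(1)[OF p_ideal_ideal] abelian_group_axioms)

lemma to_completion_closed: "a \<in> carrier R \<Longrightarrow> to_completion R p a \<in> carrier (padic_completion R p)"
  by (rule padic_carrierI)
    (auto simp: to_completion_def p_ideal_minus_self intro!: bexI[of _ a])

lemma to_completion_mem: "a \<in> carrier R \<Longrightarrow> a \<in> to_completion R p a k"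
  by (simp add: to_completion_def p_ideal_rcos_self)

lemma padic_zero_eq: "\<zero>\<^bsub>padic_completion R p\<^esub> = to_completion R p \<zero>"
  by (auto simp: to_completion_def padic_zero)

lemma padic_one_eq: "\<one>\<^bsub>padic_completion R p\<^esub> = to_completion R p \<one>"
  by (auto simp: to_completion_def padic_one)

lemma padic_add_closed:
  assumes X: "X \<in> carrier (padic_completion R p)" and Y: "Y \<in> carrier (padic_completion R p)"
  shows "X \<oplus>\<^bsub>padic_completion R p\<^esub> Y \<in> carrier (padic_completion R p)"
proof (rule padic_carrierI)
  fix k
  interpret I: ideal "p_ideal R p k" R by (rule p_ideal_ideal)
  obtain a b where ab: "a \<in> X (Suc k)" "b \<in> Y (Suc k)" using padic_ex'[OF X] padic_ex'[OF Y] by blast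
  then have ab': "a \<in> X k" "b \<in> Y k" using padic_mem_mono[OF X, of _ k 1] padic_mem_mono[OF Y, of _ k 1] by auto
  show "\<exists>a\<in>carrier R. \<exists>b\<in>carrier R. (X \<oplus>\<^bsub>padic_completion R p\<^esub> Y) k = p_ideal R p k +> a \<and>
    (X \<oplus>\<^bsub>padic_completion R p\<^esub> Y) (Suc k) = p_ideal R p (Suc k) +> b \<and> b \<ominus> a \<in> p_ideal R p k"
    using padic_add[OF X Y ab] padic_add[OF X Y ab'] padic_mem(1)[OF X ab(1)] padic_mem(1)[OF Y ab(2)]
    by (intro bexI[of _ "a \<oplus> b"]) (auto simp: p_ideal_minus_self)
qed

lemma padic_mult_closed:
  assumes X: "X \<in> carrier (padic_completion R p)" and Y: "Y \<in> carrier (padic_completion R p)"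
  shows "X \<otimes>\<^bsub>padic_completion R p\<^esub> Y \<in> carrier (padic_completion R p)"
proof (rule padic_carrierI)
  fix k
  interpret I: ideal "p_ideal R p k" R by (rule p_ideal_ideal)
  obtain a b where ab: "a \<in> X (Suc k)" "b \<in> Y (Suc k)" using padic_ex'[OF X] padic_ex'[OF Y] by blast
  then have ab': "a \<in> X k" "b \<in> Y k" using padic_mem_mono[OF X, of _ k 1] padic_mem_mono[OF Y, of _ k 1] by auto
  show "\<exists>a\<in>carrier R. \<exists>b\<in>carrier R. (X \<otimes>\<^bsub>padic_completion R p\<^esub> Y) k = p_ideal R p k +> a \<and>
    (X \<otimes>\<^bsub>padic_completion R p\<^esub> Y) (Suc k) = p_ideal R p (Suc k) +> b \<and> b \<ominus> a \<in> p_ideal R p k"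
    using padic_mult[OF X Y ab] padic_mult[OF X Y ab'] padic_mem(1)[OF X ab(1)] padic_mem(1)[OF Y ab(2)]
    by (intro bexI[of _ "a \<otimes> b"]) (auto simp: p_ideal_minus_self)
qed

lemma padic_add_mem:
  assumes X: "X \<in> carrier (padic_completion R p)" and Y: "Y \<in> carrier (padic_completion R p)"
    and a: "a \<in> X k" and b: "b \<in> Y k"
  shows "a \<oplus> b \<in> (X \<oplus>\<^bsub>padic_completion R p\<^esub> Y) k"
  using padic_add[OF assms] p_ideal_rcos_self padic_mem(1)[OF X a] padic_mem(1)[OF Y b] by simp

lemma padic_mult_mem:
  assumes X: "X \<in> carrier (padic_completion R p)" and Y: "Y \<in> carrier (padic_completion R p)"
    and a: "a \<in> X k" and b: "b \<in> Y k"
  shows "a \<otimes> b \<in> (X \<otimes>\<^bsub>padic_completion R p\<^esub> Y) k"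
  using padic_mult[OF assms] p_ideal_rcos_self padic_mem(1)[OF X a] padic_mem(1)[OF Y b] by simp

text \<open>The ring laws hold level by level in the quotients by \<open>p ^ k\<close>.
  Representatives are needed only to see that the operations produce compatible sequences of cosets
  again.\<close>

lemma padic_cring: "cring (padic_completion R p)"
proof (rule cringI)
  let ?C = "padic_completion R p" and ?Q = "\<lambda>k. R Quot p_ideal R p k"
  have Q: "cring (?Q k)" for k by (rule ideal.quotient_is_cring[OF p_ideal_ideal is_cring])
  have level: "X k \<in> carrier (?Q k)" if "X \<in> carrier ?C" for X k
    using that by (auto simp: padic_completion_def)
  have ops: "(X \<oplus>\<^bsub>?C\<^esub> Y) = (\<lambda>k. X k \<oplus>\<^bsub>?Q k\<^esub> Y k)" "(X \<otimes>\<^bsub>?C\<^esub> Y) = (\<lambda>k. X k \<otimes>\<^bsub>?Q k\<^esub> Y k)"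
    "\<zero>\<^bsub>?C\<^esub> = (\<lambda>k. \<zero>\<^bsub>?Q k\<^esub>)" "\<one>\<^bsub>?C\<^esub> = (\<lambda>k. \<one>\<^bsub>?Q k\<^esub>)" for X Y
    by (simp_all add: padic_completion_def)
  show "abelian_group ?C"
  proof (rule abelian_groupI)
    show z: "\<zero>\<^bsub>?C\<^esub> \<in> carrier ?C" by (simp add: padic_zero_eq to_completion_closed)
    fix X assume X: "X \<in> carrier ?C"
    define f where "f = (\<lambda>k. SOME a. a \<in> X k)"
    define Y where "Y = (\<lambda>k. p_ideal R p k +> \<ominus> f k)"
    have f: "f k \<in> X k" for k
      using padic_ex'[OF X] by (auto simp: f_def intro: someI_ex)
    have fc: "f k \<in> carrier R" for k by (rule padic_mem(1)[OF X f])
    have Yc: "Y \<in> carrier ?C"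
    proof (rule padic_carrierI)
      fix k
      have "f (Suc k) \<in> X k" using padic_mem_mono[OF X, of _ k 1] f[of "Suc k"] by simp
      then have "f k \<ominus> f (Suc k) \<in> p_ideal R p k" using padic_mem_iff[OF X, of "f (Suc k)" k "f k"] f fc by simp
      moreover have "\<ominus> f (Suc k) \<ominus> \<ominus> f k = f k \<ominus> f (Suc k)" using fc by (simp add: a_minus_def a_comm)
      ultimately show "\<exists>a\<in>carrier R. \<exists>b\<in>carrier R. Y k = p_ideal R p k +> a \<and>
        Y (Suc k) = p_ideal R p (Suc k) +> b \<and> b \<ominus> a \<in> p_ideal R p k"
        by (intro bexI[of _ "\<ominus> f k"] bexI[of _ "\<ominus> f (Suc k)"]) (auto simp: Y_def fc)
    qed
    have "Y \<oplus>\<^bsub>?C\<^esub> X = \<zero>\<^bsub>?C\<^esub>"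
    proof (rule padic_eqI[where p = p])
      fix k
      have "\<ominus> f k \<oplus> f k \<in> (Y \<oplus>\<^bsub>?C\<^esub> X) k"
        by (rule padic_add_mem[OF Yc X _ f]) (simp add: Y_def fc p_ideal_rcos_self)
      then show "\<exists>a. a \<in> (Y \<oplus>\<^bsub>?C\<^esub> X) k \<and> a \<in> \<zero>\<^bsub>?C\<^esub> k"
        by (auto simp: fc l_neg padic_zero_eq to_completion_mem)
    qed (simp_all add: X Yc z padic_add_closed)
    then show "\<exists>Y\<in>carrier ?C. Y \<oplus>\<^bsub>?C\<^esub> X = \<zero>\<^bsub>?C\<^esub>" using Yc by blast
  qed (simp_all add: padic_add_closed[where p = p, unfolded ops] ops cring.cring_simprules[OF Q] level)
  have oc: "(\<lambda>k. \<one>\<^bsub>?Q k\<^esub>) \<in> carrier ?C"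
    unfolding ops(4)[symmetric] padic_one_eq by (simp add: to_completion_closed)
  show "comm_monoid ?C"
    by (rule comm_monoidI)
      (simp_all add: padic_mult_closed[where p = p, unfolded ops] oc ops cring.cring_simprules[OF Q] level monoid.r_one[OF ring.is_monoid[OF cring.axioms(1)[OF Q]]])
  fix X Y Z assume "X \<in> carrier ?C" "Y \<in> carrier ?C" "Z \<in> carrier ?C"
  then show "(X \<oplus>\<^bsub>?C\<^esub> Y) \<otimes>\<^bsub>?C\<^esub> Z = X \<otimes>\<^bsub>?C\<^esub> Z \<oplus>\<^bsub>?C\<^esub> Y \<otimes>\<^bsub>?C\<^esub> Z"
    by (simp add: ops cring.cring_simprules[OF Q] level)
qed

lemma to_completion_add:
  assumes "a \<in> carrier R" "b \<in> carrier R"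
  shows "to_completion R p (a \<oplus> b) = to_completion R p a \<oplus>\<^bsub>padic_completion R p\<^esub> to_completion R p b"
  by (rule padic_eqI[where p = p])
    (use assms in \<open>auto intro!: exI[of _ "a \<oplus> b"] to_completion_closed to_completion_mem padic_add_closed padic_add_mem\<close>)

lemma to_completion_mult:
  assumes "a \<in> carrier R" "b \<in> carrier R"
  shows "to_completion R p (a \<otimes> b) = to_completion R p a \<otimes>\<^bsub>padic_completion R p\<^esub> to_completion R p b"
  by (rule padic_eqI[where p = p])
    (use assms in \<open>auto intro!: exI[of _ "a \<otimes> b"] to_completion_closed to_completion_mem padic_mult_closed padic_mult_mem\<close>)

lemma to_completion_eq_iff:
  assumes "a \<in> carrier R" "b \<in> carrier R"
  shows "to_completion R p a = to_completion R p b \<longleftrightarrow> (\<forall>k. a \<ominus> b \<in> p_ideal R p k)"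
proof -
  have "to_completion R p a = to_completion R p b \<longleftrightarrow> (\<forall>k. a \<in> to_completion R p b k)"
    using assms padic_eqI[OF to_completion_closed to_completion_closed] to_completion_mem by metis
  also have "\<dots> \<longleftrightarrow> (\<forall>k. a \<ominus> b \<in> p_ideal R p k)"
    using padic_mem_iff[OF to_completion_closed[OF assms(2)] to_completion_mem[OF assms(2)] assms(1)] by simp
  finally show ?thesis .
qed

lemma padic_add_pow_mem:
  assumes X: "X \<in> carrier (padic_completion R p)" and a: "a \<in> X k"
  shows "[(n::nat)] \<cdot> a \<in> ([n] \<cdot>\<^bsub>padic_completion R p\<^esub> X) k"
proof -
  interpret C: cring "padic_completion R p" by (rule padic_cring)
  show ?thesis
    by (induction n) (auto simp: padic_zero_eq to_completion_mem X a intro!: padic_add_mem)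
qed

lemma padic_nat_pow_mem:
  assumes X: "X \<in> carrier (padic_completion R p)" and a: "a \<in> X k"
  shows "a [^] (n::nat) \<in> (X [^]\<^bsub>padic_completion R p\<^esub> n) k"
proof -
  interpret C: cring "padic_completion R p" by (rule padic_cring)
  show ?thesis
    by (induction n) (auto simp: padic_one_eq to_completion_mem X a intro!: padic_mult_mem)
qed

lemma padic_a_inv_mem:
  assumes X: "X \<in> carrier (padic_completion R p)" and a: "a \<in> X k"
  shows "\<ominus> a \<in> (\<ominus>\<^bsub>padic_completion R p\<^esub> X) k"
proof -
  interpret C: cring "padic_completion R p" by (rule padic_cring)
  have c: "\<ominus>\<^bsub>padic_completion R p\<^esub> X \<in> carrier (padic_completion R p)" using X by simp
  obtain b where b: "b \<in> (\<ominus>\<^bsub>padic_completion R p\<^esub> X) k" using padic_ex[OF c] by blast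
  have bc: "b \<in> carrier R" "a \<in> carrier R" using padic_mem(1)[OF c b] padic_mem(1)[OF X a] .
  have "a \<oplus> b \<in> \<zero>\<^bsub>padic_completion R p\<^esub> k"
    using padic_add_mem[OF X c a b] X by (simp add: C.r_neg)
  then have "a \<oplus> b \<in> p_ideal R p k"
    using padic_mem_iff[OF to_completion_closed[OF zero_closed] to_completion_mem[OF zero_closed], of "a \<oplus> b" p k] bc
    by (simp add: padic_zero_eq a_minus_def)
  then have "\<ominus> (a \<oplus> b) \<in> p_ideal R p k"
    using additive_subgroup.a_inv_closed[OF ideal.axioms(1)[OF p_ideal_ideal]] by blast
  then have "\<ominus> a \<ominus> b \<in> p_ideal R p k" using bc by (simp add: minus_add a_minus_def)
  then show ?thesis using padic_mem_iff[OF c b] bc by simp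
qed

text \<open>At level \<open>k + j\<close> a representative has the form \<open>p ^ k\<close> times
  \<open>c j\<close>, and the absence of \<open>p ^ k\<close>-torsion makes \<open>c j\<close> well
  defined modulo \<open>p ^ j\<close>, so that the \<open>c j\<close> form an element of the
  completion. A condition on one level thus becomes divisibility, which every ring homomorphism
  preserves.\<close>

lemma padic_level_zero_imp_dvd:
  assumes X: "X \<in> carrier (padic_completion R p)" and z: "\<zero> \<in> X k"
    and tf: "\<And>c. c \<in> carrier R \<Longrightarrow> [(p ^ k :: nat)] \<cdot> c = \<zero> \<Longrightarrow> c = \<zero>"
  obtains C where "C \<in> carrier (padic_completion R p)" "X = [(p ^ k :: nat)] \<cdot>\<^bsub>padic_completion R p\<^esub> C"
proof -
  let ?C = "padic_completion R p"
  interpret C: cring ?C by (rule padic_cring)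
  have "\<exists>c. c \<in> carrier R \<and> [(p ^ k :: nat)] \<cdot> c \<in> X (k + j)" for j
  proof -
    obtain a where a: "a \<in> X (k + j)" using padic_ex'[OF X] by blast
    then have "a \<in> X k" using padic_mem_mono[OF X] by blast
    then have "a \<in> p_ideal R p k" using padic_mem_iff[OF X z] padic_mem(1)[OF X a] by (simp add: a_minus_def)
    then show ?thesis using a by (auto simp: p_ideal_iff)
  qed
  then obtain c where c: "\<And>j. c j \<in> carrier R" "\<And>j. [(p ^ k :: nat)] \<cdot> c j \<in> X (k + j)" by metis
  define Y where "Y = (\<lambda>j. p_ideal R p j +> c j)"
  have Y: "Y \<in> carrier ?C"
  proof (rule padic_carrierI)
    fix j
    have "[(p ^ k :: nat)] \<cdot> c (Suc j) \<in> X (k + j)" using padic_mem_mono[OF X, of _ "k + j" 1] c(2)[of "Suc j"] by simp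
    then have "[(p ^ k :: nat)] \<cdot> c (Suc j) \<ominus> [(p ^ k :: nat)] \<cdot> c j \<in> p_ideal R p (k + j)"
      using padic_mem_iff[OF X c(2)] c(1) by simp
    then obtain d where d: "d \<in> carrier R" "[(p ^ k :: nat)] \<cdot> c (Suc j) \<ominus> [(p ^ k :: nat)] \<cdot> c j = [(p ^ (k + j) :: nat)] \<cdot> d"
      by (auto simp: p_ideal_iff)
    have "[(p ^ k :: nat)] \<cdot> (c (Suc j) \<ominus> c j \<ominus> [(p ^ j :: nat)] \<cdot> d) =
        [(p ^ k :: nat)] \<cdot> c (Suc j) \<ominus> [(p ^ k :: nat)] \<cdot> c j \<ominus> [(p ^ (k + j) :: nat)] \<cdot> d"
      using c(1) d(1) by (simp add: a_minus_def add.nat_pow_distrib add.nat_pow_inv add.nat_pow_pow power_add mult.commute)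
    also have "\<dots> = \<zero>" using d c(1) by (simp add: a_minus_def r_neg)
    finally have "c (Suc j) \<ominus> c j \<ominus> [(p ^ j :: nat)] \<cdot> d = \<zero>"
      by (rule tf[rotated]) (simp add: c d(1))
    then have "c (Suc j) \<ominus> c j = [(p ^ j :: nat)] \<cdot> d" using c(1) d(1) by (simp add: r_right_minus_eq)
    then have "c (Suc j) \<ominus> c j \<in> p_ideal R p j" using d by (auto simp: p_ideal_iff)
    then show "\<exists>a\<in>carrier R. \<exists>b\<in>carrier R. Y j = p_ideal R p j +> a \<and>
      Y (Suc j) = p_ideal R p (Suc j) +> b \<and> b \<ominus> a \<in> p_ideal R p j"
      by (intro bexI[of _ "c j"] bexI[of _ "c (Suc j)"]) (auto simp: Y_def c)
  qed
  have "X = [(p ^ k :: nat)] \<cdot>\<^bsub>?C\<^esub> Y"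
  proof (rule padic_eqI[OF X])
    show "[(p ^ k :: nat)] \<cdot>\<^bsub>?C\<^esub> Y \<in> carrier ?C" using Y by simp
    fix j
    have "[(p ^ k :: nat)] \<cdot> c j \<in> X j" using padic_mem_mono[OF X, of _ j k] c(2)[of j] by (simp add: add.commute)
    moreover have "c j \<in> Y j" by (simp add: Y_def c p_ideal_rcos_self)
    ultimately show "\<exists>a. a \<in> X j \<and> a \<in> ([(p ^ k :: nat)] \<cdot>\<^bsub>?C\<^esub> Y) j"
      using padic_add_pow_mem[OF Y] by blast
  qed
  with Y that show ?thesis by blast
qed

lemma padic_dvd_imp_level_zero:
  assumes C: "C \<in> carrier (padic_completion R p)"
  shows "\<zero> \<in> ([(p ^ k :: nat)] \<cdot>\<^bsub>padic_completion R p\<^esub> C) k"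
proof -
  interpret C: cring "padic_completion R p" by (rule padic_cring)
  obtain c where c: "c \<in> C k" using padic_ex[OF C] by blast
  have cc: "c \<in> carrier R" using padic_mem(1)[OF C c] .
  have "\<zero> \<ominus> [(p ^ k :: nat)] \<cdot> c = [(p ^ k :: nat)] \<cdot> (\<ominus> c)"
    using cc by (simp add: a_minus_def add.nat_pow_inv)
  then have "\<zero> \<ominus> [(p ^ k :: nat)] \<cdot> c \<in> p_ideal R p k" using cc by (auto simp: p_ideal_iff)
  then show ?thesis
    using padic_mem_iff[of "[(p ^ k :: nat)] \<cdot>\<^bsub>padic_completion R p\<^esub> C" p "[(p ^ k :: nat)] \<cdot> c" k \<zero>]
      padic_add_pow_mem[OF C c] C by simp
qed

lemma padic_separated:
  assumes X: "X \<in> carrier (padic_completion R p)"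
    and d: "\<And>k. \<exists>C\<in>carrier (padic_completion R p). X = [(p ^ k :: nat)] \<cdot>\<^bsub>padic_completion R p\<^esub> C"
  shows "X = \<zero>\<^bsub>padic_completion R p\<^esub>"
proof -
  interpret C: cring "padic_completion R p" by (rule padic_cring)
  show ?thesis
  proof (rule padic_eqI[OF X])
    fix k
    obtain C where "C \<in> carrier (padic_completion R p)" "X = [(p ^ k :: nat)] \<cdot>\<^bsub>padic_completion R p\<^esub> C"
      using d by blast
    then have "\<zero> \<in> X k" using padic_dvd_imp_level_zero by simp
    then show "\<exists>a. a \<in> X k \<and> a \<in> \<zero>\<^bsub>padic_completion R p\<^esub> k"
      by (auto simp: padic_zero_eq to_completion_mem)
  qed simp
qed

end

section \<open>Matrices and complex power series\<close>

lemma (in abelian_monoid) finsum_swap: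
  assumes "finite A" "finite B" and f: "\<And>a b. f a b \<in> carrier G"
  shows "(\<Oplus>a\<in>A. \<Oplus>b\<in>B. f a b) = (\<Oplus>b\<in>B. \<Oplus>a\<in>A. f a b)"
  using \<open>finite A\<close>
proof induction
  case (insert x A)
  then have "(\<Oplus>a\<in>insert x A. \<Oplus>b\<in>B. f a b) = (\<Oplus>b\<in>B. f x b) \<oplus> (\<Oplus>b\<in>B. \<Oplus>a\<in>A. f a b)"
    by (simp add: f)
  also have "\<dots> = (\<Oplus>b\<in>B. f x b \<oplus> (\<Oplus>a\<in>A. f a b))"
    by (rule finsum_addf[symmetric]) (auto simp: f)
  finally show ?case using insert by (simp add: f cong: finsum_cong)
qed simp

lemma mat_ring_simps:
  "a \<in> carrier (mat_ring R) \<longleftrightarrow> (\<forall>i j. a i j \<in> carrier R)"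
  "a \<otimes>\<^bsub>mat_ring R\<^esub> b = (\<lambda>i j. \<Oplus>\<^bsub>R\<^esub>k\<in>UNIV. a i k \<otimes>\<^bsub>R\<^esub> b k j)"
  "\<one>\<^bsub>mat_ring R\<^esub> = (\<lambda>i j. if i = j then \<one>\<^bsub>R\<^esub> else \<zero>\<^bsub>R\<^esub>)"
  "\<zero>\<^bsub>mat_ring R\<^esub> = (\<lambda>i j. \<zero>\<^bsub>R\<^esub>)"
  "a \<oplus>\<^bsub>mat_ring R\<^esub> b = (\<lambda>i j. a i j \<oplus>\<^bsub>R\<^esub> b i j)"
  by (simp_all add: mat_ring_def)

context plain_cring
begin

lemma mat_ring_ring: "ring (mat_ring R :: ('n::finite, 'a) matrix ring)"
proof (rule ringI)
  let ?M = "mat_ring R :: ('n, 'a) matrix ring"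
  show "abelian_group ?M"
  proof (rule abelian_groupI)
    fix a assume "a \<in> carrier ?M"
    then show "\<exists>b\<in>carrier ?M. b \<oplus>\<^bsub>?M\<^esub> a = \<zero>\<^bsub>?M\<^esub>"
      by (intro bexI[of _ "\<lambda>i j. \<ominus> a i j"]) (auto simp: mat_ring_simps l_neg)
  next
    fix a b assume "a \<in> carrier ?M" "b \<in> carrier ?M"
    then show "a \<oplus>\<^bsub>?M\<^esub> b = b \<oplus>\<^bsub>?M\<^esub> a" by (simp add: mat_ring_simps a_comm)
  qed (auto simp: mat_ring_simps a_assoc)
  show "monoid ?M"
  proof (rule monoidI)
    fix a b c assume "a \<in> carrier ?M" "b \<in> carrier ?M" "c \<in> carrier ?M"
    then have abc: "a i j \<in> carrier R" "b i j \<in> carrier R" "c i j \<in> carrier R" for i j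
      by (auto simp: mat_ring_simps)
    have "(\<Oplus>k\<in>UNIV. (\<Oplus>l\<in>UNIV. a i l \<otimes> b l k) \<otimes> c k j) = (\<Oplus>l\<in>UNIV. a i l \<otimes> (\<Oplus>k\<in>UNIV. b l k \<otimes> c k j))" for i j
      using finsum_swap[of UNIV UNIV "\<lambda>k l. a i l \<otimes> (b l k \<otimes> c k j)"]
      by (simp add: abc finsum_ldistr finsum_rdistr m_assoc cong: finsum_cong)
    then show "a \<otimes>\<^bsub>?M\<^esub> b \<otimes>\<^bsub>?M\<^esub> c = a \<otimes>\<^bsub>?M\<^esub> (b \<otimes>\<^bsub>?M\<^esub> c)"
      by (simp add: mat_ring_simps)
  next
    fix a assume "a \<in> carrier ?M"
    then have a: "a i j \<in> carrier R" for i j by (auto simp: mat_ring_simps)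
    have "(\<Oplus>k\<in>UNIV. (if i = k then \<one> else \<zero>) \<otimes> a k j) = (\<Oplus>k\<in>UNIV. if i = k then a k j else \<zero>)" for i j
      by (auto simp: a intro!: finsum_cong')
    then show "\<one>\<^bsub>?M\<^esub> \<otimes>\<^bsub>?M\<^esub> a = a"
      by (simp add: mat_ring_simps finsum_singleton a)
    have "(\<Oplus>k\<in>UNIV. a i k \<otimes> (if k = j then \<one> else \<zero>)) = (\<Oplus>k\<in>UNIV. if j = k then a i k else \<zero>)" for i j
      by (auto simp: a intro!: finsum_cong')
    then show "a \<otimes>\<^bsub>?M\<^esub> \<one>\<^bsub>?M\<^esub> = a"
      by (simp add: mat_ring_simps finsum_singleton a)
  qed (auto simp: mat_ring_simps intro!: finsum_closed)
  fix a b c assume "a \<in> carrier ?M" "b \<in> carrier ?M" "c \<in> carrier ?M"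
  then have abc: "a i j \<in> carrier R" "b i j \<in> carrier R" "c i j \<in> carrier R" for i j
    by (auto simp: mat_ring_simps)
  show "(a \<oplus>\<^bsub>?M\<^esub> b) \<otimes>\<^bsub>?M\<^esub> c = a \<otimes>\<^bsub>?M\<^esub> c \<oplus>\<^bsub>?M\<^esub> b \<otimes>\<^bsub>?M\<^esub> c"
    by (simp add: mat_ring_simps abc l_distr finsum_addf)
  show "c \<otimes>\<^bsub>?M\<^esub> (a \<oplus>\<^bsub>?M\<^esub> b) = c \<otimes>\<^bsub>?M\<^esub> a \<oplus>\<^bsub>?M\<^esub> c \<otimes>\<^bsub>?M\<^esub> b"
    by (simp add: mat_ring_simps abc r_distr finsum_addf)
qed

lemma mat_ring_a_inv:
  fixes a :: "('n::finite, 'a) matrix"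
  assumes a: "\<And>i j. a i j \<in> carrier R"
  shows "\<ominus>\<^bsub>mat_ring R\<^esub> a = (\<lambda>i j. \<ominus> a i j)"
proof -
  interpret M: ring "mat_ring R :: ('n, 'a) matrix ring" by (rule mat_ring_ring)
  show ?thesis
    by (rule M.minus_equality) (auto simp: a l_neg mat_ring_simps)
qed

lemma mat_ring_minus:
  fixes a :: "('n::finite, 'a) matrix"
  assumes a: "\<And>i j. a i j \<in> carrier R" and b: "\<And>i j. b i j \<in> carrier R"
  shows "a \<ominus>\<^bsub>mat_ring R\<^esub> b = (\<lambda>i j. a i j \<ominus> b i j)"
  by (simp add: a b a_minus_def mat_ring_a_inv mat_ring_simps)

lemma mat_ring_finsum:
  fixes F :: "'i \<Rightarrow> ('n::finite, 'a) matrix"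
  assumes "\<And>l i j. F l i j \<in> carrier R"
  shows "finsum (mat_ring R) F A = (\<lambda>i j. \<Oplus>l\<in>A. F l i j)"
proof -
  interpret M: ring "mat_ring R :: ('n, 'a) matrix ring" by (rule mat_ring_ring)
  show ?thesis
    by (induction A rule: infinite_finite_induct) (auto simp: assms mat_ring_simps)
qed

lemma mat_transpose_mult:
  fixes a b :: "('n::finite, 'a) matrix"
  assumes "\<And>i j. a i j \<in> carrier R" "\<And>i j. b i j \<in> carrier R"
  shows "mat_transpose (a \<otimes>\<^bsub>mat_ring R\<^esub> b) = mat_transpose b \<otimes>\<^bsub>mat_ring R\<^esub> mat_transpose a"
  by (simp add: mat_ring_simps mat_transpose_def m_comm assms)

end

text \<open>All complex power series as a type, so that they form an instance of
  \<open>comm_ring_1\<close> and ring arithmetic in the type class applies. The series over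
  \<open>A\<close> are cut out later as the subset \<open>PA\<close>, and \<open>cf\<close> leads
  back to the rings given as records.\<close>

typedef 'v mps = "UNIV :: ('v multiset \<Rightarrow> complex) set" morphisms cf Mps by simp

lemma cf_Mps [simp]: "cf (Mps f) = f" by (simp add: Mps_inverse)

lemma Mps_cf [simp]: "Mps (cf F) = F" by (rule cf_inverse)

lemma mps_eqI: "(\<And>m. cf F m = cf G m) \<Longrightarrow> F = G"
  by (metis cf_inject ext)

locale coeff_ring =
  fixes A :: "complex ring" and K :: "complex set"
  assumes A_eq: "A = complex_ring\<lparr>carrier := K\<rparr>"
    and K_one: "1 \<in> K" and K_add: "x \<in> K \<Longrightarrow> y \<in> K \<Longrightarrow> x + y \<in> K"
    and K_uminus: "x \<in> K \<Longrightarrow> - x \<in> K" and K_mult: "x \<in> K \<Longrightarrow> y \<in> K \<Longrightarrow> x * y \<in> K"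
begin

lemma K_zero: "0 \<in> K" using K_add[OF K_one K_uminus[OF K_one]] by simp

lemma K_sum: "(\<And>i. i \<in> I \<Longrightarrow> f i \<in> K) \<Longrightarrow> sum f I \<in> K"
  by (induction I rule: infinite_finite_induct) (auto simp: K_zero K_add)

lemma A_simps [simp]:
  "carrier A = K" "x \<otimes>\<^bsub>A\<^esub> y = x * y" "\<one>\<^bsub>A\<^esub> = 1"
  "\<zero>\<^bsub>A\<^esub> = 0" "x \<oplus>\<^bsub>A\<^esub> y = x + y"
  by (simp_all add: A_eq complex_ring_def)

lemma A_cring: "cring A"
proof (rule cringI)
  show "abelian_group A"
    by (rule abelian_groupI) (auto simp: K_add K_zero intro!: bexI[OF _ K_uminus])
  show "comm_monoid A"
    by (rule comm_monoidI) (auto simp: K_mult K_one)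
qed (auto simp: algebra_simps)

sublocale plain_cring A by (simp add: plain_cring_def A_cring)

lemma A_finsum: "(\<And>i. i \<in> I \<Longrightarrow> f i \<in> K) \<Longrightarrow> finsum A f I = sum f I"
  by (induction I rule: infinite_finite_induct) (auto simp: Pi_def)

lemma A_a_inv: "x \<in> K \<Longrightarrow> \<ominus>\<^bsub>A\<^esub> x = - x"
  by (rule minus_equality) (auto simp: K_uminus)

lemma A_minus: "x \<in> K \<Longrightarrow> y \<in> K \<Longrightarrow> x \<ominus>\<^bsub>A\<^esub> y = x - y"
  by (simp add: a_minus_def A_a_inv)

lemma A_add_pow: "[(n::nat)] \<cdot>\<^bsub>A\<^esub> x = of_nat n * x"
  by (induction n) (auto simp: algebra_simps)

lemma A_nat_pow: "x [^]\<^bsub>A\<^esub> (n::nat) = x ^ n"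
  by (induction n) (auto simp: algebra_simps)

lemma A_p_ideal_iff: "x \<in> p_ideal A p k \<longleftrightarrow> (\<exists>c\<in>K. x = of_nat (p ^ k) * c)"
  using p_ideal_iff[of x p k] by (simp add: A_add_pow)

end

interpretation CR: coeff_ring complex_ring UNIV
  by unfold_locales (auto simp: complex_ring_def)

instantiation mps :: (type) comm_ring_1
begin

definition "0 = Mps (\<lambda>m. 0)"
definition "1 = Mps (\<lambda>m. if m = {#} then 1 else 0)"
definition "F + G = Mps (\<lambda>m. cf F m + cf G m)"
definition "F - G = Mps (\<lambda>m. cf F m - cf G m)"
definition "- F = Mps (\<lambda>m. - cf F m)"
definition "F * G = Mps (\<lambda>m. \<Sum>k\<in>{k. k \<subseteq># m}. cf F k * cf G (m - k))"

instance
proof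
  interpret P: cring "pseries_ring complex_ring :: ('a, complex) pseries ring" by (rule CR.pseries_cring)
  have m: "cf (F * G) = cf F \<otimes>\<^bsub>pseries_ring complex_ring\<^esub> cf G" for F G :: "'a mps"
    by (simp add: times_mps_def pseries_simps CR.A_finsum)
  have p: "cf (F + G) = cf F \<oplus>\<^bsub>pseries_ring complex_ring\<^esub> cf G" for F G :: "'a mps"
    by (simp add: plus_mps_def pseries_simps)
  have o: "cf (1 :: 'a mps) = \<one>\<^bsub>pseries_ring complex_ring\<^esub>"
    by (auto simp: one_mps_def pseries_simps)
  have c: "cf F \<in> carrier (pseries_ring complex_ring)" for F :: "'a mps"
    by (simp add: pseries_simps)
  fix F G H :: "'a mps"
  show "F * G * H = F * (G * H)" by (simp add: cf_inject[symmetric] m c P.m_assoc)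
  show "F * G = G * F" by (simp add: cf_inject[symmetric] m c P.m_comm)
  show "1 * F = F" by (simp add: cf_inject[symmetric] m c o)
  show "(F + G) * H = F * H + G * H" by (simp add: cf_inject[symmetric] m c p P.l_distr)
  have "cf (0 :: 'a mps) {#} \<noteq> cf (1 :: 'a mps) {#}" by (simp add: zero_mps_def one_mps_def)
  then show "(0 :: 'a mps) \<noteq> 1" by metis
qed (simp_all add: plus_mps_def zero_mps_def uminus_mps_def minus_mps_def cf_inject[symmetric] algebra_simps)

end

lemma cf_simps [simp]:
  "cf 0 m = 0" "cf (F + G) m = cf F m + cf G m" "cf (F - G) m = cf F m - cf G m" "cf (- F) m = - cf F m"
  by (simp_all add: zero_mps_def plus_mps_def minus_mps_def uminus_mps_def)

lemma cf_one: "cf 1 m = (if m = {#} then 1 else 0)"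
  by (simp add: one_mps_def)

lemma cf_mult: "cf (F * G) m = (\<Sum>k\<in>{k. k \<subseteq># m}. cf F k * cf G (m - k))"
  by (simp add: times_mps_def)

lemma cf_sum: "cf (sum F I) m = (\<Sum>i\<in>I. cf (F i) m)"
  by (induction I rule: infinite_finite_induct) auto

definition cst :: "complex \<Rightarrow> 'v mps" where
  "cst c = Mps (\<lambda>m. if m = {#} then c else 0)"

definition tv :: "'v \<Rightarrow> 'v mps" where
  "tv v = Mps (\<lambda>m. if m = {#v#} then 1 else 0)"

lemma cf_cst: "cf (cst c) m = (if m = {#} then c else 0)"
  by (simp add: cst_def)

lemma cf_tv: "cf (tv v) m = (if m = {#v#} then 1 else 0)"
  by (simp add: tv_def)

lemma cf_cst_mult [simp]: "cf (cst c * F) m = c * cf F m"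
proof -
  have "cf (cst c * F) m = (\<Sum>k\<in>{k. k \<subseteq># m}. if k = {#} then c * cf F (m - k) else 0)"
    by (auto simp: cf_mult cf_cst intro!: sum.cong)
  also have "\<dots> = c * cf F m" using finite_sub_mset[of m] by (simp add: sum.delta)
  finally show ?thesis .
qed

lemma cst_0 [simp]: "cst 0 = 0" and cst_1: "cst 1 = 1"
  and cst_add: "cst (a + b) = cst a + cst b" and cst_mult: "cst (a * b) = cst a * cst b"
  and cst_uminus: "cst (- a) = - cst a" and cst_diff: "cst (a - b) = cst a - cst b"
  by (auto intro!: mps_eqI simp: cf_cst cf_one)

lemma cst_of_nat: "cst (of_nat n) = of_nat n"
  by (induction n) (auto simp: cst_add cst_1)

lemma cst_power: "cst (a ^ n) = cst a ^ n"
  by (induction n) (auto simp: cst_mult cst_1)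

lemma cf_of_nat_mult [simp]: "cf (of_nat n * F) m = of_nat n * cf F m"
  using cf_cst_mult[of "of_nat n" F m] by (simp add: cst_of_nat)

section \<open>Order of vanishing and \<open>T\<close>-adic sums\<close>

definition tord :: "nat \<Rightarrow> 'v mps set" where
  "tord k = {F. \<forall>m. size m < k \<longrightarrow> cf F m = 0}"

lemma tord_0 [simp]: "F \<in> tord 0" by (simp add: tord_def)

lemma tord_zero [simp]: "0 \<in> tord k" by (simp add: tord_def)

lemma tord_add: "F \<in> tord k \<Longrightarrow> G \<in> tord k \<Longrightarrow> F + G \<in> tord k"
  and tord_diff: "F \<in> tord k \<Longrightarrow> G \<in> tord k \<Longrightarrow> F - G \<in> tord k"
  and tord_uminus: "F \<in> tord k \<Longrightarrow> - F \<in> tord k"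
  by (auto simp: tord_def)

lemma tord_sum: "(\<And>i. i \<in> I \<Longrightarrow> F i \<in> tord k) \<Longrightarrow> sum F I \<in> tord k"
  by (auto simp: tord_def cf_sum intro!: sum.neutral)

lemma tord_mono: "F \<in> tord k \<Longrightarrow> l \<le> k \<Longrightarrow> F \<in> tord l"
  by (auto simp: tord_def)

lemma tord_mult_add: "F \<in> tord k \<Longrightarrow> G \<in> tord l \<Longrightarrow> F * G \<in> tord (k + l)"
proof -
  assume F: "F \<in> tord k" and G: "G \<in> tord l"
  have "cf F j * cf G (m - j) = 0" if "size m < k + l" "j \<subseteq># m" for m j
  proof -
    have "size j + size (m - j) = size m" using that(2) by (metis size_union subset_mset.add_diff_inverse)
    then have "size j < k \<or> size (m - j) < l" using that(1) by linarith
    then show ?thesis using F G by (auto simp: tord_def)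
  qed
  then show ?thesis by (auto simp: tord_def cf_mult intro!: sum.neutral)
qed

lemma tord_mult_left: "F \<in> tord k \<Longrightarrow> F * G \<in> tord k"
  using tord_mult_add[of F k G 0] by simp

lemma tord_mult_right: "F \<in> tord k \<Longrightarrow> G * F \<in> tord k"
  using tord_mult_left[of F k G] by (simp add: mult.commute)

lemma tord_power: "F \<in> tord k \<Longrightarrow> F ^ n \<in> tord (n * k)"
  by (induction n) (auto simp: tord_mult_add)

lemma tv_tord: "tv v \<in> tord 1"
  by (auto simp: tord_def cf_tv)

lemma tord_eqI: "(\<And>k. F - G \<in> tord k) \<Longrightarrow> F = G"
proof (rule mps_eqI)
  fix m assume "\<And>k. F - G \<in> tord k"
  from this[of "Suc (size m)"] show "cf F m = cf G m" by (auto simp: tord_def)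
qed

lemma tord_1_iff: "F \<in> tord 1 \<longleftrightarrow> cf F {#} = 0"
  by (auto simp: tord_def)

text \<open>The \<open>T\<close>-adic sum of a sequence whose \<open>l\<close>-th term has order at least \<open>l\<close>.\<close>

definition ser :: "(nat \<Rightarrow> 'v mps) \<Rightarrow> 'v mps" where
  "ser a = Mps (\<lambda>m. \<Sum>l\<le>size m. cf (a l) m)"

lemma ser_approx:
  assumes a: "\<And>l. a l \<in> tord l"
  shows "ser a - (\<Sum>l\<le>n. a l) \<in> tord (Suc n)"
  unfolding tord_def
proof (intro CollectI allI impI)
  fix m :: "'a multiset" assume m: "size m < Suc n"
  have "(\<Sum>l\<le>n. cf (a l) m) = (\<Sum>l\<le>size m. cf (a l) m)"
    by (rule sum.mono_neutral_right) (use m a in \<open>auto simp: tord_def\<close>)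
  then show "cf (ser a - (\<Sum>l\<le>n. a l)) m = 0" by (simp add: ser_def cf_sum)
qed

section \<open>Cramer's rule and the coordinate ring\<close>

definition mmul :: "('n::finite, 'a::comm_ring_1) matrix \<Rightarrow> ('n, 'a) matrix \<Rightarrow> ('n, 'a) matrix" where
  "mmul a b = (\<lambda>i j. \<Sum>k\<in>UNIV. a i k * b k j)"

definition mone :: "('n, 'a::comm_ring_1) matrix" where
  "mone = (\<lambda>i j. if i = j then 1 else 0)"

primrec mpow :: "('n::finite, 'a::comm_ring_1) matrix \<Rightarrow> nat \<Rightarrow> ('n, 'a) matrix" where
  "mpow a 0 = mone"
| "mpow a (Suc l) = mmul (mpow a l) a"

lemma mmul_assoc: "mmul (mmul a b) c = mmul a (mmul b c)"
proof (intro ext)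
  fix i j
  have "(\<Sum>k\<in>UNIV. \<Sum>l\<in>UNIV. a i l * b l k * c k j) = (\<Sum>l\<in>UNIV. \<Sum>k\<in>UNIV. a i l * b l k * c k j)"
    by (rule sum.swap)
  then show "mmul (mmul a b) c i j = mmul a (mmul b c) i j"
    by (simp add: mmul_def sum_distrib_left sum_distrib_right mult.assoc)
qed

lemma mmul_mone [simp]: "mmul mone a = a" "mmul a mone = a"
  by (simp_all add: mmul_def mone_def if_distrib[of "\<lambda>x. x * _"] if_distrib[of "\<lambda>x. _ * x"] cong: if_cong)

lemma mpow_commute: "mmul a (mpow a l) = mmul (mpow a l) a"
  by (induction l) (simp_all add: mmul_assoc[symmetric])

lemma mmul_transpose: "mat_transpose (mmul a b) = mmul (mat_transpose b) (mat_transpose a)"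
  by (simp add: mmul_def mat_transpose_def mult.commute)

lemma mat_transpose_mone [simp]: "mat_transpose mone = mone"
  by (auto simp: mat_transpose_def mone_def fun_eq_iff)

lemma mmul_tord:
  "(\<And>i j. a i j \<in> tord k) \<Longrightarrow> (\<And>i j. b i j \<in> tord l) \<Longrightarrow> mmul a b i j \<in> tord (k + l)"
  by (auto simp: mmul_def intro!: tord_sum tord_mult_add)

lemma mpow_tord: "(\<And>i j. a i j \<in> tord k) \<Longrightarrow> mpow a l i j \<in> tord (l * k)"
proof (induction l arbitrary: i j)
  case (Suc l)
  then show ?case using mmul_tord[of "mpow a l" "l * k" a k] by (simp add: add.commute)
qed simp

lemma mmul_diff_left: "mmul (\<lambda>i j. a i j - b i j) c i j = mmul a c i j - mmul b c i j"
  and mmul_diff_right: "mmul c (\<lambda>i j. a i j - b i j) i j = mmul c a i j - mmul c b i j"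
  by (simp_all add: mmul_def algebra_simps sum_subtractf)

lemma mmul_add_left: "mmul (\<lambda>i j. a i j + b i j) c i j = mmul a c i j + mmul b c i j"
  and mmul_add_right: "mmul c (\<lambda>i j. a i j + b i j) i j = mmul c a i j + mmul c b i j"
  by (simp_all add: mmul_def algebra_simps sum.distrib)

lemma mpow_geometric:
  "mmul (\<lambda>i j. mone i j - N i j) (\<lambda>i j. \<Sum>l\<le>n. mpow N l i j) i j = mone i j - mpow N (Suc n) i j"
  "mmul (\<lambda>i j. \<Sum>l\<le>n. mpow N l i j) (\<lambda>i j. mone i j - N i j) i j = mone i j - mpow N (Suc n) i j"
proof (induction n)
  case 0
  show "mmul (\<lambda>i j. mone i j - N i j) (\<lambda>i j. \<Sum>l\<le>0. mpow N l i j) i j = mone i j - mpow N (Suc 0) i j"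
    "mmul (\<lambda>i j. \<Sum>l\<le>0. mpow N l i j) (\<lambda>i j. mone i j - N i j) i j = mone i j - mpow N (Suc 0) i j"
    by (simp_all add: mmul_diff_left mmul_diff_right)
next
  case (Suc n)
  show "mmul (\<lambda>i j. mone i j - N i j) (\<lambda>i j. \<Sum>l\<le>Suc n. mpow N l i j) i j = mone i j - mpow N (Suc (Suc n)) i j"
    using Suc(1) by (simp only: sum.atMost_Suc mmul_add_right) (simp add: mmul_diff_left mpow_commute[symmetric] mmul_assoc)
  show "mmul (\<lambda>i j. \<Sum>l\<le>Suc n. mpow N l i j) (\<lambda>i j. mone i j - N i j) i j = mone i j - mpow N (Suc (Suc n)) i j"
    using Suc(2) by (simp only: sum.atMost_Suc mmul_add_left) (simp add: mmul_diff_right)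
qed

text \<open>The Neumann series for the inverse of \<open>1 - N\<close>, meaningful when the entries
  of \<open>N\<close> have no constant term.\<close>

definition ginv :: "('n::finite, 'v mps) matrix \<Rightarrow> ('n, 'v mps) matrix" where
  "ginv N = (\<lambda>i j. ser (\<lambda>l. mpow N l i j))"

text \<open>By the geometric sum formula the partial sum up to \<open>n\<close> inverts
  \<open>1 - N\<close> up to the power \<open>N ^ (n + 1)\<close>, whose entries have order above
  \<open>n\<close>. Both one-sided identities follow in the limit.\<close>

lemma
  assumes N: "\<And>i j. N i j \<in> tord 1"
  shows ginv_right: "mmul (\<lambda>i j. mone i j - N i j) (ginv N) = mone"
    and ginv_left: "mmul (ginv N) (\<lambda>i j. mone i j - N i j) = mone"
    and ginv_tord: "ginv N i j - mone i j \<in> tord 1"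
proof -
  have t: "mpow N l i j \<in> tord l" for l i j using mpow_tord[of N 1] N by simp
  let ?g = "\<lambda>n i j. \<Sum>l\<le>n. mpow N l i j"
  have a: "ginv N i j - ?g n i j \<in> tord (Suc n)" for n i j
    unfolding ginv_def by (rule ser_approx) (rule t)
  let ?M = "\<lambda>i j. mone i j - N i j"
  show "mmul ?M (ginv N) = mone"
  proof (intro ext tord_eqI)
    fix i j n
    have "mmul ?M (ginv N) i j - mone i j = mmul ?M (\<lambda>i j. ginv N i j - ?g n i j) i j - mpow N (Suc n) i j"
      unfolding mmul_diff_right mpow_geometric by simp
    also have "\<dots> \<in> tord (Suc n)"
      by (intro tord_diff t) (use mmul_tord[of ?M 0 "\<lambda>i j. ginv N i j - ?g n i j"] a in simp)
    finally show "mmul ?M (ginv N) i j - mone i j \<in> tord n" by (rule tord_mono) simp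
  qed
  show "mmul (ginv N) ?M = mone"
  proof (intro ext tord_eqI)
    fix i j n
    have "mmul (ginv N) ?M i j - mone i j = mmul (\<lambda>i j. ginv N i j - ?g n i j) ?M i j - mpow N (Suc n) i j"
      unfolding mmul_diff_left mpow_geometric by simp
    also have "\<dots> \<in> tord (Suc n)"
      by (intro tord_diff t) (use mmul_tord[of "\<lambda>i j. ginv N i j - ?g n i j" "Suc n" ?M 0] a in simp)
    finally show "mmul (ginv N) ?M i j - mone i j \<in> tord n" by (rule tord_mono) simp
  qed
  show "ginv N i j - mone i j \<in> tord 1" using a[of i j 0] by simp
qed

text \<open>Cramer's rule: replace the \<open>i\<close>-th row by a unit vector.\<close>

definition cofac :: "('n::finite, 'a::comm_ring_1) matrix \<Rightarrow> ('n, 'a) matrix" where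
  "cofac x = (\<lambda>j i. det (\<chi> k. if k = i then (\<chi> l. if l = j then 1 else 0) else (\<chi> l. x k l)))"

text \<open>Linearity of \<open>det\<close> in row \<open>i\<close> reassembles row \<open>l\<close>
  of \<open>x\<close> in that place. For \<open>l = i\<close> this is \<open>x\<close> itself;
  otherwise the row occurs twice.\<close>

lemma mmul_cofac:
  fixes x :: "('n::finite, 'a::comm_ring_1) matrix"
  shows "mmul x (cofac x) = (\<lambda>l i. if l = i then det (\<chi> i j. x i j) else 0)"
proof (intro ext)
  fix l i
  let ?e = "\<lambda>j. (\<chi> l. if l = j then 1 else 0) :: 'a ^ 'n"
  let ?r = "\<lambda>k. (\<chi> l. x k l) :: 'a ^ 'n"
  have "mmul x (cofac x) l i = (\<Sum>j\<in>UNIV. det (\<chi> k. if k = i then x l j *s ?e j else ?r k))"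
    by (simp add: mmul_def cofac_def det_row_mul)
  also have "\<dots> = det (\<chi> k. if k = i then (\<Sum>j\<in>UNIV. x l j *s ?e j) else ?r k)"
    using det_linear_row_sum[of UNIV i "\<lambda>k j. x l j *s ?e j" ?r] by simp
  also have "(\<Sum>j\<in>UNIV. x l j *s ?e j) = ?r l"
    by (simp add: vec_eq_iff if_distrib[of "\<lambda>y. _ * y"] cong: if_cong)
  also have "det (\<chi> k. if k = i then ?r l else ?r k) = (if l = i then det (\<chi> i j. x i j) else 0)"
  proof (cases "l = i")
    case True
    then have "(\<chi> k. if k = i then ?r l else ?r k) = (\<chi> i j. x i j)" by (simp add: vec_eq_iff)
    then show ?thesis using True by simp
  next
    case False
    have "det (\<chi> k. if k = i then ?r l else ?r k) = 0"
      by (rule det_identical_rows[OF False]) (use False in \<open>simp add: row_def vec_eq_iff\<close>)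
    then show ?thesis using False by simp
  qed
  finally show "mmul x (cofac x) l i = (if l = i then det (\<chi> i j. x i j) else 0)" .
qed

text \<open>Multiply the identity \<open>mmul_cofac\<close> by \<open>V\<close> from the left. The
  purpose is to express an inverse matrix that is known as a series through minors and an inverse
  determinant, all of which lie in the coordinate ring.\<close>

lemma left_inverse_cofac:
  assumes "mmul V x = mone"
  shows "V i j * det (\<chi> i j. x i j) = cofac x i j" "det (\<chi> i j. V i j) * det (\<chi> i j. x i j) = 1"
proof -
  have "mmul V (mmul x (cofac x)) i j = V i j * det (\<chi> i j. x i j)"
    unfolding mmul_cofac by (simp add: mmul_def if_distrib[of "\<lambda>y. _ * y"] cong: if_cong)
  then show "V i j * det (\<chi> i j. x i j) = cofac x i j"
    by (simp add: mmul_assoc[symmetric] assms)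
  have "det (\<chi> i j. V i j) * det (\<chi> i j. x i j) = det ((\<chi> i j. V i j) ** (\<chi> i j. x i j))"
    by (simp add: det_mul)
  also have "(\<chi> i j. V i j) ** (\<chi> i j. x i j) = mat 1"
    using assms by (simp add: matrix_matrix_mult_def mat_def mmul_def mone_def vec_eq_iff fun_eq_iff)
  finally show "det (\<chi> i j. V i j) * det (\<chi> i j. x i j) = 1" by simp
qed

definition xmat :: "('n, ('n \<times> 'n) mps) matrix" where
  "xmat = (\<lambda>i j. tv (i, j) + (if i = j then 1 else 0))"

text \<open>The sign comes from writing \<open>x = 1 - (- T)\<close> for the Neumann series.\<close>

definition xinv :: "('n::finite, ('n \<times> 'n) mps) matrix" where
  "xinv = ginv (\<lambda>i j. - tv (i, j))"

lemma xmat_xinv: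
  "mmul (xmat :: ('n::finite, _) matrix) xinv = mone" "mmul xinv (xmat :: ('n, _) matrix) = mone"
proof -
  have e: "(xmat :: ('n, _) matrix) = (\<lambda>i j. mone i j - - tv (i, j))" by (auto simp: xmat_def mone_def fun_eq_iff)
  have t: "- tv v \<in> tord 1" for v :: "'n \<times> 'n" by (rule tord_uminus[OF tv_tord])
  show "mmul (xmat :: ('n, _) matrix) xinv = mone" unfolding xinv_def e by (rule ginv_right, rule t)
  show "mmul xinv (xmat :: ('n, _) matrix) = mone" unfolding xinv_def e by (rule ginv_left, rule t)
qed

section \<open>Series with coefficients in \<open>A\<close> and the coordinate ring inside
  them\<close>

context coeff_ring
begin

abbreviation P :: "('v, complex) pseries ring" where "P \<equiv> pseries_ring A"

definition PA :: "'v mps set" where "PA = {F. \<forall>m. cf F m \<in> K}"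

lemma PA_0 [simp]: "0 \<in> PA" by (simp add: PA_def K_zero)
lemma PA_1 [simp]: "1 \<in> PA" by (simp add: PA_def cf_one K_zero K_one)
lemma PA_add: "F \<in> PA \<Longrightarrow> G \<in> PA \<Longrightarrow> F + G \<in> PA" by (simp add: PA_def K_add)
lemma PA_uminus: "F \<in> PA \<Longrightarrow> - F \<in> PA" by (simp add: PA_def K_uminus)
lemma PA_diff: "F \<in> PA \<Longrightarrow> G \<in> PA \<Longrightarrow> F - G \<in> PA" using PA_add[OF _ PA_uminus, of F G] by simp
lemma PA_mult: "F \<in> PA \<Longrightarrow> G \<in> PA \<Longrightarrow> F * G \<in> PA" by (auto simp: PA_def cf_mult intro!: K_sum K_mult)
lemma PA_sum: "(\<And>i. i \<in> I \<Longrightarrow> F i \<in> PA) \<Longrightarrow> sum F I \<in> PA"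
  by (induction I rule: infinite_finite_induct) (auto simp: PA_add)
lemma PA_power: "F \<in> PA \<Longrightarrow> F ^ n \<in> PA" by (induction n) (auto simp: PA_mult)
lemma PA_cst: "c \<in> K \<Longrightarrow> cst c \<in> PA" by (simp add: PA_def cf_cst K_zero)
lemma PA_tv: "tv v \<in> PA" by (simp add: PA_def cf_tv K_zero K_one)
lemma PA_of_nat: "of_nat n \<in> PA" by (induction n) (auto intro!: PA_add)
lemma PA_ser: "(\<And>l. a l \<in> PA) \<Longrightarrow> ser a \<in> PA" by (auto simp: PA_def ser_def intro!: K_sum)
lemma PA_mmul: "(\<And>i j. a i j \<in> PA) \<Longrightarrow> (\<And>i j. b i j \<in> PA) \<Longrightarrow> mmul a b i j \<in> PA"
  by (auto simp: mmul_def intro!: PA_sum PA_mult)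
lemma PA_mone: "mone i j \<in> PA" by (simp add: mone_def)
lemma PA_mpow: "(\<And>i j. a i j \<in> PA) \<Longrightarrow> mpow a l i j \<in> PA"
  by (induction l arbitrary: i j) (auto intro!: PA_mmul PA_mone)
lemma PA_ginv: "(\<And>i j. N i j \<in> PA) \<Longrightarrow> ginv N i j \<in> PA"
  by (auto simp: ginv_def intro!: PA_ser PA_mpow)
lemma PA_xmat: "xmat i j \<in> PA" by (auto simp: xmat_def intro!: PA_add PA_tv)
lemma PA_xinv: "xinv i j \<in> PA" by (auto simp: xinv_def intro!: PA_ginv PA_uminus PA_tv)

lemma P_carrier: "f \<in> carrier P \<longleftrightarrow> (\<exists>F\<in>PA. f = cf F)"
  by (auto simp: PA_def pseries_simps intro!: exI[of _ "Mps f"])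

lemma cf_carrier [simp]: "cf F \<in> carrier P \<longleftrightarrow> F \<in> PA"
  by (auto simp: PA_def pseries_simps)

lemma P_add: "cf F \<oplus>\<^bsub>P\<^esub> cf G = cf (F + G)" by (auto simp: pseries_simps)
lemma P_zero: "\<zero>\<^bsub>P\<^esub> = cf 0" by (auto simp: pseries_simps)
lemma P_one: "\<one>\<^bsub>P\<^esub> = cf 1" by (auto simp: pseries_simps cf_one)
lemma P_mult: "F \<in> PA \<Longrightarrow> G \<in> PA \<Longrightarrow> cf F \<otimes>\<^bsub>P\<^esub> cf G = cf (F * G)"
  by (rule ext) (auto simp: pseries_simps cf_mult PA_def K_mult A_finsum)

lemma P_cring: "cring (P :: ('v, complex) pseries ring)" by (rule pseries_cring)

lemma P_a_inv: "F \<in> PA \<Longrightarrow> \<ominus>\<^bsub>P\<^esub> cf F = cf (- F)"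
  by (subst pseries_minus) (auto simp: PA_def A_a_inv)

lemma P_add_pow: "[(n::nat)] \<cdot>\<^bsub>P\<^esub> cf F = cf (of_nat n * F)"
proof -
  interpret P: cring "P :: ('b, complex) pseries ring" by (rule P_cring)
  show ?thesis by (induction n) (auto simp: P_zero P_add algebra_simps)
qed

lemma P_add_pow_int: "F \<in> PA \<Longrightarrow> [(n::int)] \<cdot>\<^bsub>P\<^esub> cf F = cf (of_int n * F)"
proof -
  assume F: "F \<in> PA"
  have "F * of_nat k \<in> PA" for k using F by (auto intro!: PA_mult PA_of_nat)
  then show ?thesis
    by (cases n) (simp_all add: add_pow_int_ge add_pow_int_lt P_add_pow P_a_inv algebra_simps del: of_nat_Suc)
qed

lemma P_finsum: "(\<And>i. F i \<in> PA) \<Longrightarrow> (\<Oplus>\<^bsub>P\<^esub>i\<in>I. cf (F i)) = cf (\<Sum>i\<in>I. F i)"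
proof -
  interpret P: cring "P :: ('b, complex) pseries ring" by (rule P_cring)
  assume "\<And>i. F i \<in> PA"
  then show ?thesis
    by (induction I rule: infinite_finite_induct) (auto simp: P_zero P_add)
qed

lemma P_finprod: "(\<And>i. F i \<in> PA) \<Longrightarrow> (\<Otimes>\<^bsub>P\<^esub>i\<in>I. cf (F i)) = cf (\<Prod>i\<in>I. F i)" and
  PA_prod: "(\<And>i. F i \<in> PA) \<Longrightarrow> (\<Prod>i\<in>I. F i) \<in> PA"
proof -
  interpret P: cring "P :: ('b, complex) pseries ring" by (rule P_cring)
  assume F: "\<And>i. F i \<in> PA"
  then show c: "(\<Prod>i\<in>I. F i) \<in> PA" for I
    by (induction I rule: infinite_finite_induct) (auto simp: PA_mult)
  show "(\<Otimes>\<^bsub>P\<^esub>i\<in>I. cf (F i)) = cf (\<Prod>i\<in>I. F i)"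
    by (induction I rule: infinite_finite_induct) (auto simp: P_one P_mult F c)
qed

lemma PA_of_int: "of_int k \<in> PA"
  by (cases k) (auto intro!: PA_of_nat PA_uminus simp del: of_nat_Suc)

lemma PA_det: "(\<And>i j. a i j \<in> PA) \<Longrightarrow> det (\<chi> i j. a i j) \<in> PA"
  unfolding det_def by (auto intro!: PA_sum PA_mult PA_prod PA_of_int)

lemma P_mat_det: "(\<And>i j. a i j \<in> PA) \<Longrightarrow> mat_det P (\<lambda>i j. cf (a i j)) = cf (det (\<chi> i j. a i j))"
  by (simp add: mat_det_def det_def P_finprod PA_prod P_add_pow_int P_finsum PA_mult PA_of_int)

lemma coord_matrix_eq: "coord_matrix A i j = cf (xmat i j)"
  by (auto simp: coord_matrix_def xmat_def pseries_var_def pseries_simps cf_tv cf_one)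

lemma pseries_const_eq: "pseries_const A a = cf (cst a)"
  by (auto simp: pseries_const_def cf_cst)

lemma P_inv: "F \<in> PA \<Longrightarrow> G \<in> PA \<Longrightarrow> F * G = 1 \<Longrightarrow> inv\<^bsub>P\<^esub> (cf F) = cf G"
proof -
  interpret P: cring "P :: ('b, complex) pseries ring" by (rule P_cring)
  assume "F \<in> PA" "G \<in> PA" "F * G = 1"
  then show ?thesis by (intro P.comm_inv_char) (auto simp: P_mult P_one)
qed

abbreviation xdet_inv :: "('n::finite \<times> 'n) mps" where "xdet_inv \<equiv> det (\<chi> i j. xinv i j)"

text \<open>Replaces the abstract inverse in the definition of \<open>GL_coord\<close> by an
  explicit series, the determinant of the Neumann inverse of \<open>x\<close>.\<close>

lemma P_inv_det:
  "inv\<^bsub>P\<^esub> (mat_det P (coord_matrix A :: ('n::finite, _) matrix)) = cf xdet_inv"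
proof -
  have e: "coord_matrix A = (\<lambda>i j :: 'n. cf (xmat i j))" by (auto simp: coord_matrix_eq fun_eq_iff)
  show ?thesis unfolding e
    by (simp add: P_mat_det PA_xmat)
      (rule P_inv, auto simp: PA_det PA_xmat PA_xinv mult.commute left_inverse_cofac(2)[OF xmat_xinv(2)])
qed

definition GO :: "('n::finite \<times> 'n) mps set" where
  "GO = {F. cf F \<in> carrier (GL_coord A)}"

definition GH :: "('n::finite \<times> 'n) mps set" where
  "GH = cst ` K \<union> {xmat i j |i j. True} \<union> {xdet_inv}"

lemma GL_coord_carrier:
  "carrier (GL_coord A :: ('n::finite \<times> 'n, complex) pseries ring) = generate_ring P (cf ` GH)"
proof -
  have "(\<lambda>(i, j). coord_matrix A i j) ` UNIV = cf ` {xmat i j |i j :: 'n. True}"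
    unfolding image_def by (force simp: coord_matrix_eq)
  then have "pseries_const A ` carrier A \<union> (\<lambda>(i, j). coord_matrix A i j) ` UNIV
     \<union> {inv\<^bsub>P\<^esub> (mat_det P (coord_matrix A))} = cf ` (GH :: ('n \<times> 'n) mps set)"
    by (simp add: GH_def P_inv_det pseries_const_eq[abs_def] image_Un image_image)
  then show ?thesis by (simp add: GL_coord_def)
qed

lemma GH_PA: "GH \<subseteq> PA"
  by (auto simp: GH_def PA_cst PA_xmat PA_det PA_xinv)

lemma GL_subring: "subring (carrier (GL_coord A :: ('n::finite \<times> 'n, complex) pseries ring)) P"
proof -
  interpret P: cring "P :: ('n \<times> 'n, complex) pseries ring" by (rule P_cring)
  show ?thesis unfolding GL_coord_carrier
    by (rule P.generate_ring_is_subring) (use GH_PA in auto)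
qed

lemma GL_coord_simps:
  "\<zero>\<^bsub>GL_coord A\<^esub> = \<zero>\<^bsub>P\<^esub>" "\<one>\<^bsub>GL_coord A\<^esub> = \<one>\<^bsub>P\<^esub>"
  "f \<otimes>\<^bsub>GL_coord A\<^esub> g = f \<otimes>\<^bsub>P\<^esub> g" "f \<oplus>\<^bsub>GL_coord A\<^esub> g = f \<oplus>\<^bsub>P\<^esub> g"
  by (simp_all add: GL_coord_def)

lemma GL_cring: "cring (GL_coord A :: ('n::finite \<times> 'n, complex) pseries ring)"
proof -
  interpret P: cring "P :: ('n \<times> 'n, complex) pseries ring" by (rule P_cring)
  have "cring (P \<lparr>carrier := carrier (GL_coord A :: ('n \<times> 'n, complex) pseries ring)\<rparr>)"
    using P.subcringI'[OF GL_subring] P.subcring_iff[OF subringE(1)[OF GL_subring]] by blast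
  then show ?thesis by (simp add: GL_coord_def)
qed

lemma GO_PA: "F \<in> GO \<Longrightarrow> F \<in> PA"
  using subringE(1)[OF GL_subring] by (auto simp: GO_def)

lemma GL_carrier: "f \<in> carrier (GL_coord A) \<longleftrightarrow> (\<exists>F\<in>GO. f = cf F)"
  by (auto simp: GO_def intro!: exI[of _ "Mps f"])

lemma GO_0: "0 \<in> GO" and GO_1: "1 \<in> GO"
  using subringE(2,3)[OF GL_subring] by (auto simp: GO_def P_zero P_one)

lemma GO_add: "F \<in> GO \<Longrightarrow> G \<in> GO \<Longrightarrow> F + G \<in> GO"
  using subringE(7)[OF GL_subring, of "cf F" "cf G"] by (auto simp: GO_def P_add)

lemma GO_mult: "F \<in> GO \<Longrightarrow> G \<in> GO \<Longrightarrow> F * G \<in> GO"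
  using subringE(6)[OF GL_subring, of "cf F" "cf G"] by (auto simp: GO_def P_mult[OF GO_PA GO_PA, unfolded GO_def])

lemma GO_uminus: "F \<in> GO \<Longrightarrow> - F \<in> GO"
  using subringE(5)[OF GL_subring, of "cf F"] by (auto simp: GO_def P_a_inv[OF GO_PA, unfolded GO_def])

lemma GO_sum: "(\<And>i. i \<in> I \<Longrightarrow> F i \<in> GO) \<Longrightarrow> sum F I \<in> GO"
  by (induction I rule: infinite_finite_induct) (auto simp: GO_add GO_0)

lemma GO_prod: "(\<And>i. i \<in> I \<Longrightarrow> F i \<in> GO) \<Longrightarrow> prod F I \<in> GO"
  by (induction I rule: infinite_finite_induct) (auto simp: GO_mult GO_1)

lemma GO_GH: "F \<in> GH \<Longrightarrow> F \<in> GO"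
  by (auto simp: GO_def GL_coord_carrier intro: generate_ring.incl)

lemma xmat_GH: "xmat i j \<in> GH" unfolding GH_def by blast

lemma GO_cst: "a \<in> K \<Longrightarrow> cst a \<in> GO" and GO_xmat: "xmat i j \<in> GO" and GO_xdet_inv: "xdet_inv \<in> GO"
  by (rule GO_GH, simp add: GH_def) (rule GO_GH[OF xmat_GH], rule GO_GH, simp add: GH_def)

lemma K_of_nat: "of_nat n \<in> K" by (induction n) (auto intro: K_add K_one K_zero)

lemma GO_of_nat: "of_nat n \<in> GO" using GO_cst[OF K_of_nat] by (simp add: cst_of_nat)

lemma GO_of_int: "of_int k \<in> GO"
  by (cases k) (auto intro!: GO_of_nat GO_uminus simp del: of_nat_Suc)

lemma GO_det: "(\<And>i j. a i j \<in> GO) \<Longrightarrow> det (\<chi> i j. a i j) \<in> GO"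
  unfolding det_def by (auto intro!: GO_sum GO_mult GO_prod GO_of_int)

text \<open>Cramer's rule: a minor times the adjoined inverse determinant. This supplies an inverse
  of \<open>x\<close> over the completed coordinate ring, to which a Frobenius lift can be
  applied.\<close>

lemma GO_xinv: "xinv i j \<in> GO"
proof -
  have "cofac xmat i j = det (\<chi> k l. if k = j then (if l = i then 1 else 0) else xmat k l)"
    unfolding cofac_def by (rule arg_cong[where f = det]) (simp add: vec_eq_iff)
  then have "cofac xmat i j \<in> GO" by (auto intro!: GO_det GO_0 GO_1 GO_xmat)
  moreover have "xinv i j = cofac xmat i j * xdet_inv"
    using left_inverse_cofac(1)[OF xmat_xinv(2), of i j] left_inverse_cofac(2)[OF xmat_xinv(2)]
    by (metis (no_types) mult.assoc mult.commute mult_1_right)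
  ultimately show ?thesis by (simp add: GO_mult GO_xdet_inv)
qed

lemma GO_induct [consumes 1, case_names cst xmat xdet_inv add uminus mult]:
  fixes F :: "('n::finite \<times> 'n) mps"
  assumes "F \<in> GO" and "\<And>a. a \<in> K \<Longrightarrow> Q (cst a)" and "\<And>i j. Q (xmat i j)" and "Q xdet_inv"
    and "\<And>F G. F \<in> GO \<Longrightarrow> G \<in> GO \<Longrightarrow> Q F \<Longrightarrow> Q G \<Longrightarrow> Q (F + G)"
    and "\<And>F. F \<in> GO \<Longrightarrow> Q F \<Longrightarrow> Q (- F)"
    and "\<And>F G. F \<in> GO \<Longrightarrow> G \<in> GO \<Longrightarrow> Q F \<Longrightarrow> Q G \<Longrightarrow> Q (F * G)"
  shows "Q F"
proof -
  have "f \<in> generate_ring P (cf ` GH) \<Longrightarrow> f \<in> carrier (GL_coord A) \<and> Q (Mps f)" for f :: "('n \<times> 'n, complex) pseries"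
  proof (induction rule: generate_ring.induct)
    case one
    then show ?case using assms(2)[OF K_one] GO_1 by (simp add: P_one cst_1 GO_def)
  next
    case (incl h)
    then obtain F where F: "F \<in> GH" "h = cf F" by auto
    from F(1) have "Q F" using assms(2-4) by (auto simp: GH_def)
    then show ?case using GO_GH[OF F(1)] F(2) by (simp add: GO_def)
  next
    case (a_inv h)
    then have "Mps h \<in> GO" "Q (Mps h)" by (simp_all add: GO_def)
    then have "- Mps h \<in> GO" "Q (- Mps h)" "\<ominus>\<^bsub>P\<^esub> h = cf (- Mps h)"
      using assms(6)[of "Mps h"] GO_uminus[of "Mps h"] P_a_inv[OF GO_PA, of "Mps h"] by simp_all
    then show ?case by (simp add: GO_def del: cf_simps pseries_minus)
  next
    case (eng_add f g)
    then have fg: "Mps f \<in> GO" "Mps g \<in> GO" "Q (Mps f)" "Q (Mps g)" by (simp_all add: GO_def)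
    then have "Mps f + Mps g \<in> GO" "Q (Mps f + Mps g)" "f \<oplus>\<^bsub>P\<^esub> g = cf (Mps f + Mps g)"
      using assms(5)[of "Mps f" "Mps g"] GO_add[of "Mps f" "Mps g"] P_add[of "Mps f" "Mps g"]
      by (simp_all del: cf_simps)
    then show ?case by (simp add: GO_def del: cf_simps)
  next
    case (eng_mult f g)
    then have fg: "Mps f \<in> GO" "Mps g \<in> GO" "Q (Mps f)" "Q (Mps g)" by (simp_all add: GO_def)
    then have "Mps f * Mps g \<in> GO" "Q (Mps f * Mps g)" "f \<otimes>\<^bsub>P\<^esub> g = cf (Mps f * Mps g)"
      using assms(7)[of "Mps f" "Mps g"] GO_mult[of "Mps f" "Mps g"]
        P_mult[OF GO_PA GO_PA, of "Mps f" "Mps g"] by simp_all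
    then show ?case by (simp add: GO_def)
  qed
  from this[of "cf F"] assms(1) show ?thesis by (simp add: GO_def GL_coord_carrier)
qed

end

section \<open>The ring \<open>\<int>[1/M, \<zeta>]\<close>\<close>

text \<open>The coordinate at \<open>a\<close> in a basis of the complex numbers over the rationals
  that contains \<open>a\<close>. It takes the place of norms or integral bases when denominators
  are to be bounded.\<close>

lemma exists_rational_functional:
  fixes a :: complex
  assumes "a \<noteq> 0"
  shows "\<exists>lam :: complex \<Rightarrow> rat. (\<forall>x y. lam (x + y) = lam x + lam y) \<and>
    (\<forall>r x. lam (of_rat r * x) = r * lam x) \<and> lam a = 1"
proof -
  interpret V: vector_space "\<lambda>(r::rat) (x::complex). of_rat r * x"
    by standard (auto simp: algebra_simps of_rat_add of_rat_mult)
  have ind: "V.independent {a}" using assms by simp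
  define B where "B = V.extend_basis {a}"
  have B: "V.independent B" "V.span B = UNIV" "a \<in> B"
    using V.independent_extend_basis[OF ind] V.span_extend_basis[OF ind] V.extend_basis_superset[OF ind]
    by (auto simp: B_def)
  show ?thesis
  proof (intro exI[of _ "\<lambda>x. V.representation B x a"] conjI allI)
    show "V.representation B (x + y) a = V.representation B x a + V.representation B y a" for x y
      using B by (simp add: V.representation_add)
    show "V.representation B (of_rat r * x) a = r * V.representation B x a" for r x
      using B V.representation_scale[OF B(1), of x r] by simp
    show "V.representation B a a = 1" using V.representation_basis[OF B(1,3)] by simp
  qed
qed

lemma common_denominator:
  fixes r :: "nat \<Rightarrow> rat"
  shows "\<exists>d::nat. d > 0 \<and> (\<forall>i<N. of_nat d * r i \<in> \<int>)"
proof (induction N)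
  case (Suc N)
  then obtain d :: nat where d: "d > 0" "\<forall>i<N. of_nat d * r i \<in> \<int>" by blast
  obtain a b :: int where ab: "b > 0" "r N = of_int a / of_int b"
    by (metis Fract_of_int_quotient Rat_cases)
  have "of_nat (d * nat b) * r i \<in> \<int>" if "i < Suc N" for i
  proof (cases "i = N")
    case True
    have "of_nat (d * nat b) * r i = (of_int (int d * a) :: rat)" using ab True by simp
    then show ?thesis by (metis Ints_of_int)
  next
    case False
    then have "of_nat d * r i \<in> \<int>" using d that by simp
    then have "of_nat (nat b) * (of_nat d * r i) \<in> \<int>" by (rule Ints_mult[OF Ints_of_nat])
    then show ?thesis by (simp add: mult.assoc mult.left_commute)
  qed
  then show ?case using d ab by (intro exI[of _ "d * nat b"]) auto
qed auto

lemma primitive_root_mod: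
  assumes "primitive_root_of_one N \<zeta>" "N \<ge> 1"
  shows "\<zeta> ^ i = \<zeta> ^ (i mod N)"
proof -
  have "\<zeta> ^ i = \<zeta> ^ (N * (i div N) + i mod N)" by simp
  also have "\<dots> = (\<zeta> ^ N) ^ (i div N) * \<zeta> ^ (i mod N)" by (simp only: power_add power_mult)
  finally show ?thesis using assms by (simp add: primitive_root_of_one_def)
qed

text \<open>The powers of \<open>\<zeta>\<close> with exponent below \<open>N\<close> are distinct,
  and there are exactly \<open>N\<close> complex roots of \<open>z ^ N = 1\<close>.\<close>

lemma roots_of_unity_eq_powers:
  assumes \<zeta>: "primitive_root_of_one N \<zeta>" and N: "N \<ge> 1" and z: "z ^ N = 1"
  shows "\<exists>j. z = \<zeta> ^ j"
proof -
  have nz: "\<zeta> \<noteq> 0" using \<zeta> N by (auto simp: primitive_root_of_one_def power_0_left split: if_splits)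
  have *: "\<not> (i < j \<and> \<zeta> ^ i = \<zeta> ^ j)" if "j < N" for i j
  proof
    assume ij: "i < j \<and> \<zeta> ^ i = \<zeta> ^ j"
    then have "\<zeta> ^ i * \<zeta> ^ (j - i) = \<zeta> ^ i * 1" by (metis le_add_diff_inverse less_imp_le mult.right_neutral power_add)
    then have "\<zeta> ^ (j - i) = 1" using nz by (metis mult_left_cancel power_not_zero)
    then show False using \<zeta> ij that by (auto simp: primitive_root_of_one_def)
  qed
  have inj: "inj_on (\<lambda>i. \<zeta> ^ i) {..<N}"
    by (rule inj_onI) (use * in \<open>metis lessThan_iff linorder_neqE_nat\<close>)
  have sub: "(\<lambda>i. \<zeta> ^ i) ` {..<N} \<subseteq> {z. z ^ N = 1}"
    using \<zeta> by (auto simp: primitive_root_of_one_def simp flip: power_mult) (metis mult.commute power_mult power_one)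
  have "(\<lambda>i. \<zeta> ^ i) ` {..<N} = {z. z ^ N = 1}"
  proof (rule card_subset_eq[OF _ sub])
    show "finite {z::complex. z ^ N = 1}" using N by (intro finite_roots_unity) auto
    show "card ((\<lambda>i. \<zeta> ^ i) ` {..<N}) = card {z::complex. z ^ N = 1}"
      using N by (simp add: card_image[OF inj] card_roots_unity_eq)
  qed
  with z show ?thesis by blast
qed

text \<open>Vandermonde's identity for \<open>1/2 + 1/2 = 1\<close> says that for
  \<open>l \<ge> 2\<close> the products \<open>?b k * ?b (l - k)\<close> add up to
  \<open>1 choose l = 0\<close>. The two extreme terms give \<open>2 * ?b l\<close>, so
  \<open>?b l\<close> is \<open>1/2\<close> times an integral expression in earlier
  coefficients.\<close>

lemma half_gbinomial_in_subring:
  fixes S :: "'a::field_char_0 set"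
  assumes "1 \<in> S" "1 / 2 \<in> S" "\<And>x y. x \<in> S \<Longrightarrow> y \<in> S \<Longrightarrow> x + y \<in> S" "\<And>x. x \<in> S \<Longrightarrow> - x \<in> S"
    "\<And>x y. x \<in> S \<Longrightarrow> y \<in> S \<Longrightarrow> x * y \<in> S"
  shows "(1 / 2 :: 'a) gchoose l \<in> S"
proof (induction l rule: less_induct)
  case (less l)
  let ?b = "\<lambda>l. (1 / 2 :: 'a) gchoose l"
  have z: "0 \<in> S" using assms(3)[OF assms(1) assms(4)[OF assms(1)]] by simp
  consider "l = 0" | "l = 1" | "l \<ge> 2" by linarith
  then show ?case
  proof cases
    case 3
    have s: "sum f I \<in> S" if "\<And>i. i \<in> I \<Longrightarrow> f i \<in> S" for f :: "nat \<Rightarrow> 'a" and I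
      using that by (induction I rule: infinite_finite_induct) (auto simp: z assms)
    have v: "(\<Sum>k\<le>l. ?b k * ?b (l - k)) = (1/2 + 1/2) gchoose l"
      using gbinomial_Vandermonde[of "1/2::'a" "1/2" l] by (simp add: atLeast0AtMost)
    have i: "{..l} = insert 0 (insert l {1..<l})" using 3 by auto
    have e: "(\<Sum>k\<le>l. ?b k * ?b (l - k)) = 2 * ?b l + (\<Sum>k\<in>{1..<l}. ?b k * ?b (l - k))"
      unfolding i using 3 by simp
    have "(1/2 + 1/2 :: 'a) gchoose l = 0"
      using 3 binomial_gbinomial[of 1 l, where 'a = 'a] by (simp add: binomial_eq_0)
    with v e have "?b l = (1/2) * (- (\<Sum>k\<in>{1..<l}. ?b k * ?b (l - k)))" by (simp add: field_simps eq_neg_iff_add_eq_0)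
    also have "\<dots> \<in> S" by (intro assms s less) auto
    finally show ?thesis .
  qed (use assms in auto)
qed

section \<open>Induction over the generators, \<open>p\<close>-adic separatedness, commuting
  endomorphisms\<close>

lemma cyclotomic_carrier: "carrier (cyclotomic_ring M \<zeta>) = generate_ring complex_ring {1 / of_nat M, \<zeta>}"
  by (simp add: cyclotomic_ring_def)

interpretation CC: cring complex_ring by (rule CR.A_cring)

lemma cyclotomic_coeff_ring: "coeff_ring (cyclotomic_ring M \<zeta>) (carrier (cyclotomic_ring M \<zeta>))"
proof
  let ?K = "carrier (cyclotomic_ring M \<zeta>)"
  show "cyclotomic_ring M \<zeta> = complex_ring\<lparr>carrier := ?K\<rparr>" by (simp add: cyclotomic_ring_def)
  show "1 \<in> ?K" using generate_ring.one[of complex_ring] by (simp add: cyclotomic_carrier)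
  show "x \<in> ?K \<Longrightarrow> y \<in> ?K \<Longrightarrow> x + y \<in> ?K" for x y
    using generate_ring.eng_add[of x complex_ring _ y] by (simp add: cyclotomic_carrier)
  show "x \<in> ?K \<Longrightarrow> y \<in> ?K \<Longrightarrow> x * y \<in> ?K" for x y
    using generate_ring.eng_mult[of x complex_ring _ y] by (simp add: cyclotomic_carrier)
  show "x \<in> ?K \<Longrightarrow> - x \<in> ?K" for x
    using generate_ring.a_inv[of x complex_ring] by (simp add: cyclotomic_carrier CR.A_a_inv)
qed

lemma cyclotomic_induct [consumes 1, case_names one M zeta uminus add mult]:
  assumes "x \<in> carrier (cyclotomic_ring M \<zeta>)" "Q 1" "Q (1 / of_nat M)" "Q \<zeta>"
    and "\<And>x. x \<in> carrier (cyclotomic_ring M \<zeta>) \<Longrightarrow> Q x \<Longrightarrow> Q (- x)"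
    and "\<And>x y. x \<in> carrier (cyclotomic_ring M \<zeta>) \<Longrightarrow> y \<in> carrier (cyclotomic_ring M \<zeta>) \<Longrightarrow> Q x \<Longrightarrow> Q y \<Longrightarrow> Q (x + y)"
    and "\<And>x y. x \<in> carrier (cyclotomic_ring M \<zeta>) \<Longrightarrow> y \<in> carrier (cyclotomic_ring M \<zeta>) \<Longrightarrow> Q x \<Longrightarrow> Q y \<Longrightarrow> Q (x * y)"
  shows "Q x"
  using assms(1) unfolding cyclotomic_carrier
proof (induction rule: generate_ring.induct)
  case (incl h)
  then show ?case using assms(3,4) by auto
qed (use assms(2,5-7) in \<open>simp_all add: cyclotomic_carrier CR.A_a_inv\<close>)

text \<open>A rational functional with value \<open>1\<close> at \<open>x\<close> maps \<open>\<int>[1/M, \<zeta>]\<close> into \<open>d\<^sup>-\<^sup>1 \<int>[1/M]\<close> for some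
  fixed \<open>d\<close>; if \<open>x\<close> were divisible by all powers of \<open>p\<close>, then so would be \<open>d\<close>.\<close>

lemma cyclotomic_separated:
  assumes M: "M > 0" and \<zeta>: "primitive_root_of_one N \<zeta>" "N \<ge> 1" and p: "prime (p::nat)" "\<not> p dvd M"
    and x: "\<And>k. \<exists>c\<in>carrier (cyclotomic_ring M \<zeta>). x = of_nat (p ^ k) * c"
  shows "x = 0"
proof (rule ccontr)
  assume "x \<noteq> 0"
  then obtain lam :: "complex \<Rightarrow> rat" where lam: "\<And>x y. lam (x + y) = lam x + lam y"
    "\<And>r x. lam (of_rat r * x) = r * lam x" "lam x = 1" using exists_rational_functional[of x] by blast
  have lam_minus: "lam (- x) = - lam x" for x using lam(2)[of "-1" x] by simp
  obtain d :: nat where d: "d > 0" "\<forall>i<N. of_nat d * lam (\<zeta> ^ i) \<in> \<int>" using common_denominator[where r = "\<lambda>i. lam (\<zeta> ^ i)" and N = N] by blast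
  \<comment> \<open>Up to powers of \<open>M\<close> the denominators are bounded by
    \<open>d\<close>. Quantifying over all \<open>j\<close> makes \<open>T\<close> stable under
    multiplication by \<open>\<zeta>\<close>; letting \<open>e\<close> depend on \<open>y\<close>
    and \<open>j\<close> makes it stable under sums and under \<open>1 / M\<close>.\<close>
  define T where "T = {y. \<forall>j. \<exists>e. of_nat d * of_nat M ^ e * lam (y * \<zeta> ^ j) \<in> \<int>}"
  have T_one: "1 \<in> T" unfolding T_def
  proof (intro CollectI allI)
    fix j
    have "of_nat d * lam (\<zeta> ^ (j mod N)) \<in> \<int>" using d(2)[rule_format, of "j mod N"] \<zeta>(2) by (metis mod_less_divisor less_le_trans zero_less_one)
    then show "\<exists>e. of_nat d * of_nat M ^ e * lam (1 * \<zeta> ^ j) \<in> \<int>"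
      using primitive_root_mod[OF \<zeta>, of j] by (intro exI[of _ 0]) simp
  qed
  have T_add: "y + z \<in> T" if "y \<in> T" "z \<in> T" for y z unfolding T_def
  proof (intro CollectI allI)
    fix j
    obtain e f where e: "of_nat d * of_nat M ^ e * lam (y * \<zeta> ^ j) \<in> \<int>" "of_nat d * of_nat M ^ f * lam (z * \<zeta> ^ j) \<in> \<int>"
      using \<open>y \<in> T\<close> \<open>z \<in> T\<close> unfolding T_def by blast
    have "of_nat M ^ f * (of_nat d * of_nat M ^ e * lam (y * \<zeta> ^ j)) +
        of_nat M ^ e * (of_nat d * of_nat M ^ f * lam (z * \<zeta> ^ j)) \<in> \<int>"
      by (intro Ints_add Ints_mult e Ints_power) auto
    then show "\<exists>e. of_nat d * of_nat M ^ e * lam ((y + z) * \<zeta> ^ j) \<in> \<int>"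
      by (intro exI[of _ "e + f"]) (simp add: lam(1) algebra_simps power_add)
  qed
  have T_minus: "- y \<in> T" if "y \<in> T" for y
    using that by (auto simp: T_def lam_minus)
  have T_zeta: "\<zeta> * y \<in> T" if "y \<in> T" for y unfolding T_def
  proof (intro CollectI allI)
    fix j
    obtain e where "of_nat d * of_nat M ^ e * lam (y * \<zeta> ^ Suc j) \<in> \<int>" using \<open>y \<in> T\<close> unfolding T_def by blast
    then show "\<exists>e. of_nat d * of_nat M ^ e * lam (\<zeta> * y * \<zeta> ^ j) \<in> \<int>"
      by (intro exI[of _ e]) (simp add: algebra_simps)
  qed
  have T_M: "1 / of_nat M * y \<in> T" if "y \<in> T" for y unfolding T_def
  proof (intro CollectI allI)
    fix j
    obtain e where e: "of_nat d * of_nat M ^ e * lam (y * \<zeta> ^ j) \<in> \<int>" using \<open>y \<in> T\<close> unfolding T_def by blast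
    have "lam (1 / of_nat M * y * \<zeta> ^ j) = 1 / of_nat M * lam (y * \<zeta> ^ j)"
      using lam(2)[of "1 / of_nat M" "y * \<zeta> ^ j"] by (simp add: of_rat_divide mult.assoc)
    then show "\<exists>e. of_nat d * of_nat M ^ e * lam (1 / of_nat M * y * \<zeta> ^ j) \<in> \<int>"
      using e M by (intro exI[of _ "Suc e"]) (simp add: algebra_simps)
  qed
  have S: "\<forall>y\<in>T. c * y \<in> T" if "c \<in> carrier (cyclotomic_ring M \<zeta>)" for c
    using that
  proof (induction rule: cyclotomic_induct)
    case one
    show ?case by simp
  next
    case M
    show ?case using T_M by blast
  next
    case zeta
    show ?case using T_zeta by blast
  next
    case (uminus x)
    then show ?case using T_minus by (metis mult_minus_left)
  next
    case (add x y)
    then show ?case using T_add by (simp add: distrib_right)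
  next
    case (mult x y)
    then show ?case by (simp add: mult.assoc)
  qed
  have "p ^ k dvd d" for k
  proof -
    obtain c where c: "c \<in> carrier (cyclotomic_ring M \<zeta>)" "x = of_nat (p ^ k) * c" using x by blast
    then have "c \<in> T" using S T_one by force
    then obtain e where "of_nat d * of_nat M ^ e * lam (c * \<zeta> ^ 0) \<in> \<int>" unfolding T_def by blast
    then obtain z where z: "of_nat d * of_nat M ^ e * lam c = of_int z" by (auto elim: Ints_cases)
    \<comment> \<open>Since \<open>lam x = 1\<close>, the factorisation of \<open>x\<close> becomes
      an equation of integers, \<open>p ^ k * z = d * M ^ e\<close>. As \<open>p\<close> does not
      divide \<open>M\<close>, the whole of \<open>p ^ k\<close> divides \<open>d\<close>.\<close>
    have "of_nat (p ^ k) * lam c = 1" using lam(2)[of "of_nat (p ^ k)" c] lam(3) c(2) by (simp add: of_rat_power)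
    then have "(of_int (int (p ^ k) * z) :: rat) = of_int (int (d * M ^ e))"
      using z by (metis (no_types, lifting) mult.assoc mult.commute mult_1_right of_int_mult of_int_of_nat_eq of_nat_mult of_nat_power)
    then have "int (p ^ k) * z = int (d * M ^ e)" by (simp only: of_int_eq_iff)
    then have "int (p ^ k) dvd int (d * M ^ e)" by (metis dvd_triv_left)
    then have "p ^ k dvd d * M ^ e" by (simp only: int_dvd_int_iff)
    moreover have "coprime (p ^ k) (M ^ e)" using p by (simp add: prime_imp_coprime)
    ultimately show ?thesis by (simp add: coprime_dvd_mult_left_iff)
  qed
  \<comment> \<open>The exponent \<open>k = d\<close> already gives a contradiction.\<close>
  then have "p ^ d \<le> d" using d(1) by (meson dvd_imp_le)
  moreover have "d < 2 ^ d" by (rule less_exp)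
  moreover have "2 ^ d \<le> p ^ d" using prime_ge_2_nat[OF p(1)] by (intro power_mono) auto
  ultimately show False by simp
qed

lemma cyclotomic_half:
  assumes "even M" "M > 0"
  shows "1 / 2 \<in> carrier (cyclotomic_ring M \<zeta>)"
proof -
  interpret coeff_ring "cyclotomic_ring M \<zeta>" "carrier (cyclotomic_ring M \<zeta>)" by (rule cyclotomic_coeff_ring)
  obtain m where m: "M = 2 * m" using assms by blast
  have "1 / of_nat M \<in> carrier (cyclotomic_ring M \<zeta>)" unfolding cyclotomic_carrier by (rule generate_ring.incl) simp
  then have "of_nat m * (1 / of_nat M) \<in> carrier (cyclotomic_ring M \<zeta>)" by (intro K_mult K_of_nat)
  also have "of_nat m * (1 / of_nat M) = (1 / 2 :: complex)" using m assms by (simp add: field_simps)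
  finally show ?thesis .
qed

locale ring_endo = coeff_ring A K for A K +
  fixes \<phi> :: "complex \<Rightarrow> complex"
  assumes \<phi>_closed: "x \<in> K \<Longrightarrow> \<phi> x \<in> K" and \<phi>_one: "\<phi> 1 = 1"
    and \<phi>_add: "x \<in> K \<Longrightarrow> y \<in> K \<Longrightarrow> \<phi> (x + y) = \<phi> x + \<phi> y"
    and \<phi>_mult: "x \<in> K \<Longrightarrow> y \<in> K \<Longrightarrow> \<phi> (x * y) = \<phi> x * \<phi> y"
begin

lemma \<phi>_zero: "\<phi> 0 = 0" using \<phi>_add[OF K_zero K_zero] by simp

lemma \<phi>_uminus: "x \<in> K \<Longrightarrow> \<phi> (- x) = - \<phi> x"
  using \<phi>_add[of "- x" x] K_uminus[of x] \<phi>_zero by (simp add: add_eq_0_iff2)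

lemma \<phi>_sum: "(\<And>i. i \<in> I \<Longrightarrow> f i \<in> K) \<Longrightarrow> \<phi> (sum f I) = (\<Sum>i\<in>I. \<phi> (f i))"
  by (induction I rule: infinite_finite_induct) (auto simp: \<phi>_zero \<phi>_add K_sum)

lemma \<phi>_of_nat: "\<phi> (of_nat n) = of_nat n"
  by (induction n) (auto simp: \<phi>_zero \<phi>_add \<phi>_one K_one K_of_nat)

lemma \<phi>_power: "x \<in> K \<Longrightarrow> \<phi> (x ^ n) = \<phi> x ^ n"
proof (induction n)
  case (Suc n)
  have "x ^ n \<in> K" using Suc.prems by (induction n) (auto simp: K_one K_mult)
  with Suc show ?case by (simp add: \<phi>_mult)
qed (simp add: \<phi>_one)

end

lemma ring_endo_hom:
  assumes "coeff_ring A K" "\<phi> \<in> ring_hom A A"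
  shows "ring_endo A K \<phi>"
proof -
  interpret coeff_ring A K by fact
  show ?thesis
    by unfold_locales (use assms(2) in \<open>auto simp: ring_hom_def\<close>)
qed

text \<open>An endomorphism fixes \<open>1 / M\<close> and sends \<open>\<zeta>\<close> to an
  \<open>N\<close>-th root of unity, that is, to a power of \<open>\<zeta>\<close>. Two such maps
  commute on the generators.\<close>

lemma cyclotomic_endos_commute:
  assumes M: "M > 0" and \<zeta>: "primitive_root_of_one N \<zeta>" "N \<ge> 1"
    and \<phi>: "ring_endo (cyclotomic_ring M \<zeta>) (carrier (cyclotomic_ring M \<zeta>)) \<phi>"
    and \<psi>: "ring_endo (cyclotomic_ring M \<zeta>) (carrier (cyclotomic_ring M \<zeta>)) \<psi>"
    and x: "x \<in> carrier (cyclotomic_ring M \<zeta>)"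
  shows "\<phi> (\<psi> x) = \<psi> (\<phi> x)"
proof -
  interpret F: ring_endo "cyclotomic_ring M \<zeta>" "carrier (cyclotomic_ring M \<zeta>)" \<phi> by fact
  interpret G: ring_endo "cyclotomic_ring M \<zeta>" "carrier (cyclotomic_ring M \<zeta>)" \<psi> by fact
  have zK: "\<zeta> \<in> carrier (cyclotomic_ring M \<zeta>)" "1 / of_nat M \<in> carrier (cyclotomic_ring M \<zeta>)"
    unfolding cyclotomic_carrier by (rule generate_ring.incl, simp)+
  have "\<phi> \<zeta> ^ N = 1" "\<psi> \<zeta> ^ N = 1"
    using F.\<phi>_power[OF zK(1), of N] G.\<phi>_power[OF zK(1), of N] \<zeta>(1) by (simp_all add: primitive_root_of_one_def F.\<phi>_one G.\<phi>_one)
  then obtain i j where ij: "\<phi> \<zeta> = \<zeta> ^ i" "\<psi> \<zeta> = \<zeta> ^ j" using roots_of_unity_eq_powers[OF \<zeta>, of "\<phi> \<zeta>"] roots_of_unity_eq_powers[OF \<zeta>, of "\<psi> \<zeta>"] by blast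
  have M': "h (1 / of_nat M) = 1 / of_nat M" if "ring_endo (cyclotomic_ring M \<zeta>) (carrier (cyclotomic_ring M \<zeta>)) h" for h
  proof -
    interpret H: ring_endo "cyclotomic_ring M \<zeta>" "carrier (cyclotomic_ring M \<zeta>)" h by fact
    have "h (of_nat M * (1 / of_nat M)) = of_nat M * h (1 / of_nat M)"
      unfolding H.\<phi>_mult[OF F.K_of_nat zK(2)] H.\<phi>_of_nat ..
    moreover have e: "of_nat M * (1 / of_nat M) = (1 :: complex)" using M by simp
    ultimately have "of_nat M * h (1 / of_nat M) = of_nat M * (1 / of_nat M)" using H.\<phi>_one by metis
    then show ?thesis using M by (metis mult_left_cancel of_nat_0_eq_iff less_numeral_extra(3))
  qed
  show ?thesis using x
  proof (induction rule: cyclotomic_induct)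
    case zeta
    have "\<phi> (\<psi> \<zeta>) = (\<zeta> ^ i) ^ j" "\<psi> (\<phi> \<zeta>) = (\<zeta> ^ j) ^ i"
      by (simp_all only: ij F.\<phi>_power[OF zK(1)] G.\<phi>_power[OF zK(1)])
    then show ?case by (simp only: power_mult[symmetric] mult.commute)
  next
    case one
    show ?case by (simp only: F.\<phi>_one G.\<phi>_one)
  next
    case M
    show ?case by (simp only: M'[OF \<phi>] M'[OF \<psi>])
  next
    case (uminus x)
    then show ?case by (simp only: F.\<phi>_uminus G.\<phi>_uminus F.\<phi>_closed G.\<phi>_closed)
  next
    case (add x y)
    then show ?case by (simp only: F.\<phi>_add G.\<phi>_add F.\<phi>_closed G.\<phi>_closed)
  next
    case (mult x y)
    then show ?case by (simp only: F.\<phi>_mult G.\<phi>_mult F.\<phi>_closed G.\<phi>_closed)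
  qed
qed

section \<open>Substitution into power series\<close>

definition tmon :: "'v multiset \<Rightarrow> 'v mps" where "tmon m = prod_mset (image_mset tv m)"

lemma cf_tv_mult: "cf (tv v * F) m = (if v \<in># m then cf F (m - {#v#}) else 0)"
proof -
  have "cf (tv v * F) m = (\<Sum>k\<in>{k. k \<subseteq># m}. if k = {#v#} then cf F (m - k) else 0)"
    by (auto simp: cf_mult cf_tv intro!: sum.cong)
  also have "\<dots> = (if v \<in># m then cf F (m - {#v#}) else 0)"
    using finite_sub_mset[of m] by (simp add: sum.delta)
  finally show ?thesis .
qed

lemma cf_tmon: "cf (tmon k) m = (if m = k then 1 else 0)"
proof (induction k arbitrary: m)
  case empty
  show ?case by (simp add: tmon_def cf_one)
next
  case (add v k)
  have "cf (tmon (add_mset v k)) m = (if v \<in># m then cf (tmon k) (m - {#v#}) else 0)"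
    by (simp add: tmon_def cf_tv_mult)
  also have "\<dots> = (if m = add_mset v k then 1 else 0)"
    using add by auto
  finally show ?case .
qed

definition tpoly :: "nat \<Rightarrow> 'v::finite mps \<Rightarrow> 'v mps" where
  "tpoly n F = (\<Sum>m\<in>{m. size m \<le> n}. cst (cf F m) * tmon m)"

lemma tpoly_approx: "F - tpoly n F \<in> tord (Suc n)"
  unfolding tord_def
proof (intro CollectI allI impI)
  fix m :: "'a multiset" assume m: "size m < Suc n"
  have "cf (tpoly n F) m = (\<Sum>k\<in>{k. size k \<le> n}. if k = m then cf F k else 0)"
    by (auto simp: tpoly_def cf_sum cf_tmon intro!: sum.cong)
  also have "\<dots> = cf F m" using m finite_mset_size_le[where 'v = 'a] by (simp add: sum.delta)
  finally show "cf (F - tpoly n F) m = 0" by simp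
qed

section \<open>Divisibility of series by integers\<close>

context coeff_ring
begin

lemma PA_cf: "F \<in> PA \<Longrightarrow> cf F m \<in> K" by (simp add: PA_def)

definition pdiv :: "nat \<Rightarrow> 'v mps set" where "pdiv n = {F. \<exists>c\<in>PA. F = of_nat n * c}"

text \<open>Testing divisibility one coefficient at a time is what allows congruences modulo
  \<open>p ^ k\<close> to be combined with truncation in \<open>T\<close>.\<close>

lemma pdiv_iff: "F \<in> pdiv n \<longleftrightarrow> (\<forall>m. \<exists>c\<in>K. cf F m = of_nat n * c)"
proof
  assume "\<forall>m. \<exists>c\<in>K. cf F m = of_nat n * c"
  then obtain c where c: "\<And>m. c m \<in> K" "\<And>m. cf F m = of_nat n * c m" by metis
  then have "F = of_nat n * Mps c" by (intro mps_eqI) simp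
  moreover have "Mps c \<in> PA" using c by (simp add: PA_def)
  ultimately show "F \<in> pdiv n" by (auto simp: pdiv_def)
qed (auto simp: pdiv_def PA_def)

lemma pdiv_PA: "F \<in> pdiv n \<Longrightarrow> F \<in> PA" by (auto simp: pdiv_def intro!: PA_mult PA_of_nat)

lemma pdivI: "c \<in> PA \<Longrightarrow> of_nat n * c \<in> pdiv n" by (auto simp: pdiv_def)

lemma pdiv_zero: "0 \<in> pdiv n" using pdivI[of 0 n] by simp

lemma pdiv_add: "F \<in> pdiv n \<Longrightarrow> G \<in> pdiv n \<Longrightarrow> F + G \<in> pdiv n"
  by (auto simp: pdiv_def simp flip: distrib_left intro: PA_add)

lemma pdiv_uminus: "F \<in> pdiv n \<Longrightarrow> - F \<in> pdiv n"
  by (auto simp: pdiv_def simp flip: mult_minus_right intro: PA_uminus)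

lemma pdiv_diff: "F \<in> pdiv n \<Longrightarrow> G \<in> pdiv n \<Longrightarrow> F - G \<in> pdiv n"
  using pdiv_add[OF _ pdiv_uminus, of F n G] by simp

lemma pdiv_mult: "F \<in> pdiv n \<Longrightarrow> G \<in> PA \<Longrightarrow> F * G \<in> pdiv n"
  by (auto simp: pdiv_def mult.assoc intro!: PA_mult)

lemma pdiv_mult': "F \<in> pdiv n \<Longrightarrow> G \<in> PA \<Longrightarrow> G * F \<in> pdiv n"
  using pdiv_mult[of F n G] by (simp add: mult.commute)

lemma pdiv_sum: "(\<And>i. i \<in> I \<Longrightarrow> F i \<in> pdiv n) \<Longrightarrow> sum F I \<in> pdiv n"
  by (induction I rule: infinite_finite_induct) (auto simp: pdiv_add pdiv_zero)

lemma freshmans_dream_mod: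
  assumes p: "prime p" and F: "F \<in> PA" and G: "G \<in> PA"
  shows "(F + G) ^ p - (F ^ p + G ^ p) \<in> pdiv p"
proof -
  have p0: "p > 0" using p prime_gt_0_nat by blast
  have i: "{..p} = insert 0 (insert p {0<..<p})" using p0 by auto
  have "(F + G) ^ p = (\<Sum>k\<le>p. of_nat (p choose k) * F ^ k * G ^ (p - k))" by (rule binomial_ring)
  also have "\<dots> = G ^ p + F ^ p + (\<Sum>k\<in>{0<..<p}. of_nat (p choose k) * F ^ k * G ^ (p - k))"
    unfolding i using p0 by simp
  finally have e: "(F + G) ^ p - (F ^ p + G ^ p) = (\<Sum>k\<in>{0<..<p}. of_nat (p choose k) * F ^ k * G ^ (p - k))"
    by simp
  have "of_nat (p choose k) * F ^ k * G ^ (p - k) \<in> pdiv p" if k: "k \<in> {0<..<p}" for k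
  proof -
    obtain d where "p choose k = p * d" using dvd_choose_prime[of k p] k p by (auto elim: dvdE)
    then show ?thesis using F G
      by (auto simp: pdiv_def mult.assoc intro!: bexI[of _ "of_nat d * (F ^ k * G ^ (p - k))"] PA_mult PA_power PA_of_nat)
  qed
  then show ?thesis unfolding e by (rule pdiv_sum)
qed

end

section \<open>The substitution homomorphism\<close>

locale substitution = ring_endo A K \<phi> for A K \<phi> +
  fixes y :: "'v::finite \<Rightarrow> 'v mps"
  assumes y_PA: "y v \<in> PA" and y_ord: "y v \<in> tord 1"
begin

definition ymon :: "'v multiset \<Rightarrow> 'v mps" where "ymon m = prod_mset (image_mset y m)"

lemma ymon_PA: "ymon m \<in> PA"
  by (induction m) (auto simp: ymon_def PA_mult y_PA)

lemma ymon_ord: "ymon m \<in> tord (size m)"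
proof (induction m)
  case (add v m)
  show ?case using tord_mult_add[OF y_ord add.IH] by (simp add: ymon_def)
qed (simp add: ymon_def)

lemma ymon_add: "ymon (k + l) = ymon k * ymon l"
  by (simp add: ymon_def)

text \<open>\<open>\<Sum> f\<^sub>m T\<^sup>m \<mapsto> \<Sum> \<phi>(f\<^sub>m) y\<^sup>m\<close>\<close>

definition sub :: "'v mps \<Rightarrow> 'v mps" where
  "sub F = ser (\<lambda>l. \<Sum>m\<in>{m. size m = l}. cst (\<phi> (cf F m)) * ymon m)"

definition subn :: "nat \<Rightarrow> 'v mps \<Rightarrow> 'v mps" where
  "subn n F = (\<Sum>m\<in>{m. size m \<le> n}. cst (\<phi> (cf F m)) * ymon m)"

lemma sub_approx: "sub F - subn n F \<in> tord (Suc n)"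
proof -
  have "(\<Sum>l\<le>n. \<Sum>m\<in>{m. size m = l}. cst (\<phi> (cf F m)) * ymon m) =
      (\<Sum>l\<in>{..n}. \<Sum>m\<in>{m \<in> {m. size m \<le> n}. size m = l}. cst (\<phi> (cf F m)) * ymon m)"
    by (intro sum.cong arg_cong[where f = "sum _"]) auto
  also have "\<dots> = subn n F"
    unfolding subn_def by (rule sum.group) (auto simp: finite_mset_size_le)
  finally have "subn n F = (\<Sum>l\<le>n. \<Sum>m\<in>{m. size m = l}. cst (\<phi> (cf F m)) * ymon m)" by simp
  then show ?thesis unfolding sub_def
    by (simp only:) (rule ser_approx, auto intro!: tord_sum tord_mult_right ymon_ord)
qed

lemma sub_eqI: "(\<And>n. subn n F - G \<in> tord (Suc n)) \<Longrightarrow> sub F = G"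
proof (rule tord_eqI)
  fix k assume *: "\<And>n. subn n F - G \<in> tord (Suc n)"
  have "(sub F - subn k F) + (subn k F - G) \<in> tord (Suc k)" by (intro tord_add sub_approx *)
  then show "sub F - G \<in> tord k" by (auto intro: tord_mono)
qed

lemma sub_PA: "F \<in> PA \<Longrightarrow> sub F \<in> PA"
  by (auto simp: sub_def intro!: PA_ser PA_sum PA_mult PA_cst \<phi>_closed ymon_PA PA_cf)

lemma sub_add: "F \<in> PA \<Longrightarrow> G \<in> PA \<Longrightarrow> sub (F + G) = sub F + sub G"
proof (rule sub_eqI)
  fix n assume "F \<in> PA" "G \<in> PA"
  then have "subn n (F + G) = subn n F + subn n G"
    by (simp add: subn_def \<phi>_add PA_cf cst_add algebra_simps sum.distrib)
  then have "subn n (F + G) - (sub F + sub G) = - ((sub F - subn n F) + (sub G - subn n G))" by simp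
  also have "\<dots> \<in> tord (Suc n)" by (intro tord_uminus tord_add sub_approx)
  finally show "subn n (F + G) - (sub F + sub G) \<in> tord (Suc n)" .
qed

lemma sub_cst: "sub (cst a) = cst (\<phi> a)"
proof (rule sub_eqI)
  fix n
  have "subn n (cst a) = (\<Sum>m\<in>{m :: 'v multiset. size m \<le> n}. if m = {#} then cst (\<phi> a) else 0)"
    unfolding subn_def by (rule sum.cong) (auto simp: cf_cst ymon_def \<phi>_zero)
  also have "\<dots> = cst (\<phi> a)" by (simp add: sum.delta[OF finite_mset_size_le])
  finally show "subn n (cst a) - cst (\<phi> a) \<in> tord (Suc n)" by simp
qed

lemma sub_zero: "sub 0 = 0" using sub_cst[of 0] by (simp add: \<phi>_zero)

lemma sub_one: "sub 1 = 1" using sub_cst[of 1] by (simp add: \<phi>_one cst_1)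

lemma sub_uminus: "F \<in> PA \<Longrightarrow> sub (- F) = - sub F"
  using sub_add[of "- F" F] PA_uminus[of F] sub_zero by (simp add: add_eq_0_iff2)

lemma sub_diff: "F \<in> PA \<Longrightarrow> G \<in> PA \<Longrightarrow> sub (F - G) = sub F - sub G"
  using sub_add[OF _ PA_uminus, of F G] sub_uminus[of G] by simp

lemma sub_tv: "sub (tv v) = y v"
proof (rule sub_eqI)
  fix n
  have e: "subn n (tv v) = (\<Sum>m\<in>{m. size m \<le> n}. if m = {#v#} then y v else 0)"
    unfolding subn_def by (rule sum.cong) (auto simp: cf_tv ymon_def \<phi>_zero \<phi>_one cst_1)
  show "subn n (tv v) - y v \<in> tord (Suc n)"
  proof (cases "n = 0")
    case True
    then show ?thesis unfolding e using tord_uminus[OF y_ord, of v] by simp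
  next
    case False
    then have "subn n (tv v) = y v" unfolding e by (simp add: sum.delta[OF finite_mset_size_le])
    then show ?thesis by simp
  qed
qed

lemma sub_mult:
  assumes F: "F \<in> PA" and G: "G \<in> PA"
  shows "sub (F * G) = sub F * sub G"
proof (rule sub_eqI)
  fix n
  let ?S = "{m :: 'v multiset. size m \<le> n}"
  let ?h = "\<lambda>q. (cst (\<phi> (cf F (fst q))) * ymon (fst q)) * (cst (\<phi> (cf G (snd q))) * ymon (snd q))"
  \<comment> \<open>The truncation of the product involves exactly the pairs of total degree at most
    \<open>n\<close>. The product of the truncations contains further pairs, and each of those
    contributes a term of order above \<open>n\<close>.\<close>
  let ?I = "{q. size (fst q) + size (snd q) \<le> n} :: ('v multiset \<times> 'v multiset) set"
  have S: "finite ?S" by (rule finite_mset_size_le)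
  have sub: "?I \<subseteq> ?S \<times> ?S" by auto
  have c: "cf F m \<in> K" "cf G m \<in> K" for m using F G by (auto simp: PA_cf)
  have cs: "cst (sum f I) = (\<Sum>i\<in>I. cst (f i) :: 'v mps)" for f and I :: "'v multiset set"
    by (induction I rule: infinite_finite_induct) (auto simp: cst_add)
  have "subn n (F * G) = (\<Sum>m\<in>?S. \<Sum>k\<in>{k. k \<subseteq># m}. ?h (k, m - k))"
    unfolding subn_def
  proof (rule sum.cong)
    fix m :: "'v multiset"
    have "cst (\<phi> (cf (F * G) m)) * ymon m = (\<Sum>k\<in>{k. k \<subseteq># m}. cst (\<phi> (cf F k)) * cst (\<phi> (cf G (m - k))) * ymon m)"
      by (simp add: cf_mult \<phi>_sum \<phi>_mult K_mult c cs cst_mult sum_distrib_right)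
    also have "\<dots> = (\<Sum>k\<in>{k. k \<subseteq># m}. ?h (k, m - k))"
    proof (rule sum.cong)
      fix k assume "k \<in> {k. k \<subseteq># m}"
      then have "ymon m = ymon k * ymon (m - k)" by (simp flip: ymon_add)
      then show "cst (\<phi> (cf F k)) * cst (\<phi> (cf G (m - k))) * ymon m = ?h (k, m - k)"
        by (simp add: algebra_simps)
    qed simp
    finally show "cst (\<phi> (cf (F * G) m)) * ymon m = (\<Sum>k\<in>{k. k \<subseteq># m}. ?h (k, m - k))" .
  qed simp
  also have "\<dots> = (\<Sum>q\<in>Sigma ?S (\<lambda>m. {k. k \<subseteq># m}). ?h (snd q, fst q - snd q))"
    by (subst sum.Sigma) (auto simp: S finite_sub_mset split_def)
  also have "\<dots> = (\<Sum>q\<in>?I. ?h q)"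
    by (rule sum.reindex_bij_witness[where j = "\<lambda>q. (snd q, fst q - snd q)" and i = "\<lambda>q. (fst q + snd q, fst q)"])
      (auto simp: size_Diff_submset size_mset_mono)
  finally have 1: "subn n (F * G) = (\<Sum>q\<in>?I. ?h q)" .
  have "subn n F * subn n G = (\<Sum>q\<in>?S \<times> ?S. ?h q)"
    by (simp add: subn_def sum_product sum.cartesian_product split_def)
  also have "\<dots> = (\<Sum>q\<in>?S \<times> ?S - ?I. ?h q) + (\<Sum>q\<in>?I. ?h q)"
    by (rule sum.subset_diff[OF sub]) (use S in auto)
  finally have 2: "subn n F * subn n G - subn n (F * G) = (\<Sum>q\<in>?S \<times> ?S - ?I. ?h q)" by (simp add: 1)
  have "?h q \<in> tord (Suc n)" if "q \<in> ?S \<times> ?S - ?I" for q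
  proof -
    have "?h q \<in> tord (size (fst q) + size (snd q))"
      by (intro tord_mult_add tord_mult_right ymon_ord)
    then show ?thesis by (rule tord_mono) (use that in auto)
  qed
  then have 3: "subn n F * subn n G - subn n (F * G) \<in> tord (Suc n)" unfolding 2 by (rule tord_sum)
  have "subn n (F * G) - sub F * sub G = - (subn n F * subn n G - subn n (F * G))
      - ((sub F - subn n F) * sub G + subn n F * (sub G - subn n G))" by (simp add: algebra_simps)
  also have "\<dots> \<in> tord (Suc n)"
    by (intro tord_diff tord_uminus 3 tord_add tord_mult_left[OF sub_approx] tord_mult_right[OF sub_approx])
  finally show "subn n (F * G) - sub F * sub G \<in> tord (Suc n)" .
qed

lemma sub_power: "F \<in> PA \<Longrightarrow> sub (F ^ n) = sub F ^ n"
  by (induction n) (auto simp: sub_one sub_mult PA_power)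

lemma sub_of_nat: "sub (of_nat n) = of_nat n"
  using sub_cst[of "of_nat n"] by (simp add: cst_of_nat \<phi>_of_nat)

lemma sub_pdiv: "F \<in> pdiv n \<Longrightarrow> sub F \<in> pdiv n"
  by (auto simp: pdiv_def sub_mult PA_of_nat sub_of_nat intro!: bexI[OF _ sub_PA])

lemma sub_tord:
  assumes "F \<in> tord k"
  shows "sub F \<in> tord k"
proof -
  have "subn k F \<in> tord k" unfolding subn_def
  proof (rule tord_sum)
    fix m :: "'v multiset"
    show "cst (\<phi> (cf F m)) * ymon m \<in> tord k"
    proof (cases "size m < k")
      case True
      then show ?thesis using assms by (simp add: tord_def \<phi>_zero)
    next
      case False
      then show ?thesis using tord_mono[OF ymon_ord, of k m] by (intro tord_mult_right) simp
    qed
  qed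
  then have "(sub F - subn k F) + subn k F \<in> tord k"
    by (intro tord_add tord_mono[OF sub_approx]) auto
  then show ?thesis by simp
qed

lemma cf_sub_linear:
  assumes "F \<in> tord 1"
  shows "cf (sub F) {#v#} = (\<Sum>u\<in>UNIV. \<phi> (cf F {#u#}) * cf (y u) {#v#})"
proof -
  have i: "{m :: 'v multiset. size m \<le> 1} = insert {#} ((\<lambda>u. {#u#}) ` UNIV)"
    by (auto simp: le_Suc_eq image_iff size_1_singleton_mset)
  have "cf (sub F - subn 1 F) {#v#} = 0" using sub_approx[of F 1] by (simp add: tord_def)
  then have "cf (sub F) {#v#} = cf (subn 1 F) {#v#}" by simp
  also have "\<dots> = (\<Sum>m\<in>(\<lambda>u. {#u#}) ` UNIV. \<phi> (cf F m) * cf (ymon m) {#v#})"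
    using assms unfolding subn_def i tord_1_iff
    by (subst sum.insert) (auto simp: cf_sum \<phi>_zero)
  also have "\<dots> = (\<Sum>u\<in>UNIV. \<phi> (cf F {#u#}) * cf (y u) {#v#})"
    by (subst sum.reindex) (auto simp: inj_on_def ymon_def)
  finally show ?thesis .
qed

text \<open>The series that satisfy the congruence are closed under products and, by the binomial
  theorem modulo \<open>p\<close>, under sums. The hypothesis is about \<open>tv v + cst u\<close>
  because the congruence is known for the entries of \<open>x = 1 + T\<close>; the constant is then
  split off. The step from polynomials to \<open>F\<close> works because a coefficient of either
  side depends only on a truncation of \<open>F\<close>.\<close>

lemma sub_frobenius:
  assumes p: "prime p" and \<phi>: "\<And>a. a \<in> K \<Longrightarrow> \<exists>c\<in>K. \<phi> a = a ^ p + of_nat p * c"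
    and y: "\<And>v. \<exists>u\<in>K. sub (tv v + cst u) - (tv v + cst u) ^ p \<in> pdiv p"
    and F: "F \<in> PA"
  shows "sub F - F ^ p \<in> pdiv p"
proof -
  define Q where "Q = {F \<in> PA. sub F - F ^ p \<in> pdiv p}"
  have Q_add: "F + G \<in> Q" if "F \<in> Q" "G \<in> Q" for F G
  proof -
    have "sub (F + G) - (F + G) ^ p = (sub F - F ^ p) + (sub G - G ^ p) - ((F + G) ^ p - (F ^ p + G ^ p))"
      using that by (simp add: Q_def sub_add)
    also have "\<dots> \<in> pdiv p"
      by (rule pdiv_diff[OF pdiv_add freshmans_dream_mod[OF p]]) (use that in \<open>auto simp: Q_def\<close>)
    finally show ?thesis using that by (simp add: Q_def PA_add)
  qed
  have Q_mult: "F * G \<in> Q" if "F \<in> Q" "G \<in> Q" for F G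
  proof -
    have "sub (F * G) - (F * G) ^ p = (sub F - F ^ p) * sub G + F ^ p * (sub G - G ^ p)"
      using that by (simp add: Q_def sub_mult algebra_simps power_mult_distrib)
    also have "\<dots> \<in> pdiv p" using that
      by (intro pdiv_add pdiv_mult pdiv_mult' PA_power sub_PA) (auto simp: Q_def)
    finally show ?thesis using that by (simp add: Q_def PA_mult)
  qed
  have Q_cst: "cst a \<in> Q" if a: "a \<in> K" for a
  proof -
    obtain c where c: "c \<in> K" "\<phi> a = a ^ p + of_nat p * c" using \<phi>[OF a] by blast
    have "sub (cst a) - cst a ^ p = of_nat p * cst c"
      unfolding sub_cst c(2) by (simp add: cst_add cst_mult cst_power cst_of_nat)
    then show ?thesis using pdivI[OF PA_cst[OF c(1)], of p] that by (simp add: Q_def PA_cst)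
  qed
  have Q_tv: "tv v \<in> Q" for v
  proof -
    obtain u where u: "u \<in> K" "sub (tv v + cst u) - (tv v + cst u) ^ p \<in> pdiv p" using y by blast
    then have "tv v + cst u \<in> Q" by (auto simp: Q_def intro!: PA_add PA_tv PA_cst)
    then have "(tv v + cst u) + cst (- u) \<in> Q" by (rule Q_add[OF _ Q_cst[OF K_uminus[OF u(1)]]])
    then show ?thesis by (simp add: cst_uminus)
  qed
  have Q_sum: "sum f I \<in> Q" if "\<And>i. i \<in> I \<Longrightarrow> f i \<in> Q" for f :: "'v multiset \<Rightarrow> 'v mps" and I
    using that Q_cst[OF K_zero] by (induction I rule: infinite_finite_induct) (auto simp: Q_add)
  have Q_tmon: "tmon m \<in> Q" for m
    using Q_cst[OF K_one] by (induction m) (auto simp: tmon_def cst_1 Q_mult Q_tv)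
  have Q_tpoly: "tpoly n F \<in> Q" for n
    unfolding tpoly_def using F by (intro Q_sum Q_mult Q_cst Q_tmon PA_cf)
  show ?thesis unfolding pdiv_iff
  proof
    fix m :: "'v multiset"
    let ?n = "size m"
    let ?G = "tpoly ?n F"
    have G: "?G \<in> PA" "sub ?G - ?G ^ p \<in> pdiv p" using Q_tpoly by (auto simp: Q_def)
    have d: "F ^ k - ?G ^ k \<in> tord (Suc ?n)" for k
    proof (induction k)
      case (Suc k)
      have "F ^ Suc k - ?G ^ Suc k = F * (F ^ k - ?G ^ k) + (F - ?G) * ?G ^ k" by (simp add: algebra_simps)
      also have "\<dots> \<in> tord (Suc ?n)"
        by (intro tord_add tord_mult_right[OF Suc] tord_mult_left[OF tpoly_approx])
      finally show ?case .
    qed simp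
    have "(sub F - F ^ p) - (sub ?G - ?G ^ p) = sub (F - ?G) - (F ^ p - ?G ^ p)"
      using F G by (simp add: sub_diff)
    also have "\<dots> \<in> tord (Suc ?n)" by (intro tord_diff d sub_tord tpoly_approx)
    finally have "cf ((sub F - F ^ p) - (sub ?G - ?G ^ p)) m = 0" by (simp add: tord_def)
    then have "cf (sub F - F ^ p) m = cf (sub ?G - ?G ^ p) m" by simp
    then show "\<exists>c\<in>K. cf (sub F - F ^ p) m = of_nat p * c" using G(2) by (metis pdiv_iff)
  qed
qed

end

section \<open>Taylor expansion at the identity\<close>

context coeff_ring
begin

lemma GL_plain: "plain_cring (GL_coord A :: ('n::finite \<times> 'n, complex) pseries ring)"
  by (simp add: plain_cring_def GL_cring)

lemma GL_carrier_iff [simp]: "cf F \<in> carrier (GL_coord A) \<longleftrightarrow> F \<in> GO"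
  by (simp add: GO_def)

lemma GL_add: "cf F \<oplus>\<^bsub>GL_coord A\<^esub> cf G = cf (F + G)"
  by (simp only: GL_coord_simps P_add)

lemma GL_mult: "F \<in> GO \<Longrightarrow> G \<in> GO \<Longrightarrow> cf F \<otimes>\<^bsub>GL_coord A\<^esub> cf G = cf (F * G)"
  by (simp add: GL_coord_simps P_mult GO_PA)

lemma GL_zero: "\<zero>\<^bsub>GL_coord A\<^esub> = cf 0" by (simp only: GL_coord_simps P_zero)

lemma GL_one: "\<one>\<^bsub>GL_coord A\<^esub> = cf 1" by (simp only: GL_coord_simps P_one)

lemma GL_a_inv:
  fixes F :: "('n::finite \<times> 'n) mps"
  assumes F: "F \<in> GO"
  shows "\<ominus>\<^bsub>GL_coord A\<^esub> cf F = cf (- F)"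
proof -
  interpret O: cring "GL_coord A :: ('n \<times> 'n, complex) pseries ring" by (rule GL_cring)
  have "cf (- F) \<oplus>\<^bsub>GL_coord A\<^esub> cf F = \<zero>\<^bsub>GL_coord A\<^esub>"
    unfolding GL_add GL_zero by (simp del: cf_simps)
  then show ?thesis by (rule O.minus_equality) (simp_all add: F GO_uminus del: cf_simps)
qed

lemma GL_minus: "F \<in> GO \<Longrightarrow> G \<in> GO \<Longrightarrow> cf F \<ominus>\<^bsub>GL_coord A\<^esub> cf G = cf (F - G)"
  by (simp add: a_minus_def GL_a_inv GL_add del: cf_simps)

lemma GL_add_pow:
  fixes F :: "('n::finite \<times> 'n) mps"
  shows "[(n::nat)] \<cdot>\<^bsub>GL_coord A\<^esub> cf F = cf (of_nat n * F)"
proof -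
  interpret O: cring "GL_coord A :: ('n \<times> 'n, complex) pseries ring" by (rule GL_cring)
  show ?thesis by (induction n) (simp_all add: GL_zero GL_add distrib_right add.commute del: cf_simps cf_of_nat_mult)
qed

lemma GL_p_ideal:
  fixes F :: "('n::finite \<times> 'n) mps"
  shows "cf F \<in> p_ideal (GL_coord A) p k \<longleftrightarrow> (\<exists>C\<in>GO. F = of_nat (p ^ k) * C)"
proof -
  interpret O: plain_cring "GL_coord A :: ('n \<times> 'n, complex) pseries ring" by (rule GL_plain)
  have "cf F \<in> p_ideal (GL_coord A) p k \<longleftrightarrow> (\<exists>C\<in>GO. cf F = cf (of_nat (p ^ k) * C))"
    unfolding O.p_ideal_iff by (metis GL_add_pow GL_carrier GL_carrier_iff)
  then show ?thesis by (simp only: cf_inject)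
qed

lemma GL_hat_ex:
  fixes X :: "('n::finite, complex) GL_hat"
  assumes X: "X \<in> carrier (GL_completion A p)"
  shows "\<exists>G\<in>GO. cf G \<in> X k"
proof -
  interpret O: plain_cring "GL_coord A :: ('n \<times> 'n, complex) pseries ring" by (rule GL_plain)
  obtain a where a: "a \<in> X k" using O.padic_ex'[OF X] by blast
  then have "a \<in> carrier (GL_coord A)" using O.padic_mem(1)[OF X] by blast
  then show ?thesis using a by (auto simp: GL_carrier)
qed

lemma GL_hat_mem:
  fixes X :: "('n::finite, complex) GL_hat"
  assumes X: "X \<in> carrier (GL_completion A p)" and G: "cf G \<in> X k"
  shows "G \<in> GO"
proof -
  interpret O: plain_cring "GL_coord A :: ('n \<times> 'n, complex) pseries ring" by (rule GL_plain)
  show ?thesis using O.padic_mem(1)[OF X G] by simp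
qed

lemma GL_hat_mem_iff:
  fixes X :: "('n::finite, complex) GL_hat"
  assumes X: "X \<in> carrier (GL_completion A p)" and G: "cf G \<in> X k" and H: "H \<in> GO"
  shows "cf H \<in> X k \<longleftrightarrow> (\<exists>C\<in>GO. H - G = of_nat (p ^ k) * C)"
proof -
  interpret O: plain_cring "GL_coord A :: ('n \<times> 'n, complex) pseries ring" by (rule GL_plain)
  show ?thesis using O.padic_mem_iff[OF X G, of "cf H"] H GL_hat_mem[OF X G]
    by (simp add: GL_minus GL_p_ideal del: cf_simps)
qed

lemma GL_hat_cong:
  fixes X :: "('n::finite, complex) GL_hat"
  assumes X: "X \<in> carrier (GL_completion A p)" and G: "cf G \<in> X k" and H: "cf H \<in> X k"
  shows "H - G \<in> pdiv (p ^ k)"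
proof -
  obtain C where "C \<in> GO" "H - G = of_nat (p ^ k) * C"
    using GL_hat_mem_iff[OF X G GL_hat_mem[OF X H]] H by blast
  then show ?thesis using GO_PA by (auto simp: pdiv_def)
qed

text \<open>\<open>F\<close> is the Taylor expansion at \<open>1\<close> of the element \<open>X\<close> of the completed coordinate ring.\<close>

definition tay :: "nat \<Rightarrow> ('n::finite, complex) GL_hat \<Rightarrow> ('n \<times> 'n) mps \<Rightarrow> bool" where
  "tay p X F \<longleftrightarrow> X \<in> carrier (GL_completion A p) \<and> F \<in> PA \<and>
     (\<forall>k G. cf G \<in> X k \<longrightarrow> G - F \<in> pdiv (p ^ k))"

text \<open>Two representatives at one level differ by a multiple of \<open>p ^ k\<close>, so one
  good representative for each level suffices.\<close>

lemma tayI: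
  assumes X: "X \<in> carrier (GL_completion A p)" and F: "F \<in> PA"
    and e: "\<And>k. \<exists>G. cf G \<in> X k \<and> G - F \<in> pdiv (p ^ k)"
  shows "tay p X F"
proof -
  have "H - F \<in> pdiv (p ^ k)" if "cf H \<in> X k" for H k
  proof -
    obtain G where G: "cf G \<in> X k" "G - F \<in> pdiv (p ^ k)" using e by blast
    have "(H - G) + (G - F) \<in> pdiv (p ^ k)" by (rule pdiv_add[OF GL_hat_cong[OF X G(1) that] G(2)])
    then show ?thesis by simp
  qed
  then show ?thesis using X F by (simp add: tay_def)
qed

lemma tay_closed: "tay p X F \<Longrightarrow> X \<in> carrier (GL_completion A p)"
  and tay_PA: "tay p X F \<Longrightarrow> F \<in> PA"
  by (simp_all add: tay_def)

lemma tay_ex: "tay p X F \<Longrightarrow> \<exists>G\<in>GO. cf G \<in> X k \<and> G - F \<in> pdiv (p ^ k)"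
  using GL_hat_ex by (fastforce simp: tay_def)

lemma tay_to_completion:
  fixes F :: "('n::finite \<times> 'n) mps"
  assumes F: "F \<in> GO"
  shows "tay p (to_completion (GL_coord A) p (cf F)) F"
proof -
  interpret O: plain_cring "GL_coord A :: ('n \<times> 'n, complex) pseries ring" by (rule GL_plain)
  show ?thesis
    by (rule tayI)
      (use F in \<open>auto simp: O.to_completion_closed GO_PA pdiv_zero intro!: exI[of _ F] O.to_completion_mem\<close>)
qed

lemma tay_zero: "tay p \<zero>\<^bsub>GL_completion A p\<^esub> (0 :: ('n::finite \<times> 'n) mps)"
proof -
  interpret O: plain_cring "GL_coord A :: ('n \<times> 'n, complex) pseries ring" by (rule GL_plain)
  show ?thesis using tay_to_completion[OF GO_0] by (simp add: O.padic_zero_eq GL_zero del: cf_simps)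
qed

lemma tay_one: "tay p \<one>\<^bsub>GL_completion A p\<^esub> (1 :: ('n::finite \<times> 'n) mps)"
proof -
  interpret O: plain_cring "GL_coord A :: ('n \<times> 'n, complex) pseries ring" by (rule GL_plain)
  show ?thesis using tay_to_completion[OF GO_1] by (simp add: O.padic_one_eq GL_one)
qed

lemma tay_add:
  fixes F G :: "('n::finite \<times> 'n) mps"
  assumes X: "tay p X F" and Y: "tay p Y G"
  shows "tay p (X \<oplus>\<^bsub>GL_completion A p\<^esub> Y) (F + G)"
proof -
  interpret O: plain_cring "GL_coord A :: ('n \<times> 'n, complex) pseries ring" by (rule GL_plain)
  note c = tay_closed[OF X] tay_closed[OF Y]
  show ?thesis
  proof (rule tayI)
    fix k
    obtain F' G' where 1: "cf F' \<in> X k" "F' - F \<in> pdiv (p ^ k)" "cf G' \<in> Y k" "G' - G \<in> pdiv (p ^ k)"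
      using tay_ex[OF X, of k] tay_ex[OF Y, of k] by blast
    have "cf (F' + G') \<in> (X \<oplus>\<^bsub>GL_completion A p\<^esub> Y) k"
      using O.padic_add_mem[OF c 1(1,3)] by (simp only: GL_add)
    moreover have "(F' + G') - (F + G) \<in> pdiv (p ^ k)"
      using pdiv_add[OF 1(2,4)] by (simp add: algebra_simps)
    ultimately show "\<exists>H. cf H \<in> (X \<oplus>\<^bsub>GL_completion A p\<^esub> Y) k \<and> H - (F + G) \<in> pdiv (p ^ k)" by blast
  qed (simp_all add: c O.padic_add_closed PA_add tay_PA[OF X] tay_PA[OF Y])
qed

lemma tay_mult:
  fixes F G :: "('n::finite \<times> 'n) mps"
  assumes X: "tay p X F" and Y: "tay p Y G"
  shows "tay p (X \<otimes>\<^bsub>GL_completion A p\<^esub> Y) (F * G)"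
proof -
  interpret O: plain_cring "GL_coord A :: ('n \<times> 'n, complex) pseries ring" by (rule GL_plain)
  note c = tay_closed[OF X] tay_closed[OF Y]
  show ?thesis
  proof (rule tayI)
    fix k
    obtain F' G' where 1: "cf F' \<in> X k" "F' - F \<in> pdiv (p ^ k)" "cf G' \<in> Y k" "G' - G \<in> pdiv (p ^ k)"
      and 2: "F' \<in> GO" "G' \<in> GO"
      using tay_ex[OF X, of k] tay_ex[OF Y, of k] by blast
    have "cf (F' * G') \<in> (X \<otimes>\<^bsub>GL_completion A p\<^esub> Y) k"
      using O.padic_mult_mem[OF c 1(1,3)] by (simp only: GL_mult 2)
    moreover have "(F' * G') - (F * G) = (F' - F) * G' + F * (G' - G)" by (simp add: algebra_simps)
    then have "(F' * G') - (F * G) \<in> pdiv (p ^ k)"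
      using 2 by (simp only:) (intro pdiv_add pdiv_mult pdiv_mult' 1 GO_PA tay_PA[OF X])
    ultimately show "\<exists>H. cf H \<in> (X \<otimes>\<^bsub>GL_completion A p\<^esub> Y) k \<and> H - (F * G) \<in> pdiv (p ^ k)" by blast
  qed (simp_all add: c O.padic_mult_closed PA_mult tay_PA[OF X] tay_PA[OF Y])
qed

lemma tay_uminus:
  fixes F :: "('n::finite \<times> 'n) mps"
  assumes X: "tay p X F"
  shows "tay p (\<ominus>\<^bsub>GL_completion A p\<^esub> X) (- F)"
proof -
  interpret O: plain_cring "GL_coord A :: ('n \<times> 'n, complex) pseries ring" by (rule GL_plain)
  interpret B: cring "GL_completion A p :: ('n, complex) GL_hat ring" by (rule O.padic_cring)
  note c = tay_closed[OF X]
  show ?thesis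
  proof (rule tayI)
    fix k
    obtain F' where 1: "cf F' \<in> X k" "F' - F \<in> pdiv (p ^ k)" "F' \<in> GO"
      using tay_ex[OF X, of k] by blast
    have "cf (- F') \<in> (\<ominus>\<^bsub>GL_completion A p\<^esub> X) k"
      using O.padic_a_inv_mem[OF c 1(1)] by (simp only: GL_a_inv 1)
    moreover have "- F' - - F \<in> pdiv (p ^ k)"
      using pdiv_uminus[OF 1(2)] by (simp add: algebra_simps)
    ultimately show "\<exists>H. cf H \<in> (\<ominus>\<^bsub>GL_completion A p\<^esub> X) k \<and> H - - F \<in> pdiv (p ^ k)" by blast
  qed (simp_all add: c PA_uminus tay_PA[OF X])
qed

lemma tay_minus: "tay p X F \<Longrightarrow> tay p Y G \<Longrightarrow> tay p (X \<ominus>\<^bsub>GL_completion A p\<^esub> Y) (F - G)"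
  using tay_add[OF _ tay_uminus, of p X F Y G] by (simp add: a_minus_def)

lemma tay_finsum:
  fixes F :: "'i \<Rightarrow> ('n::finite \<times> 'n) mps"
  assumes "\<And>i. tay p (X i) (F i)"
  shows "tay p (finsum (GL_completion A p) X I) (sum F I)"
proof -
  interpret O: plain_cring "GL_coord A :: ('n \<times> 'n, complex) pseries ring" by (rule GL_plain)
  interpret B: cring "GL_completion A p :: ('n, complex) GL_hat ring" by (rule O.padic_cring)
  note c = tay_closed[OF assms]
  show ?thesis
    by (induction I rule: infinite_finite_induct) (auto simp: tay_zero c assms intro!: tay_add)
qed

lemma tay_nat_pow:
  fixes F :: "('n::finite \<times> 'n) mps"
  assumes "tay p X F"
  shows "tay p (X [^]\<^bsub>GL_completion A p\<^esub> (n::nat)) (F ^ n)"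
proof -
  interpret O: plain_cring "GL_coord A :: ('n \<times> 'n, complex) pseries ring" by (rule GL_plain)
  interpret B: cring "GL_completion A p :: ('n, complex) GL_hat ring" by (rule O.padic_cring)
  show ?thesis
  proof (induction n)
    case (Suc n)
    then show ?case using tay_mult[OF Suc assms] by (simp add: mult.commute)
  qed (simp add: tay_one)
qed

text \<open>If \<open>E\<close> and \<open>H\<close> represent \<open>X\<close> and \<open>Y\<close>
  modulo \<open>p ^ k\<close>, then \<open>H = H * F * G\<close> is congruent to
  \<open>H * E * G\<close> and hence to \<open>G\<close>.\<close>

lemma tay_inverse:
  fixes F G :: "('n::finite \<times> 'n) mps"
  assumes X: "tay p X F" and Y: "Y \<in> carrier (GL_completion A p)"
    and XY: "X \<otimes>\<^bsub>GL_completion A p\<^esub> Y = \<one>\<^bsub>GL_completion A p\<^esub>"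
    and FG: "F * G = 1" and G: "G \<in> PA"
  shows "tay p Y G"
proof (rule tayI[OF Y G])
  interpret O: plain_cring "GL_coord A :: ('n \<times> 'n, complex) pseries ring" by (rule GL_plain)
  fix k
  obtain H where H: "H \<in> GO" "cf H \<in> Y k" using GL_hat_ex[OF Y] by blast
  obtain E where E: "E \<in> GO" "cf E \<in> X k" "E - F \<in> pdiv (p ^ k)" using tay_ex[OF X] by blast
  have "cf (E * H) \<in> \<one>\<^bsub>GL_completion A p\<^esub> k"
    using O.padic_mult_mem[OF tay_closed[OF X] Y E(2) H(2)] by (simp only: XY GL_mult E H)
  then have 1: "E * H - 1 \<in> pdiv (p ^ k)" using tay_one[of p] by (auto simp: tay_def)
  have "H - G = (E * H - 1) * G - (E - F) * (H * G) + H * (1 - F * G)" by (simp add: algebra_simps)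
  also have "\<dots> = (E * H - 1) * G - (E - F) * (H * G)" by (simp add: FG)
  also have "\<dots> \<in> pdiv (p ^ k)" by (intro pdiv_diff pdiv_mult 1 E G PA_mult GO_PA[OF H(1)])
  finally show "\<exists>H. cf H \<in> Y k \<and> H - G \<in> pdiv (p ^ k)" using H by blast
qed

lemma tay_mat_mult:
  fixes F G :: "('n::finite, ('n \<times> 'n) mps) matrix"
  assumes "\<And>i j. tay p (X i j) (F i j)" "\<And>i j. tay p (Y i j) (G i j)"
  shows "tay p ((X \<otimes>\<^bsub>mat_ring (GL_completion A p)\<^esub> Y) i j) (mmul F G i j)"
  unfolding mat_ring_simps mmul_def by (intro tay_finsum tay_mult assms)

lemma tay_mat_one:
  "tay p (\<one>\<^bsub>mat_ring (GL_completion A p)\<^esub> i j) (mone i j :: ('n::finite \<times> 'n) mps)"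
  unfolding mat_ring_simps mone_def by (simp add: tay_one tay_zero)

text \<open>The non-commutative version: if \<open>E\<close> and \<open>H\<close> represent
  \<open>X\<close> and \<open>Y\<close>, then \<open>H = G F H\<close> is congruent to
  \<open>G E H\<close> and hence to \<open>G\<close>. A right inverse over the completion is thus
  matched with a left inverse of series.\<close>

lemma tay_mat_inverse:
  fixes F G :: "('n::finite, ('n \<times> 'n) mps) matrix"
  assumes X: "\<And>i j. tay p (X i j) (F i j)" and Y: "Y \<in> carrier (mat_ring (GL_completion A p))"
    and XY: "X \<otimes>\<^bsub>mat_ring (GL_completion A p)\<^esub> Y = \<one>\<^bsub>mat_ring (GL_completion A p)\<^esub>"
    and GF: "mmul G F = mone" and G: "\<And>i j. G i j \<in> PA"
  shows "tay p (Y i j) (G i j)"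
proof (rule tayI[OF _ G])
  interpret O: plain_cring "GL_coord A :: ('n \<times> 'n, complex) pseries ring" by (rule GL_plain)
  interpret B: plain_cring "GL_completion A p :: ('n, complex) GL_hat ring"
    by (simp add: plain_cring_def O.padic_cring)
  have Yc: "Y i j \<in> carrier (GL_completion A p)" for i j using Y by (simp add: mat_ring_simps)
  show "Y i j \<in> carrier (GL_completion A p)" by (rule Yc)
  fix k
  have "\<exists>H\<in>GO. cf H \<in> Y i j k" for i j using GL_hat_ex[OF Yc] by blast
  then obtain H where H: "\<And>i j. H i j \<in> GO" "\<And>i j. cf (H i j) \<in> Y i j k" by metis
  have "\<exists>E\<in>GO. cf E \<in> X i j k \<and> E - F i j \<in> pdiv (p ^ k)" for i j using tay_ex[OF X] by blast
  then obtain E where E: "\<And>i j. E i j \<in> GO" "\<And>i j. cf (E i j) \<in> X i j k" "\<And>i j. E i j - F i j \<in> pdiv (p ^ k)"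
    by metis
  have m: "cf (\<Sum>l\<in>I. E i l * H l j) \<in> (\<Oplus>\<^bsub>GL_completion A p\<^esub>l\<in>I. X i l \<otimes>\<^bsub>GL_completion A p\<^esub> Y l j) k" for i j I
  proof (induction I rule: infinite_finite_induct)
    case (insert x I)
    have c: "(\<lambda>l. X i l \<otimes>\<^bsub>GL_completion A p\<^esub> Y l j) \<in> J \<rightarrow> carrier (GL_completion A p)"
      "X i x \<otimes>\<^bsub>GL_completion A p\<^esub> Y x j \<in> carrier (GL_completion A p)" for J
      using tay_closed[OF X] Yc by auto
    have "cf (E i x * H x j) \<in> (X i x \<otimes>\<^bsub>GL_completion A p\<^esub> Y x j) k"
      using O.padic_mult_mem[OF tay_closed[OF X] Yc E(2) H(2)] by (simp only: GL_mult E H)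
    from O.padic_add_mem[OF c(2) B.finsum_closed[OF c(1)] this insert.IH]
    show ?case unfolding sum.insert[OF insert(1,2)] B.finsum_insert[OF insert(1,2) c(1,2)] GL_add .
  qed (simp_all add: O.padic_zero_eq GL_zero O.to_completion_mem GO_0 del: cf_simps)
  have "cf (mmul E H i j) \<in> \<one>\<^bsub>mat_ring (GL_completion A p)\<^esub> i j k" for i j
    using m[of i j UNIV] unfolding XY[symmetric] by (simp add: mat_ring_simps mmul_def)
  then have 1: "mmul E H i j - mone i j \<in> pdiv (p ^ k)" for i j
    using tay_mat_one[of p i j] by (auto simp: tay_def)
  have e: "mmul G (\<lambda>i j. E i j - F i j) i j \<in> pdiv (p ^ k)" for i j
    unfolding mmul_def by (intro pdiv_sum pdiv_mult' E G)
  have a: "mmul G (\<lambda>i j. mmul E H i j - mone i j) i j \<in> pdiv (p ^ k)"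
    unfolding mmul_def[of G] by (intro pdiv_sum pdiv_mult' 1 G)
  have b: "mmul (mmul G (\<lambda>i j. E i j - F i j)) H i j \<in> pdiv (p ^ k)"
    unfolding mmul_def[of _ H] by (intro pdiv_sum pdiv_mult e GO_PA H)
  have "H = mmul (mmul G F) H" by (simp add: GF)
  then have "H i j - G i j = mmul (mmul G F) H i j - mmul G mone i j" by simp
  also have "\<dots> = mmul G (\<lambda>i j. mmul E H i j - mone i j) i j - mmul (mmul G (\<lambda>i j. E i j - F i j)) H i j"
    by (simp only: mmul_diff_right mmul_assoc mmul_diff_left)
      (simp add: mmul_def sum_subtractf algebra_simps sum_distrib_left)
  also have "\<dots> \<in> pdiv (p ^ k)"
    by (rule pdiv_diff[OF a b])
  finally show "\<exists>H. cf H \<in> Y i j k \<and> H - G i j \<in> pdiv (p ^ k)" using H by blast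
qed

lemma GL_level_zero_imp_dvd:
  fixes X :: "('n::finite, complex) GL_hat"
  assumes X: "X \<in> carrier (GL_completion A p)" and z: "\<zero>\<^bsub>GL_coord A\<^esub> \<in> X k" and p: "p > 0"
  obtains C where "C \<in> carrier (GL_completion A p)" "X = [(p ^ k :: nat)] \<cdot>\<^bsub>GL_completion A p\<^esub> C"
proof (rule plain_cring.padic_level_zero_imp_dvd[OF GL_plain X z])
  fix c :: "('n \<times> 'n, complex) pseries"
  assume "c \<in> carrier (GL_coord A)" "[(p ^ k :: nat)] \<cdot>\<^bsub>GL_coord A\<^esub> c = \<zero>\<^bsub>GL_coord A\<^esub>"
  then obtain C where C: "c = cf C" "cf (of_nat (p ^ k) * C) = cf 0"
    by (auto simp only: GL_carrier GL_add_pow GL_zero)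
  then have "of_nat (p ^ k) * cf C m = 0" for m by (metis cf_of_nat_mult cf_simps(1))
  then have "cf C m = 0" for m using p by simp
  then have "C = 0" by (intro mps_eqI) simp
  then show "c = \<zero>\<^bsub>GL_coord A\<^esub>" by (simp only: C(1) GL_zero)
qed (rule that)

end

section \<open>Frobenius lifts on power series\<close>

lemma (in coeff_ring) pseries_to_completion_closed:
  "F \<in> PA \<Longrightarrow> pseries_to_completion A p (cf F) m \<in> carrier (padic_completion A p)"
  by (simp add: pseries_to_completion_def to_completion_closed PA_def)

lemma (in coeff_ring) pdiv_coeff: "F \<in> PA \<Longrightarrow> G \<in> PA \<Longrightarrow>
    cf F m \<ominus>\<^bsub>A\<^esub> cf G m \<in> p_ideal A p k \<longleftrightarrow> (\<exists>c\<in>K. cf (F - G) m = of_nat (p ^ k) * c)"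
  by (simp add: A_minus PA_cf A_p_ideal_iff)

text \<open>\<open>completion_map\<close> takes a union over a whole coset. Its members agree modulo
  \<open>p ^ k\<close> in every coefficient, so the union collapses to a single coset.\<close>

lemma (in coeff_ring) GL_taylor_level:
  fixes h :: "('n::finite, complex) GL_hat"
  assumes h: "h \<in> carrier (GL_completion A p)" and G: "cf G \<in> h k"
  shows "GL_taylor A p h m k = p_ideal A p k +>\<^bsub>A\<^esub> cf G m"
proof -
  have "p_ideal A p k +>\<^bsub>A\<^esub> a m = p_ideal A p k +>\<^bsub>A\<^esub> cf G m" if "a \<in> h k" for a
  proof -
    interpret O: plain_cring "GL_coord A :: ('n \<times> 'n, complex) pseries ring" by (rule GL_plain)
    interpret I: ideal "p_ideal A p k" A by (rule p_ideal_ideal)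
    have "a \<in> carrier (GL_coord A)" by (rule O.padic_mem(1)[OF h that])
    then obtain H where H: "a = cf H" "H \<in> GO" by (auto simp: GL_carrier)
    have "H - G \<in> pdiv (p ^ k)" using GL_hat_cong[OF h G] that H by simp
    then have "cf H m \<ominus>\<^bsub>A\<^esub> cf G m \<in> p_ideal A p k"
      using pdiv_coeff[OF GO_PA[OF H(2)] GO_PA[OF GL_hat_mem[OF h G]]] by (simp add: pdiv_iff)
    then have "cf H m \<in> p_ideal A p k +>\<^bsub>A\<^esub> cf G m"
      using I.a_rcos_module[of "cf G m" "cf H m"] PA_cf[OF GO_PA[OF H(2)]] PA_cf[OF GO_PA[OF GL_hat_mem[OF h G]]]
      by (simp add: a_minus_def)
    then show ?thesis unfolding H(1)
      using a_repr_independence[OF _ _ I.a_subgroup] PA_cf[OF GO_PA[OF GL_hat_mem[OF h G]]] by simp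
  qed
  then show ?thesis unfolding GL_taylor_def completion_map_def by (intro UN_constant_eq[OF G] ballI)
qed

lemma (in coeff_ring) GL_taylor_closed:
  fixes h :: "('n::finite, complex) GL_hat"
  assumes h: "h \<in> carrier (GL_completion A p)"
  shows "GL_taylor A p h m \<in> carrier (padic_completion A p)"
proof (rule padic_carrierI)
  fix k
  interpret O: plain_cring "GL_coord A :: ('n \<times> 'n, complex) pseries ring" by (rule GL_plain)
  obtain G where G: "cf G \<in> h (Suc k)" "G \<in> GO" using GL_hat_ex[OF h] by blast
  then have G': "cf G \<in> h k" using O.padic_mem_mono[OF h, of _ k 1] by simp
  show "\<exists>a\<in>carrier A. \<exists>b\<in>carrier A. GL_taylor A p h m k = p_ideal A p k +>\<^bsub>A\<^esub> a \<and>
      GL_taylor A p h m (Suc k) = p_ideal A p (Suc k) +>\<^bsub>A\<^esub> b \<and> b \<ominus>\<^bsub>A\<^esub> a \<in> p_ideal A p k"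
    using GL_taylor_level[OF h G(1)] GL_taylor_level[OF h G'] PA_cf[OF GO_PA[OF G(2)]] p_ideal_minus_self
    by (intro bexI[of _ "cf G m"]) auto
qed

lemma (in coeff_ring) GL_taylor_eq_iff:
  fixes h :: "('n::finite, complex) GL_hat"
  assumes h: "h \<in> carrier (GL_completion A p)" and F: "F \<in> PA"
  shows "pseries_to_completion A p (cf F) m = GL_taylor A p h m \<longleftrightarrow>
    (\<forall>k G. cf G \<in> h k \<longrightarrow> (\<exists>c\<in>K. cf (G - F) m = of_nat (p ^ k) * c))"
proof -
  have cF: "cf F m \<in> carrier A" using F by (simp add: PA_cf)
  note tc = to_completion_closed[OF cF, of p] to_completion_mem[OF cF, of p]
  have iff: "cf G m \<in> to_completion A p (cf F m) k \<longleftrightarrow> (\<exists>c\<in>K. cf (G - F) m = of_nat (p ^ k) * c)"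
    if "cf G \<in> h k" for G k
  proof -
    have G: "G \<in> PA" using GO_PA[OF GL_hat_mem[OF h that]] .
    show ?thesis using padic_mem_iff[OF tc(1) tc(2), of "cf G m" k] pdiv_coeff[OF G F] by (simp add: PA_cf[OF G])
  qed
  have T: "cf G m \<in> GL_taylor A p h m k" if "cf G \<in> h k" for G k
    using GL_taylor_level[OF h that] p_ideal_rcos_self[of "cf G m" p k] PA_cf[OF GO_PA[OF GL_hat_mem[OF h that]]] by simp
  have "to_completion A p (cf F m) = GL_taylor A p h m \<longleftrightarrow> (\<forall>k G. cf G \<in> h k \<longrightarrow> cf G m \<in> to_completion A p (cf F m) k)"
  proof
    assume *: "\<forall>k G. cf G \<in> h k \<longrightarrow> cf G m \<in> to_completion A p (cf F m) k"
    show "to_completion A p (cf F m) = GL_taylor A p h m"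
    proof (rule padic_eqI[OF tc(1) GL_taylor_closed[OF h]])
      fix k
      obtain G where "cf G \<in> h k" using GL_hat_ex[OF h] by blast
      then show "\<exists>a. a \<in> to_completion A p (cf F m) k \<and> a \<in> GL_taylor A p h m k" using * T by blast
    qed
  qed (use T in simp)
  then show ?thesis using iff by (simp add: pseries_to_completion_def)
qed

text \<open>The interface between completion and power series: \<open>\<Phi>\<close> agrees with the
  substitution of \<open>y\<close> for \<open>T\<close> on scalars and on the entries of
  \<open>x\<close>. The summand \<open>mone i j\<close> accounts for
  \<open>x = 1 + T\<close>.\<close>

locale frob_lift = substitution A K \<phi> y
  for A K \<phi> and y :: "'n::finite \<times> 'n \<Rightarrow> ('n \<times> 'n) mps" +
  fixes p :: nat and \<Phi> :: "('n, complex) GL_hat \<Rightarrow> ('n, complex) GL_hat"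
  assumes p_pos: "p > 0"
    and separated: "(\<And>k. \<exists>c\<in>K. x = of_nat (p ^ k) * c) \<Longrightarrow> x = 0"
    and \<Phi>_hom: "\<Phi> \<in> ring_hom (GL_completion A p) (GL_completion A p)"
    and \<Phi>_scalar: "a \<in> K \<Longrightarrow> \<Phi> (GL_scalar A p a) = GL_scalar A p (\<phi> a)"
    and \<Phi>_x: "tay p (\<Phi> (GL_x A p i j)) (y (i, j) + mone i j)"
begin

sublocale O: plain_cring "GL_coord A :: ('n \<times> 'n, complex) pseries ring" by (rule GL_plain)

sublocale B: plain_cring "GL_completion A p :: ('n, complex) GL_hat ring"
  by (simp add: plain_cring_def O.padic_cring)

sublocale h: ring_hom_cring "GL_completion A p :: ('n, complex) GL_hat ring" "GL_completion A p" \<Phi>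
  by (simp add: ring_hom_cring_def ring_hom_cring_axioms_def B.is_cring \<Phi>_hom)

abbreviation toc :: "('n \<times> 'n) mps \<Rightarrow> ('n, complex) GL_hat" where
  "toc F \<equiv> to_completion (GL_coord A) p (cf F)"

lemma toc_closed: "F \<in> GO \<Longrightarrow> toc F \<in> carrier (GL_completion A p)"
  by (simp add: O.to_completion_closed)

lemma sub_xmat: "sub (xmat i j) = y (i, j) + mone i j"
  unfolding xmat_def mone_def by (simp add: sub_add PA_tv sub_tv sub_one sub_zero)

text \<open>Induction over the generators of the coordinate ring. Nothing is assumed about the image
  of the inverse determinant, but \<open>\<Phi>\<close> must send it to an inverse of the image of
  the determinant, and \<open>tay_inverse\<close> then yields its expansion.\<close>

lemma tay_\<Phi>: "F \<in> GO \<Longrightarrow> tay p (\<Phi> (toc F)) (sub F)"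
proof -
  define Q where "Q F \<longleftrightarrow> F \<in> GO \<and> tay p (\<Phi> (toc F)) (sub F)" for F
  have Q_cst: "Q (cst a)" if "a \<in> K" for a
    using tay_to_completion[OF GO_cst[OF \<phi>_closed[OF that]], of p] \<Phi>_scalar[OF that] that
    by (simp add: Q_def GL_scalar_def pseries_const_eq sub_cst GO_cst)
  have Q_xmat: "Q (xmat i j)" for i j
    using \<Phi>_x[of i j] by (simp add: Q_def GO_xmat sub_xmat GL_x_def coord_matrix_eq)
  have Q_add: "Q (F + G)" if "Q F" "Q G" for F G
  proof -
    have "toc (F + G) = toc F \<oplus>\<^bsub>GL_completion A p\<^esub> toc G"
      using that by (simp add: Q_def O.to_completion_add flip: GL_add)
    then have "\<Phi> (toc (F + G)) = \<Phi> (toc F) \<oplus>\<^bsub>GL_completion A p\<^esub> \<Phi> (toc G)"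
      using that by (simp add: Q_def toc_closed)
    then show ?thesis using that by (simp add: Q_def GO_add sub_add GO_PA tay_add)
  qed
  have Q_mult: "Q (F * G)" if "Q F" "Q G" for F G
  proof -
    have "toc (F * G) = toc F \<otimes>\<^bsub>GL_completion A p\<^esub> toc G"
      using that by (simp add: Q_def O.to_completion_mult flip: GL_mult)
    then have "\<Phi> (toc (F * G)) = \<Phi> (toc F) \<otimes>\<^bsub>GL_completion A p\<^esub> \<Phi> (toc G)"
      using that by (simp add: Q_def toc_closed)
    then show ?thesis using that by (simp add: Q_def GO_mult sub_mult GO_PA tay_mult)
  qed
  have Q_uminus: "Q (- F)" if "Q F" for F
  proof -
    have "- F = cst (- 1) * F" by (simp add: cst_uminus cst_1)
    then show ?thesis using Q_mult[OF Q_cst[OF K_uminus[OF K_one]] that] by simp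
  qed
  have Q_0: "Q 0" and Q_1: "Q 1" using Q_cst[OF K_zero] Q_cst[OF K_one] by (simp_all add: cst_1)
  have Q_sum: "Q (sum f I)" if "\<And>i. Q (f i)" for f and I :: "('n \<Rightarrow> 'n) set"
    using that Q_0 by (induction I rule: infinite_finite_induct) (auto simp: Q_add)
  have Q_prod: "Q (prod f I)" if "\<And>i. Q (f i)" for f and I :: "'n set"
    using that Q_1 by (induction I rule: infinite_finite_induct) (auto simp: Q_mult)
  have Q_sign: "Q (of_int (sign \<pi>))" for \<pi> :: "'n \<Rightarrow> 'n"
    using Q_1 Q_uminus[OF Q_1] by (auto simp: sign_def)
  have Q_det: "Q (det (\<chi> i j. xmat i j))"
    unfolding det_def by (auto intro!: Q_sum Q_mult Q_prod Q_sign Q_xmat)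
  define D where "D = (det (\<chi> i j. xmat i j) :: ('n \<times> 'n) mps)"
  define E where "E = (xdet_inv :: ('n \<times> 'n) mps)"
  have D: "D \<in> GO" "tay p (\<Phi> (toc D)) (sub D)" using Q_det by (auto simp: Q_def D_def)
  have E: "E \<in> GO" unfolding E_def by (rule GO_xdet_inv)
  have DE: "D * E = 1" using left_inverse_cofac(2)[OF xmat_xinv(2)] by (simp add: mult.commute D_def E_def)
  have "toc D \<otimes>\<^bsub>GL_completion A p\<^esub> toc E = toc (D * E)"
    using D E by (simp add: O.to_completion_mult flip: GL_mult)
  also have "\<dots> = \<one>\<^bsub>GL_completion A p\<^esub>" by (simp add: DE O.padic_one_eq GL_one)
  finally have "\<Phi> (toc D) \<otimes>\<^bsub>GL_completion A p\<^esub> \<Phi> (toc E) = \<one>\<^bsub>GL_completion A p\<^esub>"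
    using h.hom_mult[OF toc_closed[OF D(1)] toc_closed[OF E]] by simp
  moreover have "sub D * sub E = 1"
    using sub_mult[OF GO_PA[OF D(1)] GO_PA[OF E]] by (simp add: DE sub_one)
  ultimately have "tay p (\<Phi> (toc E)) (sub E)"
    by (intro tay_inverse[OF D(2)] h.hom_closed toc_closed E sub_PA GO_PA[OF E])
  then have Q_xdet: "Q xdet_inv" using E by (simp add: Q_def E_def)
  assume "F \<in> GO"
  then have "Q F"
    by (induction rule: GO_induct) (auto simp: Q_cst Q_xmat Q_xdet Q_add Q_uminus Q_mult)
  then show ?thesis by (simp add: Q_def)
qed

text \<open>Automatic continuity: the difference of \<open>X\<close> and its representative
  \<open>F\<close> is \<open>p ^ k\<close> times an element of the completion, and hence so is the
  image of the difference. Level \<open>k\<close> of \<open>\<Phi> X\<close> is therefore governed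
  by \<open>F\<close> alone.\<close>

lemma \<Phi>_cong:
  assumes X: "X \<in> carrier (GL_completion A p)" and F: "cf F \<in> X k" and G: "cf G \<in> \<Phi> X k"
  shows "G - sub F \<in> pdiv (p ^ k)"
proof -
  have FG: "F \<in> GO" by (rule GL_hat_mem[OF X F])
  let ?Y = "X \<ominus>\<^bsub>GL_completion A p\<^esub> toc F"
  have Y: "?Y \<in> carrier (GL_completion A p)" using X FG by (simp add: toc_closed)
  have XY: "X = toc F \<oplus>\<^bsub>GL_completion A p\<^esub> ?Y"
    using X toc_closed[OF FG] by (simp add: a_minus_def B.a_ac B.r_neg)
  have "cf F \<ominus>\<^bsub>GL_coord A\<^esub> cf F \<in> ?Y k"
    unfolding a_minus_def
    by (intro O.padic_add_mem O.padic_a_inv_mem O.to_completion_mem X F B.a_inv_closed toc_closed FG) (simp add: FG)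
  then have z: "\<zero>\<^bsub>GL_coord A\<^esub> \<in> ?Y k" using FG by (simp add: GL_minus GL_zero)
  obtain C where C: "C \<in> carrier (GL_completion A p)" "?Y = [(p ^ k :: nat)] \<cdot>\<^bsub>GL_completion A p\<^esub> C"
    by (rule GL_level_zero_imp_dvd[OF Y z p_pos])
  have hp: "\<Phi> ([n] \<cdot>\<^bsub>GL_completion A p\<^esub> C) = [n] \<cdot>\<^bsub>GL_completion A p\<^esub> \<Phi> C" for n :: nat
    by (induction n) (auto simp: C)
  have "\<Phi> X = \<Phi> (toc F) \<oplus>\<^bsub>GL_completion A p\<^esub> \<Phi> ?Y"
    by (subst XY) (rule h.hom_add[OF toc_closed[OF FG] Y])
  also have "\<Phi> ?Y = [(p ^ k :: nat)] \<cdot>\<^bsub>GL_completion A p\<^esub> \<Phi> C" unfolding C(2) hp ..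
  finally have e: "\<Phi> X = \<Phi> (toc F) \<oplus>\<^bsub>GL_completion A p\<^esub> [(p ^ k :: nat)] \<cdot>\<^bsub>GL_completion A p\<^esub> \<Phi> C" .
  obtain H where H: "H \<in> GO" "cf H \<in> \<Phi> (toc F) k" "H - sub F \<in> pdiv (p ^ k)" using tay_ex[OF tay_\<Phi>[OF FG]] by blast
  have "cf H \<oplus>\<^bsub>GL_coord A\<^esub> \<zero>\<^bsub>GL_coord A\<^esub> \<in> \<Phi> X k"
    unfolding e
    by (intro O.padic_add_mem H O.padic_dvd_imp_level_zero) (simp_all add: toc_closed FG C)
  then have "cf H \<in> \<Phi> X k" using H(1) by simp
  then have "G - H \<in> pdiv (p ^ k)" using GL_hat_cong[OF h.hom_closed[OF X]] G by blast
  then have "(G - H) + (H - sub F) \<in> pdiv (p ^ k)" using H by (intro pdiv_add)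
  then show ?thesis by simp
qed

lemma tpoly_GO:
  fixes F :: "('n \<times> 'n) mps"
  assumes F: "F \<in> PA"
  shows "tpoly n F \<in> GO"
proof -
  have tv: "tv v \<in> GO" for v :: "'n \<times> 'n"
  proof (cases v)
    case (Pair i j)
    have m: "mone i j \<in> GO" by (simp add: mone_def GO_0 GO_1)
    have "tv v = xmat i j + - mone i j" by (simp add: xmat_def mone_def Pair)
    also have "\<dots> \<in> GO" by (rule GO_add[OF GO_xmat GO_uminus[OF m]])
    finally show ?thesis .
  qed
  have tm: "tmon m \<in> GO" for m :: "('n \<times> 'n) multiset"
    by (induction m) (auto simp: tmon_def GO_1 GO_mult tv)
  show ?thesis unfolding tpoly_def using F by (intro GO_sum GO_mult GO_cst tm PA_cf)
qed

text \<open>Existence: if \<open>F\<close> and \<open>h\<close> agree below degree \<open>k\<close>,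
  so do their images, because substitution preserves both divisibility by \<open>p ^ j\<close> and
  order in \<open>T\<close>. Uniqueness: the truncations of \<open>F\<close> are polynomials in
  \<open>T = x - 1\<close>, so they lie in the coordinate ring, and they approximate
  \<open>F\<close> to every order.\<close>

lemma induced_endo_eq:
  assumes F: "F \<in> PA"
  shows "induced_endo A p \<Phi> (pseries_to_completion A p (cf F)) = pseries_to_completion A p (cf (sub F))"
proof -
  interpret C: plain_cring "padic_completion A p" by (simp add: plain_cring_def padic_cring)
  let ?S = "pseries_ring (padic_completion A p) :: ('n \<times> 'n, nat \<Rightarrow> complex set) pseries ring"
  let ?pc = "pseries_to_completion A p"
  have diff: "U \<ominus>\<^bsub>?S\<^esub> GL_taylor A p h \<in> T_power (padic_completion A p) k \<longleftrightarrow> (\<forall>m. size m < k \<longrightarrow> U m = GL_taylor A p h m)"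
    if "\<And>m. U m \<in> carrier (padic_completion A p)" "h \<in> carrier (GL_completion A p)" for U h k
    using that GL_taylor_closed[OF that(2)]
    by (auto simp: C.T_power_eq C.pseries_ord_def C.pseries_diff)
  have pcF: "?pc (cf F) m \<in> carrier (padic_completion A p)" for m by (rule pseries_to_completion_closed[OF F])
  have pcG: "?pc (cf (sub F)) m \<in> carrier (padic_completion A p)" for m
    by (rule pseries_to_completion_closed[OF sub_PA[OF F]])
  have main: "?pc (cf (sub F)) m = GL_taylor A p (\<Phi> h) m"
    if h: "h \<in> carrier (GL_completion A p)" and eq: "\<And>m. size m < k \<Longrightarrow> ?pc (cf F) m = GL_taylor A p h m"
      and m: "size m < k" for h k m
    unfolding GL_taylor_eq_iff[OF h.hom_closed[OF h] sub_PA[OF F]]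
  proof (intro allI impI)
    fix j G assume G: "cf G \<in> \<Phi> h j"
    obtain H where H: "cf H \<in> h j" "H \<in> GO" using GL_hat_ex[OF h] by blast
    have HF: "\<exists>c\<in>K. cf (H - F) m = of_nat (p ^ j) * c" if "size m < k" for m
      using eq[OF that] H unfolding GL_taylor_eq_iff[OF h F] by blast
    \<comment> \<open>\<open>H - F\<close> is split into its part of degree below \<open>k\<close>,
      which is divisible by \<open>p ^ j\<close>, and a remainder of order at least
      \<open>k\<close>.\<close>
    define a where "a = Mps (\<lambda>m. if size m < k then cf (H - F) m else 0)"
    have "a \<in> pdiv (p ^ j)" unfolding pdiv_iff a_def using HF K_zero by auto
    then have sa: "sub a \<in> pdiv (p ^ j)" by (rule sub_pdiv)
    have t: "(H - F) - a \<in> tord k" by (simp add: tord_def a_def)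
    have P: "H - F \<in> PA" "a \<in> PA" "H \<in> PA" using F GO_PA[OF H(2)] \<open>a \<in> pdiv (p ^ j)\<close> by (auto intro: PA_diff pdiv_PA)
    have "(sub H - sub F) - sub a = sub ((H - F) - a)" using P F by (simp add: sub_diff)
    also have "\<dots> \<in> tord k" by (rule sub_tord[OF t])
    finally have 1: "cf (sub H - sub F) m = cf (sub a) m" using m by (simp add: tord_def)
    have "(G - sub H) + sub a \<in> pdiv (p ^ j)" by (intro pdiv_add \<Phi>_cong[OF h H(1) G] sa)
    moreover have "cf ((G - sub H) + sub a) m = cf (G - sub F) m" using 1[symmetric] by simp
    ultimately show "\<exists>c\<in>K. cf (G - sub F) m = of_nat (p ^ j) * c" by (metis pdiv_iff)
  qed
  show ?thesis unfolding induced_endo_def Let_def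
  proof (rule the_equality)
    show "?pc (cf (sub F)) \<in> carrier ?S \<and> (\<forall>k. \<forall>h\<in>carrier (GL_completion A p).
          ?pc (cf F) \<ominus>\<^bsub>?S\<^esub> GL_taylor A p h \<in> T_power (padic_completion A p) k \<longrightarrow>
          ?pc (cf (sub F)) \<ominus>\<^bsub>?S\<^esub> GL_taylor A p (\<Phi> h) \<in> T_power (padic_completion A p) k)"
    proof (intro conjI allI ballI impI)
      show "?pc (cf (sub F)) \<in> carrier ?S" using pcG by (simp add: pseries_simps)
      fix k :: nat and h assume h: "h \<in> carrier (GL_completion A p)"
        and "?pc (cf F) \<ominus>\<^bsub>?S\<^esub> GL_taylor A p h \<in> T_power (padic_completion A p) k"
      then have "?pc (cf F) m' = GL_taylor A p h m'" if "size m' < k" for m'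
        using that unfolding diff[OF pcF h] by simp
      from main[OF h this]
      show "?pc (cf (sub F)) \<ominus>\<^bsub>?S\<^esub> GL_taylor A p (\<Phi> h) \<in> T_power (padic_completion A p) k"
        unfolding diff[OF pcG h.hom_closed[OF h]] by simp
    qed
  next
    fix U assume U: "U \<in> carrier ?S \<and> (\<forall>k. \<forall>h\<in>carrier (GL_completion A p).
          ?pc (cf F) \<ominus>\<^bsub>?S\<^esub> GL_taylor A p h \<in> T_power (padic_completion A p) k \<longrightarrow>
          U \<ominus>\<^bsub>?S\<^esub> GL_taylor A p (\<Phi> h) \<in> T_power (padic_completion A p) k)"
    then have Uc: "U m \<in> carrier (padic_completion A p)" for m by (simp add: pseries_simps)
    show "U = ?pc (cf (sub F))"
    proof
      fix m :: "('n \<times> 'n) multiset"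
      \<comment> \<open>One more than the degree of \<open>m\<close>, so that the coefficient at
        \<open>m\<close> lies in the controlled range.\<close>
      let ?n = "Suc (size m)"
      let ?h = "toc (tpoly ?n F)"
      have h: "?h \<in> carrier (GL_completion A p)" by (rule toc_closed[OF tpoly_GO[OF F]])
      have eq: "?pc (cf F) m' = GL_taylor A p ?h m'" if "size m' < ?n" for m'
        unfolding GL_taylor_eq_iff[OF h F]
      proof (intro allI impI)
        fix k G assume "cf G \<in> ?h k"
        then have "G - tpoly ?n F \<in> pdiv (p ^ k)"
          using tay_to_completion[OF tpoly_GO[OF F]] by (auto simp: tay_def)
        moreover have "cf (F - tpoly ?n F) m' = 0" using tpoly_approx[of F ?n] that by (simp add: tord_def)
        then have "cf (G - F) m' = cf (G - tpoly ?n F) m'" by simp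
        ultimately show "\<exists>c\<in>K. cf (G - F) m' = of_nat (p ^ k) * c" by (metis pdiv_iff)
      qed
      then have "?pc (cf F) \<ominus>\<^bsub>?S\<^esub> GL_taylor A p ?h \<in> T_power (padic_completion A p) ?n"
        unfolding diff[OF pcF h] by simp
      with U h have "U \<ominus>\<^bsub>?S\<^esub> GL_taylor A p (\<Phi> ?h) \<in> T_power (padic_completion A p) ?n" by blast
      then have "U m = GL_taylor A p (\<Phi> ?h) m" unfolding diff[OF Uc h.hom_closed[OF h]] by simp
      then show "U m = ?pc (cf (sub F)) m" using main[of ?h ?n m, OF h eq] by simp
    qed
  qed
qed

text \<open>Two series over \<open>A\<close> with the same image over the completion differ, in each
  coefficient, by an element divisible by all powers of \<open>p\<close>, which is zero by
  \<open>separated\<close>. So the description determines a unique series.\<close>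

lemma frob_at_one_eq:
  assumes \<Phi>: "\<Phi> = frob (GL_completion A p) p (\<delta> p)" and F: "F \<in> PA"
  shows "frob_at_one A \<delta> p (cf F) = cf (sub F)"
  unfolding frob_at_one_def \<Phi>[symmetric] induced_endo_eq[OF F]
proof (rule the_equality)
  fix g :: "('n \<times> 'n, complex) pseries"
  assume g: "g \<in> carrier P \<and> pseries_to_completion A p g = pseries_to_completion A p (cf (sub F))"
  then obtain G where G: "G \<in> PA" "g = cf G" by (auto simp: P_carrier)
  have "cf G m = cf (sub F) m" for m
  proof -
    have "to_completion A p (cf G m) = to_completion A p (cf (sub F) m)"
      using g G(2) by (simp add: pseries_to_completion_def fun_eq_iff)
    then have "\<forall>k. \<exists>c\<in>K. cf (G - sub F) m = of_nat (p ^ k) * c"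
      using to_completion_eq_iff[of "cf G m" "cf (sub F) m" p] G F
      by (simp add: PA_cf sub_PA A_minus A_p_ideal_iff)
    then have "cf (G - sub F) m = 0" by (intro separated) blast
    then show ?thesis by simp
  qed
  then show "g = cf (sub F)" using G by (simp add: fun_eq_iff)
qed (use F in \<open>simp add: sub_PA\<close>)

end

section \<open>Connections and the trivial Frobenius lift\<close>

lemma tord_power_diff: "F - G \<in> tord k \<Longrightarrow> F ^ n - G ^ n \<in> tord k"
proof (induction n)
  case (Suc n)
  have "F ^ Suc n - G ^ Suc n = F * (F ^ n - G ^ n) + (F - G) * G ^ n" by (simp add: algebra_simps)
  also have "\<dots> \<in> tord k" by (intro tord_add tord_mult_right[OF Suc.IH] tord_mult_left Suc.prems)
  finally show ?case .
qed simp

lemma mone_power: "n > 0 \<Longrightarrow> mone i j ^ n = mone i j"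
  by (auto simp: mone_def zero_power)

lemma xmat_tord: "xmat i j - mone i j \<in> tord 1"
  using tv_tord[of "(i, j)"] by (auto simp: xmat_def mone_def)

lemma xmat_power_tord: "n > 0 \<Longrightarrow> xmat i j ^ n - mone i j \<in> tord 1"
  using tord_power_diff[OF xmat_tord, of i j n] by (simp add: mone_power)

context plain_cring
begin

lemma mat_ring_add_pow:
  fixes a :: "('n::finite, 'a) matrix"
  shows "([(n::nat)] \<cdot>\<^bsub>mat_ring R\<^esub> a) = (\<lambda>i j. [n] \<cdot> a i j)"
proof -
  interpret M: ring "mat_ring R :: ('n, 'a) matrix ring" by (rule mat_ring_ring)
  show ?thesis by (induction n) (simp_all add: mat_ring_simps)
qed

end

text \<open>The element \<open>e = 1 - rx\<close> satisfies \<open>e = pce\<close>, so it is divisible by all powers of \<open>p\<close>.\<close>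

lemma (in ring) right_inverse_imp_left_inverse:
  assumes c: "x \<in> carrier R" "r \<in> carrier R" "z \<in> carrier R" "c \<in> carrier R"
    and xr: "x \<otimes> r = \<one>" and zx: "z \<otimes> x = \<one> \<ominus> [(p::nat)] \<cdot> c"
    and sep: "\<And>e. e \<in> carrier R \<Longrightarrow> (\<And>k. \<exists>a\<in>carrier R. e = [(p ^ k :: nat)] \<cdot> a) \<Longrightarrow> e = \<zero>"
  shows "r \<otimes> x = \<one>"
proof -
  define e where "e = \<one> \<ominus> r \<otimes> x"
  have e: "e \<in> carrier R" using c by (simp add: e_def)
  have "x \<otimes> e = x \<ominus> (x \<otimes> r) \<otimes> x" using c by (simp add: e_def a_minus_def r_distr r_minus m_assoc)
  then have xe: "x \<otimes> e = \<zero>" using c by (simp add: xr r_neg a_minus_def)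
  have "\<zero> = (z \<otimes> x) \<otimes> e" using c e by (simp add: m_assoc xe)
  also have "\<dots> = e \<ominus> [p] \<cdot> (c \<otimes> e)" using c e by (simp add: zx a_minus_def l_distr l_minus add_pow_ldistr)
  finally have "e \<ominus> [p] \<cdot> (c \<otimes> e) = \<zero>" by (rule sym)
  then have ee: "e = [p] \<cdot> (c \<otimes> e)" using c e by (simp add: r_right_minus_eq)
  have "\<exists>a\<in>carrier R. e = [(p ^ k :: nat)] \<cdot> a" for k
  proof (induction k)
    case (Suc k)
    then obtain a where a: "a \<in> carrier R" "e = [(p ^ k :: nat)] \<cdot> a" by blast
    have "c \<otimes> e = [(p ^ k :: nat)] \<cdot> (c \<otimes> a)" using a c by (simp add: add_pow_rdistr)
    then have "e = [p] \<cdot> ([(p ^ k :: nat)] \<cdot> (c \<otimes> a))" using ee by simp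
    then have "e = [(p ^ Suc k :: nat)] \<cdot> (c \<otimes> a)" using a c by (simp add: add.nat_pow_pow mult.commute)
    then show ?case using a c by blast
  qed (use e in \<open>auto intro!: bexI[of _ e]\<close>)
  then have "e = \<zero>" using sep[OF e] by blast
  then show ?thesis using c by (simp add: e_def r_right_minus_eq)
qed

text \<open>The component of an adelic connection at one prime, with the arithmetic of
  \<open>A\<close> at that prime. Both the Chern and the trivial connection are instances, the two
  at possibly different primes.\<close>

locale conn = ring_endo A K \<phi> for A K \<phi> +
  fixes p :: nat and d :: "('n::finite, complex) GL_hat \<Rightarrow> ('n, complex) GL_hat"
  assumes prime_p: "prime p" and p_ge_3: "p \<ge> 3"
    and separated: "(\<And>k. \<exists>c\<in>K. x = of_nat (p ^ k) * c) \<Longrightarrow> x = 0"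
    and \<phi>_frob: "a \<in> K \<Longrightarrow> \<exists>c\<in>K. \<phi> a = a ^ p + of_nat p * c"
    and pder: "p_derivation (GL_completion A p) p d"
    and base: "extends_base A p \<phi> (frob (GL_completion A p) p d)"
    and half: "1 / 2 \<in> K"
begin

abbreviation \<Phi> :: "('n, complex) GL_hat \<Rightarrow> ('n, complex) GL_hat" where
  "\<Phi> \<equiv> frob (GL_completion A p) p d"

sublocale O: plain_cring "GL_coord A :: ('n \<times> 'n, complex) pseries ring" by (rule GL_plain)

sublocale B: plain_cring "GL_completion A p :: ('n, complex) GL_hat ring"
  by (simp add: plain_cring_def O.padic_cring)

lemma \<Phi>_hom: "\<Phi> \<in> ring_hom (GL_completion A p) (GL_completion A p)"
  using pder by (simp add: p_derivation_def)

sublocale h: ring_hom_cring "GL_completion A p :: ('n, complex) GL_hat ring" "GL_completion A p" \<Phi>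
  by (simp add: ring_hom_cring_def ring_hom_cring_axioms_def B.is_cring \<Phi>_hom)

lemma d_closed: "X \<in> carrier (GL_completion A p) \<Longrightarrow> d X \<in> carrier (GL_completion A p)"
  using pder by (auto simp: p_derivation_def)

abbreviation toc :: "('n \<times> 'n) mps \<Rightarrow> ('n, complex) GL_hat" where
  "toc F \<equiv> to_completion (GL_coord A) p (cf F)"

lemma toc_closed: "F \<in> GO \<Longrightarrow> toc F \<in> carrier (GL_completion A p)"
  by (simp add: O.to_completion_closed)

lemma GL_x_eq: "GL_x A p = (\<lambda>i j :: 'n. toc (xmat i j))"
  by (simp add: GL_x_def coord_matrix_eq fun_eq_iff)

lemma GL_scalar_eq: "GL_scalar A p a = toc (cst a)"
  by (simp add: GL_scalar_def pseries_const_eq)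

text \<open>\<open>base\<close> speaks of the completion of \<open>A\<close> through unions over
  cosets. On the image of \<open>A\<close> these unions collapse, because \<open>\<phi>\<close> and
  the inclusion of constants preserve multiples of \<open>p ^ k\<close>.\<close>

lemma \<Phi>_scalar:
  assumes a: "a \<in> K"
  shows "\<Phi> (GL_scalar A p a) = GL_scalar A p (\<phi> a)"
proof -
  have 1: "completion_map A p \<phi> (to_completion A p a) = to_completion A p (\<phi> a)" if a: "a \<in> K" for a
  proof
    fix k
    interpret I: ideal "p_ideal A p k" A by (rule p_ideal_ideal)
    have "p_ideal A p k +>\<^bsub>A\<^esub> \<phi> b = p_ideal A p k +>\<^bsub>A\<^esub> \<phi> a" if "b \<in> to_completion A p a k" for b
    proof -
      have b: "b \<in> K" using padic_mem(1)[OF to_completion_closed that] a by simp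
      have "b \<ominus>\<^bsub>A\<^esub> a \<in> p_ideal A p k"
        using padic_mem_iff[OF to_completion_closed to_completion_mem, of a b] a b that by simp
      then obtain c where c: "c \<in> K" "b - a = of_nat (p ^ k) * c" using a b by (auto simp: A_minus A_p_ideal_iff)
      have "\<phi> b = \<phi> (a + of_nat (p ^ k) * c)" using c by (simp add: algebra_simps flip: c(2))
      also have "\<dots> = \<phi> a + of_nat (p ^ k) * \<phi> c"
        using a c by (simp only: \<phi>_add \<phi>_mult K_mult K_of_nat \<phi>_of_nat)
      finally have "\<phi> b - \<phi> a = of_nat (p ^ k) * \<phi> c" by simp
      then have "\<phi> b \<ominus>\<^bsub>A\<^esub> \<phi> a \<in> p_ideal A p k"
        using a b \<phi>_closed[OF c(1)] by (auto simp only: A_minus A_p_ideal_iff \<phi>_closed)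
      then have "\<phi> b \<in> p_ideal A p k +>\<^bsub>A\<^esub> \<phi> a"
        using I.a_rcos_module[of "\<phi> a" "\<phi> b"] a b by (simp add: a_minus_def \<phi>_closed)
      then show ?thesis using a_repr_independence[OF _ _ I.a_subgroup] a by (simp add: \<phi>_closed)
    qed
    then show "completion_map A p \<phi> (to_completion A p a) k = to_completion A p (\<phi> a) k"
      unfolding completion_map_def to_completion_def[of A p "\<phi> a"]
      by (intro UN_constant_eq[of a] ballI to_completion_mem) (simp_all add: a)
  qed
  have 2: "completion_map (GL_coord A) p (pseries_const A) (to_completion A p a) = (GL_scalar A p a :: ('n, complex) GL_hat)" if a: "a \<in> K" for a
  proof
    fix k
    interpret I: ideal "p_ideal (GL_coord A :: ('n \<times> 'n, complex) pseries ring) p k" "GL_coord A" by (rule O.p_ideal_ideal)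
    have "p_ideal (GL_coord A) p k +>\<^bsub>GL_coord A\<^esub> pseries_const A b =
        p_ideal (GL_coord A :: ('n \<times> 'n, complex) pseries ring) p k +>\<^bsub>GL_coord A\<^esub> pseries_const A a" if "b \<in> to_completion A p a k" for b
    proof -
      have b: "b \<in> K" using padic_mem(1)[OF to_completion_closed that] a by simp
      have "b \<ominus>\<^bsub>A\<^esub> a \<in> p_ideal A p k"
        using padic_mem_iff[OF to_completion_closed to_completion_mem, of a b] a b that by simp
      then obtain c where c: "c \<in> K" "b - a = of_nat (p ^ k) * c" using a b by (auto simp: A_minus A_p_ideal_iff)
      have "cst b - cst a = of_nat (p ^ k) * (cst c :: ('n \<times> 'n) mps)"
        unfolding cst_diff[symmetric] c(2) cst_mult cst_of_nat ..
      then have "cf (cst b) \<ominus>\<^bsub>GL_coord A\<^esub> cf (cst a :: ('n \<times> 'n) mps) \<in> p_ideal (GL_coord A) p k"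
        using a b c by (auto simp: GL_minus GO_cst GL_p_ideal simp del: cf_simps)
      then have "cf (cst b) \<in> p_ideal (GL_coord A) p k +>\<^bsub>GL_coord A\<^esub> cf (cst a :: ('n \<times> 'n) mps)"
        using I.a_rcos_module[of "cf (cst a)" "cf (cst b)"] a b by (simp add: a_minus_def GO_cst)
      then show ?thesis unfolding pseries_const_eq
        using O.a_repr_independence[OF _ _ I.a_subgroup] a by (simp add: GO_cst)
    qed
    then show "completion_map (GL_coord A) p (pseries_const A) (to_completion A p a) k = (GL_scalar A p a :: ('n, complex) GL_hat) k"
      unfolding completion_map_def GL_scalar_def to_completion_def[of _ p "pseries_const A a"]
      by (intro UN_constant_eq[of a] ballI to_completion_mem) (simp_all add: a)
  qed
  show ?thesis
    using base[unfolded extends_base_def, rule_format, of "to_completion A p a"] a to_completion_closed[of a p]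
    by (simp add: 1 2 \<phi>_closed)
qed

lemma \<Phi>_eq: "\<Phi> X = X [^]\<^bsub>GL_completion A p\<^esub> p \<oplus>\<^bsub>GL_completion A p\<^esub> [p] \<cdot>\<^bsub>GL_completion A p\<^esub> d X"
  by (simp add: frob_def)

lemma frob_liftI:
  assumes "\<And>v. y v \<in> PA" "\<And>v. y v \<in> tord 1"
    and "\<And>i j. tay p (\<Phi> (GL_x A p i j)) (y (i, j) + mone i j)"
  shows "frob_lift A K \<phi> y p \<Phi>"
  by unfold_locales (use assms separated prime_p \<Phi>_scalar \<Phi>_hom prime_gt_0_nat in auto)

text \<open>By \<open>\<Phi>_eq\<close> the image of an entry of \<open>x\<close> is its
  \<open>p\<close>-th power plus a multiple of \<open>p\<close>; comparison at level
  \<open>1\<close> with the Taylor expansion gives the congruence at the generators.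
  \<open>sub_frobenius\<close> extends it to \<open>A[[T]]\<close>, where it will give the
  divisibility of the commutator.\<close>

lemma sub_frob:
  assumes "frob_lift A K \<phi> y p \<Phi>" and F: "F \<in> PA"
  shows "substitution.sub \<phi> y F - F ^ p \<in> pdiv p"
proof -
  interpret L: frob_lift A K \<phi> y p \<Phi> by fact
  show ?thesis
  proof (rule L.sub_frobenius[OF prime_p \<phi>_frob _ F])
    fix v :: "'n \<times> 'n"
    obtain i j where v: "v = (i, j)" by (cases v)
    let ?u = "if i = j then 1 else 0 :: complex"
    have x: "tv v + cst ?u = xmat i j" by (simp add: v xmat_def cst_1)
    have xc: "GL_x A p i j \<in> carrier (GL_completion A p)" by (simp add: GL_x_eq toc_closed GO_xmat)
    have "cf (xmat i j ^ p) \<in> (GL_x A p i j [^]\<^bsub>GL_completion A p\<^esub> p) 1"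
    proof -
      have "cf (xmat i j) \<in> GL_x A p i j 1" by (simp add: GL_x_eq O.to_completion_mem GO_xmat)
      then have "cf (xmat i j) [^]\<^bsub>GL_coord A\<^esub> p \<in> (GL_x A p i j [^]\<^bsub>GL_completion A p\<^esub> p) 1"
        by (rule O.padic_nat_pow_mem[OF xc])
      moreover have "cf (xmat i j) [^]\<^bsub>GL_coord A\<^esub> n = cf (xmat i j ^ n) \<and> xmat i j ^ n \<in> GO" for n :: nat
        by (induction n) (auto simp: GL_one GL_mult GO_1 GO_mult GO_xmat mult.commute)
      ultimately show ?thesis by simp
    qed
    moreover have "\<zero>\<^bsub>GL_coord A\<^esub> \<in> ([p] \<cdot>\<^bsub>GL_completion A p\<^esub> d (GL_x A p i j)) 1"
      using O.padic_dvd_imp_level_zero[OF d_closed[OF xc], of 1] by simp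
    ultimately have "cf (xmat i j ^ p) \<oplus>\<^bsub>GL_coord A\<^esub> \<zero>\<^bsub>GL_coord A\<^esub> \<in> \<Phi> (GL_x A p i j) 1"
      unfolding \<Phi>_eq by (intro O.padic_add_mem) (simp_all add: xc d_closed)
    then have "cf (xmat i j ^ p) \<in> \<Phi> (GL_x A p i j) 1" by (simp add: GL_zero GL_add del: cf_simps)
    then have "xmat i j ^ p - (y (i, j) + mone i j) \<in> pdiv (p ^ 1)" using L.\<Phi>_x[of i j] unfolding tay_def by blast
    then have "- (xmat i j ^ p - (y (i, j) + mone i j)) \<in> pdiv p" by (intro pdiv_uminus) simp
    then show "\<exists>u\<in>K. L.sub (tv v + cst u) - (tv v + cst u) ^ p \<in> pdiv p"
      by (intro bexI[of _ ?u]) (auto simp: x L.sub_xmat K_one K_zero)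
  qed
qed

lemma trivial_lift:
  assumes "\<And>i j. d (GL_x A p i j) = \<zero>\<^bsub>GL_completion A p\<^esub>"
  shows "frob_lift A K \<phi> (\<lambda>(i, j). xmat i j ^ p - mone i j) p \<Phi>"
proof (rule frob_liftI)
  fix i j :: 'n
  have t: "tay p (GL_x A p i j [^]\<^bsub>GL_completion A p\<^esub> p) (xmat i j ^ p)"
    by (intro tay_nat_pow) (simp add: GL_x_eq tay_to_completion GO_xmat)
  then have "\<Phi> (GL_x A p i j) = GL_x A p i j [^]\<^bsub>GL_completion A p\<^esub> p"
    unfolding \<Phi>_eq assms using tay_closed[OF t] by simp
  then show "tay p (\<Phi> (GL_x A p i j)) ((case (i, j) of (i, j) \<Rightarrow> xmat i j ^ p - mone i j) + mone i j)"
    using t by simp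
next
  fix v :: "'n \<times> 'n"
  show "(case v of (i, j) \<Rightarrow> xmat i j ^ p - mone i j) \<in> PA"
    by (auto split: prod.split intro!: PA_diff PA_power PA_xmat PA_mone)
  show "(case v of (i, j) \<Rightarrow> xmat i j ^ p - mone i j) \<in> tord 1"
    using prime_gt_0_nat[OF prime_p] xmat_power_tord[of p] by (auto split: prod.split)
qed

end

section \<open>The Chern Frobenius lift modulo \<open>I\<^sup>3\<close>\<close>

locale chern_data = conn A K \<phi> p d for A K \<phi> p and d :: "('n::finite, complex) GL_hat \<Rightarrow> ('n, complex) GL_hat" +
  fixes dual :: "'n \<Rightarrow> 'n" and e :: "'n \<Rightarrow> complex" and q :: "('n, complex) matrix"
  assumes dual_dual: "dual (dual i) = i" and dual_neq: "dual i \<noteq> i"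
    and e: "e i = 1 \<or> e i = - 1"
    and q: "q = (\<lambda>i j. if j = dual i then e i else 0)"
begin

lemma q_app: "q i j = (if j = dual i then e i else 0)" by (subst q) simp

lemma dual_eq_iff [simp]: "dual i = dual j \<longleftrightarrow> i = j" by (metis dual_dual)

lemma e_K: "e i \<in> K" using e[of i] K_one K_uminus[OF K_one] by auto

text \<open>The entries are \<open>0\<close> and signs, so \<open>q\<close> itself may replace its
  Frobenius image in the Chern formula.\<close>

lemma \<phi>_q: "\<phi> (q i j) = q i j"
  using e[of i] \<phi>_uminus[OF K_one] by (auto simp: q_app \<phi>_zero \<phi>_one)

definition Qt :: "('n, ('n \<times> 'n) mps) matrix" where "Qt = (\<lambda>i j. cst (q i j))"
definition Xp :: "('n, ('n \<times> 'n) mps) matrix" where "Xp = (\<lambda>i j. xmat i j ^ p)"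
definition W :: "('n, ('n \<times> 'n) mps) matrix" where "W = mmul (mmul (mat_transpose Xp) Qt) Xp"
definition Y :: "('n, ('n \<times> 'n) mps) matrix" where
  "Y = (\<lambda>i j. mmul (mmul (mat_transpose xmat) Qt) xmat i j ^ p)"
text \<open>\<open>V\<close> is the Neumann inverse of \<open>x^(p)\<close>. In \<open>Winv\<close>
  below, the transpose of \<open>Qt\<close> stands for its inverse, since a split form is a signed
  permutation matrix.\<close>

definition V :: "('n, ('n \<times> 'n) mps) matrix" where "V = ginv (\<lambda>i j. mone i j - Xp i j)"
definition Winv :: "('n, ('n \<times> 'n) mps) matrix" where "Winv = mmul (mmul V (mat_transpose Qt)) (mat_transpose V)"
definition w :: "('n, ('n \<times> 'n) mps) matrix" where "w = mmul Winv Y"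
definition \<sigma> :: "('n, ('n \<times> 'n) mps) matrix" where
  "\<sigma> = (\<lambda>i j. ser (\<lambda>l. cst ((1/2) gchoose l) * mpow (\<lambda>i j. w i j - mone i j) l i j))"

lemma q_K: "q i j \<in> K" by (auto simp: q_app e_K K_zero)

lemma Qt_GO: "Qt i j \<in> GO" by (simp add: Qt_def GO_cst q_K)

lemma Xp_GO: "Xp i j \<in> GO"
proof -
  have "xmat i j ^ n \<in> GO" for n by (induction n) (auto simp: GO_1 GO_mult GO_xmat)
  then show ?thesis by (simp add: Xp_def)
qed

lemma p_pos: "p > 0" using prime_gt_0_nat[OF prime_p] .

lemma Xp_PA: "Xp i j \<in> PA" by (rule GO_PA[OF Xp_GO])

lemma Xp_tord: "Xp i j - mone i j \<in> tord 1"
  unfolding Xp_def by (rule xmat_power_tord[OF p_pos])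

lemma Xp_V: "mmul Xp V = mone" "mmul V Xp = mone"
proof -
  have t: "mone i j - Xp i j \<in> tord 1" for i j using tord_uminus[OF Xp_tord, of i j] by simp
  let ?N = "\<lambda>i j. mone i j - Xp i j"
  show "mmul Xp V = mone" "mmul V Xp = mone"
    using ginv_right[of ?N, OF t] ginv_left[of ?N, OF t] by (simp_all add: V_def)
qed

lemma V_tord: "V i j - mone i j \<in> tord 1"
  unfolding V_def using tord_uminus[OF Xp_tord] by (intro ginv_tord) simp

lemma V_PA: "V i j \<in> PA"
  unfolding V_def by (intro PA_ginv PA_diff PA_mone GO_PA Xp_GO)

lemma e_square: "e i * e i = 1" using e[of i] by auto

lemma Qt_inverse: "mmul (mat_transpose Qt) Qt = mone" "mmul Qt (mat_transpose Qt) = mone"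
proof -
  have 1: "(\<Sum>k\<in>UNIV. q k i * q k j) = (if i = j then 1 else 0)" for i j
  proof -
    have "(\<Sum>k\<in>UNIV. q k i * q k j) = (\<Sum>k\<in>UNIV. if k = dual i then (if i = j then 1 else 0) else 0)"
      by (rule sum.cong) (auto simp: q_app dual_dual e_square)
    then show ?thesis by simp
  qed
  have 2: "(\<Sum>k\<in>UNIV. q i k * q j k) = (if i = j then 1 else 0)" for i j
  proof -
    have "(\<Sum>k\<in>UNIV. q i k * q j k) = (\<Sum>k\<in>UNIV. if k = dual i then (if i = j then 1 else 0) else 0)"
      by (rule sum.cong) (auto simp: q_app e_square)
    then show ?thesis by simp
  qed
  have cs: "(\<Sum>k\<in>UNIV. cst (f k)) = (cst (\<Sum>k\<in>UNIV. f k) :: ('n \<times> 'n) mps)" for f :: "'n \<Rightarrow> complex"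
    by (intro mps_eqI) (auto simp: cf_sum cf_cst)
  show "mmul (mat_transpose Qt) Qt = mone" "mmul Qt (mat_transpose Qt) = mone"
    by (auto simp: mmul_def mat_transpose_def Qt_def mone_def cs 1 2 cst_1 fun_eq_iff simp flip: cst_mult)
qed

lemma W_Winv: "mmul W Winv = mone" "mmul Winv W = mone"
proof -
  have t: "mmul (mat_transpose Xp) (mat_transpose V) = mone" "mmul (mat_transpose V) (mat_transpose Xp) = mone"
    using Xp_V by (simp_all flip: mmul_transpose)
  have "mmul W Winv = mmul (mat_transpose Xp) (mmul Qt (mmul (mmul Xp V) (mmul (mat_transpose Qt) (mat_transpose V))))"
    by (simp only: W_def Winv_def mmul_assoc)
  also have "\<dots> = mmul (mat_transpose Xp) (mmul (mmul Qt (mat_transpose Qt)) (mat_transpose V))"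
    by (simp only: Xp_V mmul_mone mmul_assoc)
  also have "\<dots> = mone" by (simp only: Qt_inverse mmul_mone t)
  finally show "mmul W Winv = mone" .
  have "mmul Winv W = mmul V (mmul (mat_transpose Qt) (mmul (mmul (mat_transpose V) (mat_transpose Xp)) (mmul Qt Xp)))"
    by (simp only: W_def Winv_def mmul_assoc)
  also have "\<dots> = mmul V (mmul (mmul (mat_transpose Qt) Qt) Xp)"
    by (simp only: t mmul_mone mmul_assoc)
  also have "\<dots> = mone" by (simp only: Qt_inverse mmul_mone Xp_V)
  finally show "mmul Winv W = mone" .
qed

lemma Winv_PA: "Winv i j \<in> PA"
  unfolding Winv_def by (intro PA_mmul) (auto simp: mat_transpose_def V_PA GO_PA Qt_GO)

lemma Y_PA: "Y i j \<in> PA"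
  unfolding Y_def by (intro PA_power PA_mmul) (auto simp: mat_transpose_def PA_xmat GO_PA Qt_GO)

lemma w_PA: "w i j \<in> PA" unfolding w_def by (intro PA_mmul Winv_PA Y_PA)

lemma gbinomial_K: "(1/2 :: complex) gchoose l \<in> K"
  by (rule half_gbinomial_in_subring) (auto simp: K_one half K_add K_uminus K_mult)

lemma \<sigma>_PA: "\<sigma> i j \<in> PA"
  unfolding \<sigma>_def by (intro PA_ser PA_mult PA_cst gbinomial_K PA_mpow PA_diff w_PA PA_mone)

text \<open>The quadratic part of the \<open>(i, dual i)\<close> entry of \<open>x\<^sup>tqx\<close> that is absent from \<open>x\<^sup>(\<^sup>p\<^sup>)\<^sup>tqx\<^sup>(\<^sup>p\<^sup>)\<close>.\<close>

definition Rq :: "'n \<Rightarrow> ('n \<times> 'n) mps" where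
  "Rq i = (\<Sum>k\<in>- {i}. cst (e k) * (xmat k i * xmat (dual k) (dual i)))"

lemma mmul_Qt: "mmul (mmul (mat_transpose Z) Qt) Z i j = (\<Sum>k\<in>UNIV. cst (e k) * (Z k i * Z (dual k) j))"
proof -
  have "mmul (mat_transpose Z) Qt i l = cst (e (dual l)) * Z (dual l) i" for l
  proof -
    have "mmul (mat_transpose Z) Qt i l = (\<Sum>k\<in>UNIV. if k = dual l then cst (e (dual l)) * Z (dual l) i else 0)"
      unfolding mmul_def by (rule sum.cong) (auto simp: mat_transpose_def Qt_def q_app dual_dual mult.commute)
    then show ?thesis by simp
  qed
  then have "mmul (mmul (mat_transpose Z) Qt) Z i j = (\<Sum>l\<in>UNIV. cst (e (dual l)) * (Z (dual l) i * Z l j))"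
    by (simp add: mmul_def mult.assoc)
  also have "\<dots> = (\<Sum>k\<in>UNIV. cst (e k) * (Z k i * Z (dual k) j))"
    by (rule sum.reindex_bij_witness[of _ dual dual]) (auto simp: dual_dual)
  finally show ?thesis .
qed

lemma xmat_off_tord: "i \<noteq> j \<Longrightarrow> xmat i j \<in> tord 1"
  using tv_tord[of "(i, j)"] by (simp add: xmat_def)

lemma xmat_off_power_tord: "i \<noteq> j \<Longrightarrow> n \<ge> 3 \<Longrightarrow> xmat i j ^ n \<in> tord 3"
  using tord_power[OF xmat_off_tord, of i j n] by (auto intro: tord_mono)

lemma odd_p: "odd p" using prime_odd_nat[OF prime_p] p_ge_3 by simp

lemma e_power: "odd n \<Longrightarrow> e i ^ n = e i" and e_power_even: "even n \<Longrightarrow> e i ^ n = 1"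
  using e[of i] by auto

lemma Rq_tord: "Rq i \<in> tord 2"
proof -
  have "xmat k i * xmat (dual k) (dual i) \<in> tord 2" if "k \<in> - {i}" for k
    by (rule tord_mono[OF tord_mult_add[OF xmat_off_tord xmat_off_tord]]) (use that in auto)
  then show ?thesis unfolding Rq_def by (intro tord_sum tord_mult_right[of "xmat _ i * xmat _ _"])
qed

text \<open>The binomial expansion to first order in \<open>b\<close>; what is dropped is a multiple
  of \<open>b * b\<close>.\<close>

lemma power_add_mod_square:
  fixes a b :: "'v mps"
  assumes b: "b \<in> tord 2"
  shows "(a + b) ^ Suc n - (a ^ Suc n + of_nat (Suc n) * (a ^ n * b)) \<in> tord 4"
proof (induction n)
  case (Suc n)
  let ?D = "(a + b) ^ Suc n - (a ^ Suc n + of_nat (Suc n) * (a ^ n * b))"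
  have "(a + b) ^ Suc (Suc n) - (a ^ Suc (Suc n) + of_nat (Suc (Suc n)) * (a ^ Suc n * b))
      = (a + b) * ?D + of_nat (Suc n) * a ^ n * (b * b)"
    by (simp add: algebra_simps)
  also have "\<dots> \<in> tord 4"
    using tord_mult_add[OF b b] by (intro tord_add tord_mult_right[OF Suc.IH] tord_mult_right[of "b * b"]) simp
  finally show ?case .
qed simp

text \<open>For \<open>j \<noteq> dual i\<close> each summand of the \<open>(i, j)\<close> entry
  contains an off-diagonal factor, so \<open>p\<close>-th powers, outside the sum in
  \<open>Y\<close> and inside it in \<open>W\<close>, have order at least \<open>p \<ge> 3\<close>.
  For \<open>j = dual i\<close> both entries share the power \<open>?a ^ p\<close>. In
  \<open>Y\<close> the remaining summands \<open>Rq i\<close> enter to first order through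
  \<open>p * ?a ^ (p - 1) * Rq i\<close>, and \<open>?a ^ (p - 1)\<close> is \<open>1\<close> modulo
  \<open>I\<close> because \<open>p - 1\<close> is even and \<open>?a\<close> is a sign modulo
  \<open>I\<close>; in \<open>W\<close> they vanish modulo \<open>I^3\<close>.\<close>

lemma YW: "Y i j - W i j - (if j = dual i then of_nat p * Rq i else 0) \<in> tord 3"
proof (cases "j = dual i")
  case False
  have "cst (e k) * (xmat k i * xmat (dual k) j) \<in> tord 1" for k
  proof (cases "k = i")
    case True
    then show ?thesis using False by (intro tord_mult_right xmat_off_tord) auto
  next
    case k: False
    then show ?thesis by (intro tord_mult_right[OF tord_mult_left] xmat_off_tord)
  qed
  then have "mmul (mmul (mat_transpose xmat) Qt) xmat i j \<in> tord 1" unfolding mmul_Qt by (rule tord_sum)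
  from tord_power[OF this, of p] have "Y i j \<in> tord 3"
    unfolding Y_def using p_ge_3 by (auto intro: tord_mono)
  moreover have "cst (e k) * (Xp k i * Xp (dual k) j) \<in> tord 3" for k
  proof (cases "k = i")
    case True
    then show ?thesis using False p_ge_3 unfolding Xp_def by (intro tord_mult_right xmat_off_power_tord) auto
  next
    case k: False
    then show ?thesis using p_ge_3 unfolding Xp_def by (intro tord_mult_right[OF tord_mult_left] xmat_off_power_tord)
  qed
  then have "W i j \<in> tord 3" unfolding W_def mmul_Qt by (rule tord_sum)
  ultimately show ?thesis using False by (simp add: tord_diff)
next
  case True
  let ?a = "cst (e i) * (xmat i i * xmat (dual i) (dual i))"
  obtain n where n: "p = Suc n" "even n" using odd_p p_pos by (cases p) auto
  have s: "(\<Sum>k\<in>UNIV. f k) = f i + (\<Sum>k\<in>- {i}. f k)" for f :: "'n \<Rightarrow> ('n \<times> 'n) mps"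
    using sum.remove[of UNIV i f] by (simp add: Compl_eq_Diff_UNIV)
  have Ye: "Y i j = (?a + Rq i) ^ p" unfolding Y_def mmul_Qt True s Rq_def ..
  have r: "cst (e k) * (Xp k i * Xp (dual k) (dual i)) \<in> tord 3" if "k \<in> - {i}" for k
    using that p_ge_3 unfolding Xp_def by (intro tord_mult_right[OF tord_mult_left] xmat_off_power_tord) auto
  have "W i j = ?a ^ p + (\<Sum>k\<in>- {i}. cst (e k) * (Xp k i * Xp (dual k) (dual i)))"
    unfolding W_def mmul_Qt True s Xp_def by (simp add: power_mult_distrib e_power[OF odd_p] flip: cst_power)
  then have We: "W i j - ?a ^ p \<in> tord 3" using tord_sum[of "- {i}", OF r] by simp
  have "xmat i i * xmat (dual i) (dual i) - 1 = (xmat i i - mone i i) * xmat (dual i) (dual i) + (xmat (dual i) (dual i) - mone (dual i) (dual i))"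
    by (simp add: mone_def algebra_simps)
  also have "\<dots> \<in> tord 1" by (intro tord_add tord_mult_left xmat_tord)
  finally have "?a - cst (e i) \<in> tord 1"
    using tord_mult_right[of "xmat i i * xmat (dual i) (dual i) - 1" 1 "cst (e i)"] by (simp add: algebra_simps)
  then have "?a ^ n - cst (e i) ^ n \<in> tord 1" by (rule tord_power_diff)
  then have an: "?a ^ n - 1 \<in> tord 1" using e_power_even[OF n(2), of i] by (simp add: cst_1 flip: cst_power)
  have sq: "(?a + Rq i) ^ p - (?a ^ p + of_nat p * (?a ^ n * Rq i)) \<in> tord 4"
    using power_add_mod_square[OF Rq_tord[of i], of ?a n] by (simp only: n(1))
  have "Y i j - W i j - of_nat p * Rq i = ((?a + Rq i) ^ p - (?a ^ p + of_nat p * (?a ^ n * Rq i)))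
      - (W i j - ?a ^ p) + of_nat p * ((?a ^ n - 1) * Rq i)"
    unfolding Ye by (simp add: algebra_simps)
  also have "\<dots> \<in> tord 3"
    by (intro tord_add tord_diff We tord_mono[OF sq] tord_mult_right[of "(?a ^ n - 1) * Rq i"]
        tord_mono[OF tord_mult_add[OF an Rq_tord]]) simp_all
  finally show ?thesis using True by simp
qed

text \<open>As \<open>Winv\<close> inverts \<open>W\<close>, the matrix \<open>w - 1\<close> equals
  \<open>Winv (Y - W)\<close>. Here \<open>Y - W\<close> has order \<open>2\<close> and
  \<open>Winv\<close> is the transpose of \<open>Qt\<close> modulo \<open>I\<close>, so modulo
  \<open>I^3\<close> the product only permutes the rows of \<open>Y - W\<close> by
  \<open>dual\<close> and multiplies them by signs.\<close>

lemma w_approx: "w i j - mone i j - (if i = j then cst (e (dual i)) * (of_nat p * Rq (dual i)) else 0) \<in> tord 3"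
proof -
  define D where "D = (\<lambda>i j. Y i j - W i j)"
  have Dt: "D i j \<in> tord 2" for i j
  proof -
    have "D i j - (if j = dual i then of_nat p * Rq i else 0) \<in> tord 2"
      unfolding D_def by (rule tord_mono[OF YW]) simp
    moreover have "(if j = dual i then of_nat p * Rq i else 0) \<in> tord 2" by (simp add: tord_mult_right Rq_tord)
    ultimately show ?thesis using tord_add by fastforce
  qed
  have wD: "w i j - mone i j = mmul Winv D i j" for i j
    unfolding w_def D_def mmul_diff_right W_Winv(2) ..
  have Wt: "Winv i j - mat_transpose Qt i j \<in> tord 1" for i j
  proof -
    have VT: "mat_transpose V i j - mone i j \<in> tord 1" for i j
      using V_tord[of j i] by (simp add: mat_transpose_def mone_def eq_commute)
    have "Winv i j - mat_transpose Qt i j = mmul (mmul V (mat_transpose Qt)) (\<lambda>i j. mat_transpose V i j - mone i j) i j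
        + mmul (\<lambda>i j. V i j - mone i j) (mat_transpose Qt) i j"
      by (simp add: mmul_diff_right mmul_diff_left Winv_def)
    also have "\<dots> \<in> tord 1"
      using mmul_tord[of "mmul V (mat_transpose Qt)" 0 "\<lambda>i j. mat_transpose V i j - mone i j" 1]
        mmul_tord[of "\<lambda>i j. V i j - mone i j" 1 "mat_transpose Qt" 0] VT V_tord
      by (intro tord_add) auto
    finally show ?thesis .
  qed
  have 1: "mmul (\<lambda>i j. Winv i j - mat_transpose Qt i j) D i j \<in> tord 3"
    by (rule tord_mono[OF mmul_tord[of "\<lambda>i j. Winv i j - mat_transpose Qt i j" 1 D 2, OF Wt Dt]]) simp
  have Qm: "mmul (mat_transpose Qt) Z i j = cst (e (dual i)) * Z (dual i) j" for Z
  proof -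
    have "mmul (mat_transpose Qt) Z i j = (\<Sum>k\<in>UNIV. if k = dual i then cst (e (dual i)) * Z (dual i) j else 0)"
      unfolding mmul_def by (rule sum.cong) (auto simp: mat_transpose_def Qt_def q_app dual_dual)
    then show ?thesis by simp
  qed
  have 2: "cst (e (dual i)) * (D (dual i) j - (if j = dual (dual i) then of_nat p * Rq (dual i) else 0)) \<in> tord 3"
    unfolding D_def by (rule tord_mult_right[OF YW])
  have "w i j - mone i j - (if i = j then cst (e (dual i)) * (of_nat p * Rq (dual i)) else 0)
      = mmul (\<lambda>i j. Winv i j - mat_transpose Qt i j) D i j
        + cst (e (dual i)) * (D (dual i) j - (if j = dual (dual i) then of_nat p * Rq (dual i) else 0))"
    unfolding wD mmul_diff_left Qm by (simp add: dual_dual algebra_simps)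
  also have "\<dots> \<in> tord 3" by (intro tord_add 1 2)
  finally show ?thesis .
qed

lemma w_tord: "w i j - mone i j \<in> tord 2"
proof -
  have "(if i = j then cst (e (dual i)) * (of_nat p * Rq (dual i)) else 0) \<in> tord 2"
    by (simp add: tord_mult_right Rq_tord)
  from tord_add[OF tord_mono[OF w_approx, of 2 i j] this] show ?thesis by simp
qed

section \<open>The square root and the image of \<open>T\<close> modulo \<open>I^3\<close>\<close>

definition S :: "'n \<Rightarrow> ('n \<times> 'n) mps" where
  "S i = cst (e (dual i)) * Rq (dual i)"

lemma mpow_w_tord: "mpow (\<lambda>i j. w i j - mone i j) l i j \<in> tord (l * 2)"
  by (rule mpow_tord[OF w_tord])

lemma \<sigma>_term_tord: "cst ((1/2) gchoose l) * mpow (\<lambda>i j. w i j - mone i j) l i j \<in> tord l"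
  by (rule tord_mult_right, rule tord_mono[OF mpow_w_tord]) simp

lemma \<sigma>_approx: "\<sigma> i j - mone i j - cst (1/2) * (w i j - mone i j) \<in> tord 3"
proof -
  let ?a = "\<lambda>l. cst ((1/2) gchoose l) * mpow (\<lambda>i j. w i j - mone i j) l i j"
  \<comment> \<open>\<open>ser_approx\<close> uses only that the \<open>l\<close>-th term has order
    \<open>l\<close>, so an error of order \<open>3\<close> requires the sum up to
    \<open>l = 2\<close>. The term at \<open>l = 2\<close> is then dropped, as its true order is
    \<open>4\<close>.\<close>
  have 1: "\<sigma> i j - (\<Sum>l\<le>2. ?a l) \<in> tord 3"
    unfolding \<sigma>_def by (rule tord_mono[OF ser_approx[OF \<sigma>_term_tord]]) simp
  have 2: "?a 2 \<in> tord 3" by (rule tord_mult_right, rule tord_mono[OF mpow_w_tord]) simp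
  have s: "(\<Sum>l\<le>2. f l) = f 0 + f 1 + f 2" for f :: "nat \<Rightarrow> ('n \<times> 'n) mps"
    by (simp add: numeral_2_eq_2)
  have 3: "(\<Sum>l\<le>2. ?a l) = mone i j + cst (1/2) * (w i j - mone i j) + ?a 2"
    unfolding s by (simp add: cst_1)
  have "\<sigma> i j - mone i j - cst (1/2) * (w i j - mone i j) = (\<sigma> i j - (\<Sum>l\<le>2. ?a l)) + ?a 2"
    unfolding 3 by (simp add: algebra_simps)
  also have "\<dots> \<in> tord 3" by (rule tord_add[OF 1 2])
  finally show ?thesis .
qed

definition yc :: "'n \<times> 'n \<Rightarrow> ('n \<times> 'n) mps" where
  "yc = (\<lambda>(i, j). mmul Xp \<sigma> i j - mone i j)"

lemma yc_PA: "yc v \<in> PA"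
  by (auto simp: yc_def split: prod.split intro!: PA_diff PA_mmul PA_mone Xp_PA \<sigma>_PA)

text \<open>The difference between the Chern and the trivial image of \<open>x\<close> is
  \<open>x^(p) (\<sigma> - 1)\<close>, and since \<open>\<sigma> - 1\<close> has order
  \<open>2\<close> the factor \<open>x^(p)\<close> may be replaced by \<open>1\<close>. In the
  constant \<open>p / 2\<close> the \<open>p\<close> comes from the first-order term of the
  \<open>p\<close>-th power in \<open>Y\<close>, and \<open>1/2\<close> is the linear binomial
  coefficient.\<close>

lemma yc_approx: "yc (i, j) - (xmat i j ^ p - mone i j) - (if i = j then cst (of_nat p / 2) * S i else 0) \<in> tord 3"
proof -
  let ?z = "\<lambda>i j. \<sigma> i j - mone i j"
  let ?r = "if i = j then cst (of_nat p / 2) * S i else 0"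
  have z: "?z i j - (if i = j then cst (of_nat p / 2) * S i else 0) \<in> tord 3" for i j
  proof -
    have c: "cst (1/2) * of_nat p = cst (of_nat p / 2)" by (simp flip: cst_of_nat cst_mult)
    have "?z i j - (if i = j then cst (of_nat p / 2) * S i else 0) = (\<sigma> i j - mone i j - cst (1/2) * (w i j - mone i j))
      + cst (1/2) * (w i j - mone i j - (if i = j then cst (e (dual i)) * (of_nat p * Rq (dual i)) else 0))"
      by (simp add: S_def algebra_simps flip: c)
    also have "\<dots> \<in> tord 3" by (intro tord_add \<sigma>_approx tord_mult_right[OF w_approx])
    finally show ?thesis .
  qed
  have zt: "?z i j \<in> tord 2" for i j
  proof -
    have "(if i = j then cst (of_nat p / 2) * S i else 0) \<in> tord 2" by (simp add: S_def tord_mult_right Rq_tord)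
    from tord_add[OF tord_mono[OF z, of 2 i j] this] show ?thesis by simp
  qed
  have "yc (i, j) - (xmat i j ^ p - mone i j) - ?r = mmul Xp ?z i j - ?r"
    by (simp add: yc_def mmul_diff_right Xp_def)
  also have "\<dots> = mmul (\<lambda>i j. Xp i j - mone i j) ?z i j + (?z i j - ?r)"
    by (simp add: mmul_diff_left)
  also have "\<dots> \<in> tord 3"
    by (rule tord_add[OF tord_mono[OF mmul_tord[of "\<lambda>i j. Xp i j - mone i j" 1 ?z 2, OF Xp_tord zt]] z]) simp
  finally show ?thesis .
qed

end

section \<open>Globality of the Chern connection\<close>

context conn
begin

abbreviation Mat :: "('n, ('n, complex) GL_hat) matrix ring" where
  "Mat \<equiv> mat_ring (GL_completion A p)"

sublocale M: ring Mat by (rule B.mat_ring_ring)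

definition tocm :: "('n, ('n \<times> 'n) mps) matrix \<Rightarrow> ('n, ('n, complex) GL_hat) matrix" where
  "tocm F = (\<lambda>i j. toc (F i j))"

lemma tocm_closed: "(\<And>i j. F i j \<in> GO) \<Longrightarrow> tocm F \<in> carrier Mat"
  by (simp add: mat_ring_simps tocm_def toc_closed)

lemma tocm_mmul:
  assumes F: "\<And>i j. F i j \<in> GO" and G: "\<And>i j. G i j \<in> GO"
  shows "tocm F \<otimes>\<^bsub>Mat\<^esub> tocm G = tocm (mmul F G)"
proof -
  have "(\<Oplus>\<^bsub>GL_completion A p\<^esub>k\<in>I. toc (F i k) \<otimes>\<^bsub>GL_completion A p\<^esub> toc (G k j)) = toc (\<Sum>k\<in>I. F i k * G k j)" for i j I
  proof (induction I rule: infinite_finite_induct)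
    case (insert k I)
    have "toc (F i k * G k j) = toc (F i k) \<otimes>\<^bsub>GL_completion A p\<^esub> toc (G k j)"
      using F G by (simp add: O.to_completion_mult flip: GL_mult)
    moreover have "toc (F i k * G k j + (\<Sum>k\<in>I. F i k * G k j)) =
        toc (F i k * G k j) \<oplus>\<^bsub>GL_completion A p\<^esub> toc (\<Sum>k\<in>I. F i k * G k j)"
      using F G by (simp add: O.to_completion_add GO_mult GO_sum flip: GL_add)
    ultimately show ?case using insert F G by (simp add: toc_closed del: cf_simps)
  qed (simp_all add: O.padic_zero_eq GL_zero del: cf_simps)
  then show ?thesis by (simp add: mat_ring_simps tocm_def mmul_def)
qed

lemma tocm_mone: "tocm mone = \<one>\<^bsub>Mat\<^esub>"
  by (auto simp: tocm_def mone_def mat_ring_simps O.padic_zero_eq O.padic_one_eq GL_zero GL_one fun_eq_iff simp del: cf_simps)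

definition \<Phi>m :: "('n, ('n, complex) GL_hat) matrix \<Rightarrow> ('n, ('n, complex) GL_hat) matrix" where
  "\<Phi>m X = (\<lambda>i j. \<Phi> (X i j))"

lemma \<Phi>m_closed: "X \<in> carrier Mat \<Longrightarrow> \<Phi>m X \<in> carrier Mat"
  by (simp add: mat_ring_simps \<Phi>m_def)

lemma \<Phi>m_mult:
  assumes "X \<in> carrier Mat" "Z \<in> carrier Mat"
  shows "\<Phi>m (X \<otimes>\<^bsub>Mat\<^esub> Z) = \<Phi>m X \<otimes>\<^bsub>Mat\<^esub> \<Phi>m Z"
proof -
  have c: "X i j \<in> carrier (GL_completion A p)" "Z i j \<in> carrier (GL_completion A p)" for i j
    using assms by (auto simp: mat_ring_simps)
  have "\<Phi> (\<Oplus>\<^bsub>GL_completion A p\<^esub>k\<in>I. X i k \<otimes>\<^bsub>GL_completion A p\<^esub> Z k j) =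
      (\<Oplus>\<^bsub>GL_completion A p\<^esub>k\<in>I. \<Phi> (X i k) \<otimes>\<^bsub>GL_completion A p\<^esub> \<Phi> (Z k j))" for I i j
    by (induction I rule: infinite_finite_induct) (auto simp: c Pi_def)
  then show ?thesis by (simp add: mat_ring_simps \<Phi>m_def)
qed

lemma \<Phi>m_one: "\<Phi>m \<one>\<^bsub>Mat\<^esub> = \<one>\<^bsub>Mat\<^esub>"
  by (auto simp: mat_ring_simps \<Phi>m_def fun_eq_iff)

lemma mat_transpose_Units:
  assumes "X \<in> carrier Mat" "Z \<in> carrier Mat" "X \<otimes>\<^bsub>Mat\<^esub> Z = \<one>\<^bsub>Mat\<^esub>" "Z \<otimes>\<^bsub>Mat\<^esub> X = \<one>\<^bsub>Mat\<^esub>"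
  shows "mat_transpose X \<in> Units Mat"
proof -
  have t: "mat_transpose \<one>\<^bsub>Mat\<^esub> = \<one>\<^bsub>Mat\<^esub>"
    by (auto simp: mat_ring_simps mat_transpose_def fun_eq_iff)
  have c: "mat_transpose X \<in> carrier Mat" "mat_transpose Z \<in> carrier Mat"
    using assms by (auto simp: mat_ring_simps mat_transpose_def)
  have "mat_transpose X \<otimes>\<^bsub>Mat\<^esub> mat_transpose Z = \<one>\<^bsub>Mat\<^esub>" "mat_transpose Z \<otimes>\<^bsub>Mat\<^esub> mat_transpose X = \<one>\<^bsub>Mat\<^esub>"
    using B.mat_transpose_mult[of Z X] B.mat_transpose_mult[of X Z] assms t by (simp_all add: mat_ring_simps(1))
  then show ?thesis using c by (auto simp: Units_def)
qed

text \<open>\<open>x\<^sup>(\<^sup>p\<^sup>)\<close> is invertible: \<open>\<Phi>(x) = x\<^sup>(\<^sup>p\<^sup>) s\<close> is invertible and congruent to \<open>x\<^sup>(\<^sup>p\<^sup>)\<close> modulo \<open>p\<close>.\<close>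

lemma xp_inverse:
  assumes s: "s \<in> carrier Mat"
    and eq: "(\<lambda>i j. \<Phi> (GL_x A p i j)) = entrywise_pow (GL_completion A p) (GL_x A p) p \<otimes>\<^bsub>Mat\<^esub> s"
  obtains r where "r \<in> carrier Mat"
    "entrywise_pow (GL_completion A p) (GL_x A p) p \<otimes>\<^bsub>Mat\<^esub> r = \<one>\<^bsub>Mat\<^esub>"
    "r \<otimes>\<^bsub>Mat\<^esub> entrywise_pow (GL_completion A p) (GL_x A p) p = \<one>\<^bsub>Mat\<^esub>"
proof -
  let ?x = "GL_x A p :: ('n, ('n, complex) GL_hat) matrix"
  let ?xp = "entrywise_pow (GL_completion A p) ?x p"
  have x: "?x = tocm xmat" by (simp add: GL_x_eq tocm_def)
  have xc: "?x \<in> carrier Mat" unfolding x by (rule tocm_closed[OF GO_xmat])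
  have xij: "?x i j \<in> carrier (GL_completion A p)" for i j using xc by (simp add: mat_ring_simps)
  have xpc: "?xp \<in> carrier Mat" using xij by (simp add: mat_ring_simps entrywise_pow_def)
  let ?z = "tocm xinv"
  have zc: "?z \<in> carrier Mat" by (rule tocm_closed[OF GO_xinv])
  have xz: "?x \<otimes>\<^bsub>Mat\<^esub> ?z = \<one>\<^bsub>Mat\<^esub>" "?z \<otimes>\<^bsub>Mat\<^esub> ?x = \<one>\<^bsub>Mat\<^esub>"
    by (simp_all add: x tocm_mmul GO_xmat GO_xinv xmat_xinv tocm_mone)
  have \<Phi>xz: "\<Phi>m ?x \<otimes>\<^bsub>Mat\<^esub> \<Phi>m ?z = \<one>\<^bsub>Mat\<^esub>" "\<Phi>m ?z \<otimes>\<^bsub>Mat\<^esub> \<Phi>m ?x = \<one>\<^bsub>Mat\<^esub>"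
    by (simp_all add: \<Phi>m_one xz xc zc flip: \<Phi>m_mult)
  have e: "\<Phi>m ?x = ?xp \<otimes>\<^bsub>Mat\<^esub> s" using eq by (simp add: \<Phi>m_def)
  define D where "D = (\<lambda>i j. d (?x i j))"
  have Dc: "D \<in> carrier Mat" using xij by (simp add: D_def mat_ring_simps d_closed)
  have \<Phi>D: "\<Phi>m ?x = ?xp \<oplus>\<^bsub>Mat\<^esub> [p] \<cdot>\<^bsub>Mat\<^esub> D"
    unfolding B.mat_ring_add_pow by (simp add: \<Phi>m_def \<Phi>_eq mat_ring_simps D_def entrywise_pow_def)
  note c = xpc zc s Dc \<Phi>m_closed[OF zc] \<Phi>m_closed[OF xc]
  \<comment> \<open>With \<open>?z\<close> inverse to \<open>x\<close>, the equation
    \<open>\<Phi>(x) = x^(p) s\<close> makes \<open>s \<Phi>(?z)\<close> a right inverse of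
    \<open>x^(p)\<close>. The matrix \<open>\<Phi>(?z)\<close> is a left inverse modulo
    \<open>p\<close>, which is enough to make the right inverse two-sided.\<close>
  have xr: "?xp \<otimes>\<^bsub>Mat\<^esub> (s \<otimes>\<^bsub>Mat\<^esub> \<Phi>m ?z) = \<one>\<^bsub>Mat\<^esub>"
    using \<Phi>xz(1) c by (simp add: e M.m_assoc)
  have pD: "[p] \<cdot>\<^bsub>Mat\<^esub> D \<in> carrier Mat" by (rule M.add.nat_pow_closed[OF Dc])
  have "?xp = \<Phi>m ?x \<ominus>\<^bsub>Mat\<^esub> [p] \<cdot>\<^bsub>Mat\<^esub> D" unfolding \<Phi>D using c pD
    by (simp add: a_minus_def M.a_assoc M.r_neg)
  then have "\<Phi>m ?z \<otimes>\<^bsub>Mat\<^esub> ?xp = \<Phi>m ?z \<otimes>\<^bsub>Mat\<^esub> \<Phi>m ?x \<ominus>\<^bsub>Mat\<^esub> \<Phi>m ?z \<otimes>\<^bsub>Mat\<^esub> [p] \<cdot>\<^bsub>Mat\<^esub> D"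
    using c pD by (simp add: a_minus_def M.r_distr M.r_minus)
  then have zx: "\<Phi>m ?z \<otimes>\<^bsub>Mat\<^esub> ?xp = \<one>\<^bsub>Mat\<^esub> \<ominus>\<^bsub>Mat\<^esub> [p] \<cdot>\<^bsub>Mat\<^esub> (\<Phi>m ?z \<otimes>\<^bsub>Mat\<^esub> D)"
    using c by (simp add: \<Phi>xz M.add_pow_rdistr)
  have sep: "E = \<zero>\<^bsub>Mat\<^esub>" if E: "E \<in> carrier Mat" "\<And>k. \<exists>a\<in>carrier Mat. E = [(p ^ k :: nat)] \<cdot>\<^bsub>Mat\<^esub> a" for E
  proof -
    have "E i j = \<zero>\<^bsub>GL_completion A p\<^esub>" for i j
    proof (rule O.padic_separated)
      show "E i j \<in> carrier (GL_completion A p)" using E(1) by (simp add: mat_ring_simps)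
      fix k
      obtain a where "a \<in> carrier Mat" "E = [(p ^ k :: nat)] \<cdot>\<^bsub>Mat\<^esub> a" using E(2) by blast
      then show "\<exists>C\<in>carrier (GL_completion A p). E i j = [(p ^ k :: nat)] \<cdot>\<^bsub>GL_completion A p\<^esub> C"
        by (intro bexI[of _ "a i j"]) (simp_all add: B.mat_ring_add_pow mat_ring_simps)
    qed
    then show ?thesis by (simp add: mat_ring_simps fun_eq_iff)
  qed
  have "s \<otimes>\<^bsub>Mat\<^esub> \<Phi>m ?z \<otimes>\<^bsub>Mat\<^esub> ?xp = \<one>\<^bsub>Mat\<^esub>"
    by (rule M.right_inverse_imp_left_inverse[OF xpc _ _ _ xr zx]) (use c sep in auto)
  with xr c show ?thesis by (intro that[of "s \<otimes>\<^bsub>Mat\<^esub> \<Phi>m ?z"]) auto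
qed

end

context chern_data
begin

lemma tay_x: "tay p (GL_x A p i j) (xmat i j :: ('n \<times> 'n) mps)"
  by (simp add: GL_x_eq tay_to_completion GO_xmat)

text \<open>Each ingredient of the Chern formula receives its Taylor expansion. Since
  \<open>x^(p)\<close>, its transpose and the form are units, \<open>inv\<close> denotes a genuine
  inverse and is matched with \<open>Winv\<close>; the \<open>p\<close>-adic square root
  \<open>s\<close> is then matched with the \<open>T\<close>-adic \<open>\<sigma>\<close>.\<close>

lemma chern_lift:
  fixes s :: "('n, ('n, complex) GL_hat) matrix"
  defines "x \<equiv> GL_x A p :: ('n, ('n, complex) GL_hat) matrix"
  defines "xp \<equiv> entrywise_pow (GL_completion A p) x p"
  defines "Q \<equiv> (\<lambda>i j. GL_scalar A p (q i j)) :: ('n, ('n, complex) GL_hat) matrix"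
  defines "\<phi>Q \<equiv> (\<lambda>i j. GL_scalar A p (\<phi> (q i j))) :: ('n, ('n, complex) GL_hat) matrix"
  defines "wB \<equiv> inv\<^bsub>Mat\<^esub> (mat_transpose xp \<otimes>\<^bsub>Mat\<^esub> \<phi>Q \<otimes>\<^bsub>Mat\<^esub> xp) \<otimes>\<^bsub>Mat\<^esub>
      entrywise_pow (GL_completion A p) (mat_transpose x \<otimes>\<^bsub>Mat\<^esub> Q \<otimes>\<^bsub>Mat\<^esub> x) p"
  assumes s: "binomial_sqrt (GL_completion A p) p (GL_scalar A p) wB s"
    and eq: "(\<lambda>i j. \<Phi> (x i j)) = xp \<otimes>\<^bsub>Mat\<^esub> s"
  shows "frob_lift A K \<phi> yc p \<Phi>"
proof -
  have sc: "s \<in> carrier Mat" using s by (simp add: binomial_sqrt_def)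
  obtain r where r: "r \<in> carrier Mat" "xp \<otimes>\<^bsub>Mat\<^esub> r = \<one>\<^bsub>Mat\<^esub>" "r \<otimes>\<^bsub>Mat\<^esub> xp = \<one>\<^bsub>Mat\<^esub>"
    using xp_inverse[OF sc] eq unfolding xp_def x_def by blast
  have tx: "tay p (x i j) (xmat i j)" for i j unfolding x_def by (rule tay_x)
  have txp: "tay p (xp i j) (Xp i j)" for i j
    unfolding xp_def entrywise_pow_def Xp_def by (rule tay_nat_pow[OF tx])
  have xpc: "xp \<in> carrier Mat" using tay_closed[OF txp] by (simp add: mat_ring_simps)
  have Q: "Q = tocm Qt" "\<phi>Q = tocm Qt"
    by (simp_all add: Q_def \<phi>Q_def tocm_def \<phi>_q GL_scalar_eq Qt_def)
  have tQ: "tay p (Q i j) (Qt i j)" "tay p (\<phi>Q i j) (Qt i j)" for i j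
    unfolding Q tocm_def by (simp_all add: tay_to_completion Qt_GO)
  have Qt': "mat_transpose Qt i j \<in> GO" for i j by (simp add: mat_transpose_def Qt_GO)
  have QU: "\<phi>Q \<in> Units Mat"
    unfolding Q Units_def
    by (auto simp: tocm_closed Qt_GO Qt' tocm_mmul Qt_inverse tocm_mone intro!: bexI[of _ "tocm (mat_transpose Qt)"])
  have xpU: "xp \<in> Units Mat" using r xpc by (auto simp: Units_def)
  have xpU': "mat_transpose xp \<in> Units Mat" by (rule mat_transpose_Units[OF xpc r])
  let ?W = "mat_transpose xp \<otimes>\<^bsub>Mat\<^esub> \<phi>Q \<otimes>\<^bsub>Mat\<^esub> xp"
  have WU: "?W \<in> Units Mat" by (intro M.Units_m_closed xpU xpU' QU)
  have ttr: "tay p (mat_transpose xp i j) (mat_transpose Xp i j)" "tay p (mat_transpose x i j) (mat_transpose xmat i j)" for i j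
    by (simp_all add: mat_transpose_def txp tx)
  have tW: "tay p (?W i j) (W i j)" for i j
    unfolding W_def by (intro tay_mat_mult ttr txp tQ)
  have tWi: "tay p ((inv\<^bsub>Mat\<^esub> ?W) i j) (Winv i j)" for i j
    by (rule tay_mat_inverse[OF tW M.Units_inv_closed[OF WU] M.Units_r_inv[OF WU] W_Winv(2) Winv_PA])
  have tY: "tay p (entrywise_pow (GL_completion A p) (mat_transpose x \<otimes>\<^bsub>Mat\<^esub> Q \<otimes>\<^bsub>Mat\<^esub> x) p i j) (Y i j)" for i j
    unfolding Y_def entrywise_pow_def by (intro tay_nat_pow tay_mat_mult ttr tx tQ)
  have tw: "tay p (wB i j) (w i j)" for i j
    unfolding wB_def w_def by (rule tay_mat_mult[OF tWi tY])
  have wc: "wB \<in> carrier Mat" using tay_closed[OF tw] by (simp add: mat_ring_simps)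
  have tw1: "tay p ((wB \<ominus>\<^bsub>Mat\<^esub> \<one>\<^bsub>Mat\<^esub>) i j) (w i j - mone i j)" for i j
  proof -
    have "(wB \<ominus>\<^bsub>Mat\<^esub> \<one>\<^bsub>Mat\<^esub>) = (\<lambda>i j. wB i j \<ominus>\<^bsub>GL_completion A p\<^esub> \<one>\<^bsub>Mat\<^esub> i j)"
      by (rule B.mat_ring_minus[OF tay_closed[OF tw] tay_closed[OF tay_mat_one]])
    then show ?thesis using tay_minus[OF tw tay_mat_one] by simp
  qed
  have tpow: "tay p (((wB \<ominus>\<^bsub>Mat\<^esub> \<one>\<^bsub>Mat\<^esub>) [^]\<^bsub>Mat\<^esub> l) i j) (mpow (\<lambda>i j. w i j - mone i j) l i j)" for l :: nat and i j
  proof (induction l arbitrary: i j)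
    case 0
    show ?case using tay_mat_one by simp
  next
    case (Suc l)
    show ?case using tay_mat_mult[OF Suc tw1] by simp
  qed
  let ?t = "\<lambda>l i j. GL_scalar A p ((1/2) gchoose l) \<otimes>\<^bsub>GL_completion A p\<^esub> ((wB \<ominus>\<^bsub>Mat\<^esub> \<one>\<^bsub>Mat\<^esub>) [^]\<^bsub>Mat\<^esub> l) i j"
  let ?a = "\<lambda>l i j. cst ((1/2) gchoose l) * mpow (\<lambda>i j. w i j - mone i j) l i j"
  have tt: "tay p (?t l i j) (?a l i j)" for l i j
    by (intro tay_mult tpow) (simp add: GL_scalar_eq tay_to_completion GO_cst gbinomial_K)
  have ts: "tay p (s i j) (\<sigma> i j)" for i j
  proof (rule tayI)
    show sij: "s i j \<in> carrier (GL_completion A p)" using sc by (simp add: mat_ring_simps)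
    show "\<sigma> i j \<in> PA" by (rule \<sigma>_PA)
    fix k
    obtain G where G: "G \<in> GO" "cf G \<in> s i j k" using GL_hat_ex[OF sij] by blast
    have "G - \<sigma> i j \<in> pdiv (p ^ k)" unfolding pdiv_iff
    proof
      fix m :: "('n \<times> 'n) multiset"
      obtain m0 where m0: "\<And>m. m \<ge> m0 \<Longrightarrow> (s \<ominus>\<^bsub>Mat\<^esub> (\<Oplus>\<^bsub>Mat\<^esub>l\<in>{..m}. ?t l)) i j \<in> p_ideal (GL_completion A p) p k"
        using s unfolding binomial_sqrt_def by blast
      \<comment> \<open>From \<open>m0\<close> on, the partial sums agree with \<open>s\<close>
        modulo \<open>p ^ k\<close>; from \<open>size m\<close> on, their expansions have the final
        coefficient at \<open>m\<close>. Beyond both bounds one partial sum serves the two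
        limits.\<close>
      define n where "n = max m0 (size m)"
      let ?F = "\<Oplus>\<^bsub>GL_completion A p\<^esub>l\<in>{..n}. ?t l i j"
      have tF: "tay p ?F (\<Sum>l\<le>n. ?a l i j)" by (rule tay_finsum[OF tt])
      have Fe: "(\<Oplus>\<^bsub>Mat\<^esub>l\<in>{..n}. ?t l) = (\<lambda>i j. \<Oplus>\<^bsub>GL_completion A p\<^esub>l\<in>{..n}. ?t l i j)"
        by (rule B.mat_ring_finsum[OF tay_closed[OF tt]])
      have "(s \<ominus>\<^bsub>Mat\<^esub> (\<Oplus>\<^bsub>Mat\<^esub>l\<in>{..n}. ?t l)) i j = s i j \<ominus>\<^bsub>GL_completion A p\<^esub> ?F"
        unfolding Fe using sc tay_closed[OF tay_finsum[OF tt]]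
        by (subst B.mat_ring_minus) (simp_all add: mat_ring_simps)
      then have "s i j \<ominus>\<^bsub>GL_completion A p\<^esub> ?F \<in> p_ideal (GL_completion A p) p k"
        using m0[of n] by (simp add: n_def)
      then obtain C where C: "C \<in> carrier (GL_completion A p)"
        "s i j \<ominus>\<^bsub>GL_completion A p\<^esub> ?F = [(p ^ k :: nat)] \<cdot>\<^bsub>GL_completion A p\<^esub> C"
        by (auto simp: B.p_ideal_iff)
      obtain H where H: "H \<in> GO" "cf H \<in> ?F k" "H - (\<Sum>l\<le>n. ?a l i j) \<in> pdiv (p ^ k)" using tay_ex[OF tF] by blast
      have "s i j = ?F \<oplus>\<^bsub>GL_completion A p\<^esub> (s i j \<ominus>\<^bsub>GL_completion A p\<^esub> ?F)"
        using sij tay_closed[OF tF] by (simp add: a_minus_def B.a_ac B.r_neg)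
      then have e: "s i j = ?F \<oplus>\<^bsub>GL_completion A p\<^esub> [(p ^ k :: nat)] \<cdot>\<^bsub>GL_completion A p\<^esub> C" unfolding C(2) .
      have "cf H \<oplus>\<^bsub>GL_coord A\<^esub> \<zero>\<^bsub>GL_coord A\<^esub> \<in> s i j k"
        by (subst e) (intro O.padic_add_mem tay_closed[OF tF] H O.padic_dvd_imp_level_zero B.add.nat_pow_closed C(1))
      then have "cf H \<in> s i j k" by (simp add: GL_zero GL_add del: cf_simps)
      then have "(G - H) + (H - (\<Sum>l\<le>n. ?a l i j)) \<in> pdiv (p ^ k)" by (intro pdiv_add GL_hat_cong[OF sij] G H)
      then have 1: "G - (\<Sum>l\<le>n. ?a l i j) \<in> pdiv (p ^ k)" by simp
      have "\<sigma> i j - (\<Sum>l\<le>n. ?a l i j) \<in> tord (Suc n)"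
        unfolding \<sigma>_def by (rule ser_approx[OF \<sigma>_term_tord])
      then have "cf (\<sigma> i j) m = cf (\<Sum>l\<le>n. ?a l i j) m" by (simp add: tord_def n_def)
      then have 2: "cf (G - \<sigma> i j) m = cf (G - (\<Sum>l\<le>n. ?a l i j)) m" by simp
      show "\<exists>c\<in>K. cf (G - \<sigma> i j) m = of_nat (p ^ k) * c"
        unfolding 2 by (rule 1[unfolded pdiv_iff, rule_format])
    qed
    then show "\<exists>G. cf G \<in> s i j k \<and> G - \<sigma> i j \<in> pdiv (p ^ k)" using G by blast
  qed
  show ?thesis
  proof (rule frob_liftI)
    show "yc v \<in> PA" for v by (rule yc_PA)
    show "tay p (\<Phi> (GL_x A p i j)) (yc (i, j) + mone i j)" for i j
    proof -
      have "\<Phi> (GL_x A p i j) = (xp \<otimes>\<^bsub>Mat\<^esub> s) i j" using eq unfolding x_def by metis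
      then show ?thesis using tay_mat_mult[of p xp Xp s \<sigma> i j, OF txp ts] by (simp add: yc_def)
    qed
    show "yc v \<in> tord 1" for v
    proof (cases v)
      case (Pair i j)
      let ?r = "if i = j then cst (of_nat p / 2) * S i else 0"
      have 1: "?r \<in> tord 1" using tord_mono[OF Rq_tord, of 1] by (simp add: S_def tord_mult_right)
      have 2: "yc (i, j) - (xmat i j ^ p - mone i j) - ?r \<in> tord 1" by (rule tord_mono[OF yc_approx]) simp
      have 3: "xmat i j ^ p - mone i j \<in> tord 1" by (rule xmat_power_tord[OF p_pos])
      show ?thesis using tord_add[OF tord_add[OF 2 3] 1] by (simp add: Pair)
    qed
  qed
qed

end

section \<open>Curvature\<close>

lemma mone_same: "mone i i = 1" and mone_diff: "i \<noteq> j \<Longrightarrow> mone i j = 0"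
  by (simp_all add: mone_def)

text \<open>Bezout coefficients of \<open>m\<close> and \<open>n\<close> combine the two quotients
  into one.\<close>

lemma pdiv_coprime:
  assumes "coeff_ring A K" "coprime m n" "F \<in> coeff_ring.pdiv K m" "F \<in> coeff_ring.pdiv K n"
  shows "F \<in> coeff_ring.pdiv K (m * n)"
proof -
  interpret coeff_ring A K by fact
  obtain a b where a: "a \<in> PA" "F = of_nat m * a" and b: "b \<in> PA" "F = of_nat n * b"
    using assms(3,4) by (auto simp: pdiv_def)
  obtain u v :: int where uv: "u * int m + v * int n = 1"
    using \<open>coprime m n\<close> by (metis bezout_int coprime_int_iff coprime_imp_gcd_eq_1)
  have "F = of_int (u * int m + v * int n) * F" by (simp add: uv)
  also have "\<dots> = of_int u * (of_nat m * F) + of_int v * (of_nat n * F)" by (simp add: algebra_simps)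
  also have "\<dots> = of_int u * (of_nat m * (of_nat n * b)) + of_int v * (of_nat n * (of_nat m * a))"
    using a(2) b(2) by simp
  also have "\<dots> = of_nat (m * n) * (of_int u * b + of_int v * a)" by (simp add: algebra_simps)
  finally show ?thesis using a b by (auto simp: pdiv_def intro!: bexI[of _ "of_int u * b + of_int v * a"] PA_add PA_mult PA_of_int)
qed

section \<open>The commutator modulo \<open>I^3\<close>\<close>

context chern_data
begin

lemma S_eq: "S i = (\<Sum>k\<in>- {dual i}. cst (e (dual i) * e k) * (tv (k, dual i) * tv (dual k, i)))"
proof -
  have "S i = (\<Sum>k\<in>- {dual i}. cst (e (dual i) * e k) * (xmat k (dual i) * xmat (dual k) i))"
    by (simp add: S_def Rq_def sum_distrib_left cst_mult mult.assoc dual_dual)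
  also have "\<dots> = (\<Sum>k\<in>- {dual i}. cst (e (dual i) * e k) * (tv (k, dual i) * tv (dual k, i)))"
  proof (rule sum.cong)
    fix k assume "k \<in> - {dual i}"
    then have "k \<noteq> dual i" "dual k \<noteq> i" using dual_dual by auto
    then show "cst (e (dual i) * e k) * (xmat k (dual i) * xmat (dual k) i) =
        cst (e (dual i) * e k) * (tv (k, dual i) * tv (dual k, i))" by (simp add: xmat_def)
  qed simp
  finally show ?thesis .
qed

text \<open>Only the summand \<open>k = i\<close> contributes this monomial, and
  \<open>k = i\<close> lies in the range of summation because \<open>dual\<close> has no fixed
  points.\<close>

lemma S_coeff: "cf (S i) {#(i, dual i), (dual i, i)#} = e (dual i) * e i"
proof -
  have "cf (tv (k, dual i) * tv (dual k, i)) {#(i, dual i), (dual i, i)#} = (if k = i then 1 else 0)"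
    if "k \<in> - {dual i}" for k
    using that dual_neq[of i] by (auto simp: cf_tv_mult cf_tv)
  then have "cf (S i) {#(i, dual i), (dual i, i)#} = (\<Sum>k\<in>- {dual i}. if k = i then e (dual i) * e k else 0)"
    unfolding S_eq cf_sum by (intro sum.cong refl) simp
  also have "\<dots> = e (dual i) * e i" using dual_neq[of i] by (simp add: sum.delta)
  finally show ?thesis .
qed

text \<open>On \<open>x j j\<close> the trivial lift is the \<open>p'\<close>-th power and the Chern
  lift is \<open>?a + ?b\<close> with \<open>?a = xmat j j ^ p\<close> and \<open>?b\<close> of
  order \<open>2\<close>. One composite is \<open>(?a + ?b) ^ p'\<close>, which is
  \<open>?a ^ p' + p' * ?b\<close> modulo \<open>I^3\<close>, since \<open>?a\<close> is
  \<open>1\<close> modulo \<open>I\<close>. The other is \<open>?a ^ p'\<close> plus the trivial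
  image of \<open>?b\<close>, and this image lies in \<open>I^3\<close> because the trivial lift
  raises off-diagonal variables to the power \<open>p' \<ge> 3\<close>. What remains is
  \<open>p' * ?b\<close>, and \<open>?b\<close> is \<open>(p / 2) * S j\<close> modulo
  \<open>I^3\<close>.\<close>

lemma commutator_quadratic:
  assumes C: "frob_lift A K \<phi> yc p \<Phi>"
    and T: "substitution A K \<phi>' (\<lambda>(i, j :: 'n). xmat i j ^ p' - mone i j)" and p': "p' \<ge> 3"
  shows "substitution.sub \<phi> yc (substitution.sub \<phi>' (\<lambda>(i, j). xmat i j ^ p' - mone i j) (tv (j, j)))
     - substitution.sub \<phi>' (\<lambda>(i, j). xmat i j ^ p' - mone i j) (substitution.sub \<phi> yc (tv (j, j)))
     - cst (of_nat (p * p') / 2) * S j \<in> tord 3"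
proof -
  interpret C: frob_lift A K \<phi> yc p \<Phi> by fact
  interpret T: substitution A K \<phi>' "\<lambda>(i, j :: 'n). xmat i j ^ p' - mone i j" by fact
  have K2: "of_nat p / 2 \<in> K" using K_mult[OF K_of_nat half, of p] by simp
  define r where "r = yc (j, j) - (xmat j j ^ p - 1) - cst (of_nat p / 2) * S j"
  have r: "r \<in> tord 3" using yc_approx[of j j] by (simp add: r_def mone_same mone_diff)
  have S_PA: "S j \<in> PA" unfolding S_eq by (intro PA_sum PA_mult PA_cst PA_tv K_mult e_K)
  have r_PA: "r \<in> PA" unfolding r_def by (intro PA_diff PA_mult PA_cst K2 S_PA yc_PA PA_power PA_xmat PA_1)
  have St: "S j \<in> tord 2" by (simp add: S_def tord_mult_right Rq_tord)
  have xT: "xmat j j = tv (j, j) + 1" by (simp add: xmat_def)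
  have Tx: "T.sub (xmat j j) = xmat j j ^ p'"
  proof -
    have "T.sub (xmat j j) = T.sub (tv (j, j)) + T.sub 1" unfolding xT by (rule T.sub_add[OF PA_tv PA_1])
    then show ?thesis by (simp add: T.sub_tv T.sub_one mone_same mone_diff)
  qed
  have Cx: "C.sub (xmat j j) = xmat j j ^ p + (cst (of_nat p / 2) * S j + r)"
    unfolding C.sub_xmat by (simp add: r_def mone_same mone_diff)
  have TS: "T.sub (S j) \<in> tord 3"
  proof -
    have t: "T.sub (tv (k, dual j)) \<in> tord 3" if "k \<noteq> dual j" for k
      unfolding T.sub_tv using that xmat_off_power_tord[OF that p'] by (simp add: mone_same mone_diff)
    have ss: "T.sub (sum f I) = (\<Sum>k\<in>I. T.sub (f k))" if "\<And>k. f k \<in> PA" for f and I :: "'n set"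
      using that by (induction I rule: infinite_finite_induct) (auto simp: T.sub_zero T.sub_add PA_sum)
    have "T.sub (S j) = (\<Sum>k\<in>- {dual j}. T.sub (cst (e (dual j) * e k) * (tv (k, dual j) * tv (dual k, j))))"
      unfolding S_eq by (rule ss) (intro PA_mult PA_cst PA_tv K_mult e_K)
    also have "\<dots> = (\<Sum>k\<in>- {dual j}. T.sub (cst (e (dual j) * e k)) * (T.sub (tv (k, dual j)) * T.sub (tv (dual k, j))))"
      by (simp add: T.sub_mult PA_mult PA_cst PA_tv K_mult e_K)
    also have "\<dots> \<in> tord 3" by (intro tord_sum tord_mult_right[OF tord_mult_left] t) auto
    finally show ?thesis .
  qed
  let ?b = "cst (of_nat p / 2) * S j + r"
  have bt: "?b \<in> tord 2" by (intro tord_add tord_mult_right St tord_mono[OF r]) simp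
  obtain n where n: "p' = Suc n" using p' by (cases p') auto
  let ?a = "xmat j j ^ p"
  have sq: "(?a + ?b) ^ p' - (?a ^ p' + of_nat p' * (?a ^ n * ?b)) \<in> tord 4"
    using power_add_mod_square[OF bt, of ?a n] by (simp only: n)
  have "?a - 1 \<in> tord 1" using xmat_power_tord[OF p_pos, of j j] by (simp add: mone_same mone_diff)
  then have an: "?a ^ n - 1 \<in> tord 1" using tord_power_diff[of ?a 1 1 n] by simp
  have c1: "C.sub (T.sub (tv (j, j))) = (?a + ?b) ^ p' - 1"
    unfolding T.sub_tv by (simp add: mone_same mone_diff C.sub_diff PA_power PA_xmat C.sub_power Cx C.sub_one)
  have c2: "T.sub (C.sub (tv (j, j))) = ?a ^ p' - 1 + T.sub (cst (of_nat p / 2)) * T.sub (S j) + T.sub r"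
  proof -
    have "C.sub (tv (j, j)) = ((xmat j j ^ p - 1) + cst (of_nat p / 2) * S j) + r"
      unfolding C.sub_tv by (simp add: r_def)
    then show ?thesis
      by (simp add: T.sub_add T.sub_diff T.sub_mult T.sub_power T.sub_one Tx PA_add PA_diff PA_power PA_xmat PA_mult
          PA_cst K2 S_PA r_PA) (simp add: mult.commute flip: power_mult)
  qed
  have c3: "cst (of_nat (p * p') / 2) = of_nat p' * (cst (of_nat p / 2) :: ('n \<times> 'n) mps)"
    by (simp add: mult.commute flip: cst_of_nat cst_mult)
  have "C.sub (T.sub (tv (j, j))) - T.sub (C.sub (tv (j, j))) - cst (of_nat (p * p') / 2) * S j =
      ((?a + ?b) ^ p' - (?a ^ p' + of_nat p' * (?a ^ n * ?b))) + of_nat p' * ((?a ^ n - 1) * ?b) + of_nat p' * r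
      - T.sub (cst (of_nat p / 2)) * T.sub (S j) - T.sub r"
    unfolding c1 c2 c3 by (simp add: algebra_simps)
  also have "\<dots> \<in> tord 3"
    by (intro tord_diff tord_add tord_mono[OF sq] tord_mult_right[of "(?a ^ n - 1) * ?b"]
        tord_mono[OF tord_mult_add[OF an bt]] tord_mult_right[OF r] tord_mult_right[OF TS] T.sub_tord r) simp_all
  finally show ?thesis .
qed

end

lemma (in substitution) cf_sub_linear_diag:
  fixes c :: "'v \<Rightarrow> complex"
  assumes F: "F \<in> tord 1" and y: "\<And>u v. cf (y u) {#v#} = (if u = v then c v else 0)"
  shows "cf (sub F) {#v#} = \<phi> (cf F {#v#}) * c v"
  unfolding cf_sub_linear[OF F] y by (simp add: if_distrib[of "\<lambda>x. _ * x"] cong: if_cong)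

lemma trivial_linear:
  assumes "p \<ge> 3"
  shows "cf (case u of (i, j) \<Rightarrow> xmat i j ^ p - mone i j) {#v#} = (if u = v then (if fst v = snd v then of_nat p else 0) else 0)"
proof -
  obtain i j where u: "u = (i, j)" by (cases u)
  obtain n where n: "p = Suc n" using assms by (cases p) auto
  show ?thesis
  proof (cases "i = j")
    case True
    have "(1 + tv u) ^ Suc n - (1 + of_nat (Suc n) * tv u) \<in> tord 2" for n
    proof (induction n)
      case (Suc n)
      have "(1 + tv u) ^ Suc (Suc n) - (1 + of_nat (Suc (Suc n)) * tv u) =
          (1 + tv u) * ((1 + tv u) ^ Suc n - (1 + of_nat (Suc n) * tv u)) + of_nat (Suc n) * (tv u * tv u)"
        by (simp add: algebra_simps)
      also have "\<dots> \<in> tord 2"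
        by (intro tord_add tord_mult_right[OF Suc] tord_mult_right[of "tv u * tv u"] tord_mono[OF tord_mult_add[OF tv_tord tv_tord]]) simp
      finally show ?case .
    qed simp
    from this[of n] have "cf ((1 + tv u) ^ p - (1 + of_nat p * tv u)) {#v#} = 0" by (simp add: tord_def n)
    then show ?thesis using True by (auto simp: u xmat_def mone_def cf_one cf_tv add.commute)
  next
    case False
    then have "xmat i j ^ p \<in> tord 2"
      using tord_power[of "tv (i, j)" 1 p, OF tv_tord] assms by (auto simp: xmat_def intro: tord_mono)
    then show ?thesis using False by (auto simp: u mone_def tord_def)
  qed
qed

section \<open>The quotients of \<open>I\<close> by its powers\<close>

context coeff_ring
begin

lemma T_power_cf: "cf F \<in> T_power A k \<longleftrightarrow> F \<in> PA \<and> F \<in> (tord k :: 'v::finite mps set)"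
  by (auto simp: T_power_eq pseries_ord_def PA_def tord_def)

lemma T_ideal_cf: "cf F \<in> T_ideal A \<longleftrightarrow> F \<in> PA \<and> F \<in> (tord 1 :: 'v::finite mps set)"
  by (auto simp: T_ideal_eq pseries_ord_def PA_def tord_def)

lemma T_power_ideal: "ideal (T_power A k :: ('v::finite, complex) pseries set) P"
  unfolding T_power_eq by (rule pseries_ord_ideal)

lemma T_quotientE:
  assumes "X \<in> T_quotient A \<nu>"
  obtains F :: "'v::finite mps" where "F \<in> PA" "F \<in> tord 1" "X = T_power A (\<nu> + 1) +>\<^bsub>P\<^esub> cf F"
proof -
  obtain f where f: "f \<in> T_ideal A" "X = T_power A (\<nu> + 1) +>\<^bsub>P\<^esub> f"
    using assms by (auto simp: T_quotient_def)
  then show ?thesis using that[of "Mps f"] T_ideal_cf[of "Mps f"] by simp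
qed

lemma T_coset_mem_tord:
  fixes F :: "'v::finite mps"
  assumes F: "F \<in> PA" "F \<in> tord 1" and g: "g \<in> T_power A (Suc \<nu>) +>\<^bsub>P\<^esub> cf F"
  shows "\<exists>G\<in>PA. G \<in> tord 1 \<and> g = cf G"
proof -
  obtain h where h: "h \<in> T_power A (Suc \<nu>)" "g = h \<oplus>\<^bsub>P\<^esub> cf F" using g by (auto simp: a_r_coset_def r_coset_def)
  from h(1) have "Mps h \<in> PA" "Mps h \<in> tord (Suc \<nu>)" using T_power_cf[of "Mps h" "Suc \<nu>"] by auto
  moreover have "g = cf (Mps h + F)" using h(2) P_add[of "Mps h" F] by simp
  ultimately show ?thesis using F by (intro bexI[of _ "Mps h + F"]) (auto intro!: tord_add PA_add intro: tord_mono)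
qed

end

context chern_data
begin

text \<open>The correction by \<open>S\<close> has order \<open>2\<close>, so the linear part is
  that of the trivial lift.\<close>

lemma yc_linear: "cf (yc u) {#v#} = (if u = v then (if fst v = snd v then of_nat p else 0) else 0)"
proof -
  obtain i j where u: "u = (i, j)" by (cases u)
  have "(if i = j then cst (of_nat p / 2) * S i else 0) \<in> tord 2"
    by (simp add: S_def tord_mult_right Rq_tord)
  then have "yc (i, j) - (xmat i j ^ p - mone i j) \<in> tord 2"
    using tord_add[OF tord_mono[OF yc_approx[of i j], of 2]] by fastforce
  then have "cf (yc u) {#v#} = cf (xmat i j ^ p - mone i j) {#v#}" by (simp add: tord_def u)
  then show ?thesis using trivial_linear[OF p_ge_3, of u v] by (simp add: u)
qed

text \<open>\<open>curvature\<close> divides complex coefficients, so integrality must be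
  established before its values can be placed in cosets over \<open>A\<close>. Division by the
  positive integer \<open>n\<close> does not change the order in \<open>T\<close>, so orders are
  read off from the commutator \<open>Cm\<close>.\<close>

lemma curvature_aux:
  fixes \<delta> \<delta>' :: "nat \<Rightarrow> ('n, complex) GL_hat \<Rightarrow> ('n, complex) GL_hat"
  assumes C: "frob_lift A K \<phi> yc p \<Phi>" and d: "\<delta> p = d"
    and T: "conn A K \<phi>' p' d'" and d': "\<delta>' p' = d'"
    and triv: "\<And>i j. d' (GL_x A p' i j) = \<zero>\<^bsub>GL_completion A p'\<^esub>"
    and comm: "\<forall>x\<in>K. \<phi> (\<phi>' x) = \<phi>' (\<phi> x)"
  shows "\<And>F. F \<in> PA \<Longrightarrow> \<exists>G\<in>PA. curvature A \<delta> \<delta>' p p' (cf F) = cf G \<and> (F \<in> tord 1 \<longrightarrow> G \<in> tord 2)"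
    and "curvature A \<delta> \<delta>' p p' (cf (tv (j, j))) {#(j, dual j), (dual j, j)#} \<noteq> 0"
proof -
  interpret C: frob_lift A K \<phi> yc p \<Phi> by fact
  interpret N: conn A K \<phi>' p' d' by fact
  interpret T: frob_lift A K \<phi>' "\<lambda>(i, j). xmat i j ^ p' - mone i j" p' "frob (GL_completion A p') p' d'"
    by (rule N.trivial_lift[OF triv])
  define n where "n = (if p = p' then p else p * p')"
  have n0: "n > 0" using p_pos prime_gt_0_nat[OF N.prime_p] by (simp add: n_def)
  define Cm where "Cm F = C.sub (T.sub F) - T.sub (C.sub F)" for F
  have curv: "curvature A \<delta> \<delta>' p p' (cf F) = (\<lambda>m. cf (Cm F) m / of_nat n)" if "F \<in> PA" for F
  proof -
    have f1: "frob_at_one A \<delta> p (cf F) = cf (C.sub F)" if "F \<in> PA" for F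
      by (rule C.frob_at_one_eq[OF _ that]) (simp only: d)
    have f2: "frob_at_one A \<delta>' p' (cf F) = cf (T.sub F)" if "F \<in> PA" for F
      by (rule T.frob_at_one_eq[OF _ that]) (simp only: d')
    show ?thesis
      unfolding curvature_def f1[OF that] f2[OF that] f1[OF T.sub_PA[OF that]] f2[OF C.sub_PA[OF that]]
        Cm_def n_def cf_simps ..
  qed
  have Cm_PA: "Cm F \<in> PA" if "F \<in> PA" for F
    using that by (simp add: Cm_def PA_diff C.sub_PA T.sub_PA)
  have fC: "C.sub F - F ^ p \<in> pdiv p" if "F \<in> PA" for F by (rule sub_frob[OF C that])
  have fT: "T.sub F - F ^ p' \<in> pdiv p'" if "F \<in> PA" for F by (rule N.sub_frob[OF T.frob_lift_axioms that])
  have div_p: "Cm F \<in> pdiv p" if F: "F \<in> PA" for F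
  proof -
    \<comment> \<open>The inserted terms \<open>T.sub F ^ p\<close> and \<open>T.sub (F ^ p)\<close>
      are equal and cancel. The Frobenius congruence of the Chern lift is used twice, at
      \<open>T.sub F\<close> and inside \<open>T.sub\<close>; for \<open>p'\<close> the two lifts
      exchange roles.\<close>
    have "Cm F = (C.sub (T.sub F) - T.sub F ^ p) - T.sub (C.sub F - F ^ p)"
      using F by (simp add: Cm_def T.sub_diff C.sub_PA PA_power T.sub_power)
    also have "\<dots> \<in> pdiv p" by (intro pdiv_diff[OF fC T.sub_pdiv[OF fC]] T.sub_PA F)
    finally show ?thesis .
  qed
  have div_p': "Cm F \<in> pdiv p'" if F: "F \<in> PA" for F
  proof -
    have "Cm F = C.sub (T.sub F - F ^ p') - (T.sub (C.sub F) - C.sub F ^ p')"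
      using F by (simp add: Cm_def C.sub_diff T.sub_PA PA_power C.sub_power)
    also have "\<dots> \<in> pdiv p'" by (intro pdiv_diff[OF C.sub_pdiv[OF fT] fT] C.sub_PA F)
    finally show ?thesis .
  qed
  have div_n: "Cm F \<in> pdiv n" if F: "F \<in> PA" for F
  proof (cases "p = p'")
    case True
    then show ?thesis using div_p[OF F] by (simp add: n_def)
  next
    case False
    then have "coprime p p'" using prime_p N.prime_p by (simp add: primes_coprime)
    then show ?thesis using pdiv_coprime[OF coeff_ring_axioms _ div_p[OF F] div_p'[OF F]] False by (simp add: n_def)
  qed
  have Cm_tord: "Cm F \<in> tord 2" if F: "F \<in> PA" "F \<in> tord 1" for F
  proof -
    let ?l = "\<lambda>p v. if fst v = snd v then of_nat p else (0::complex)"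
    have CF: "C.sub F \<in> tord 1" "T.sub F \<in> tord 1" by (rule C.sub_tord[OF F(2)], rule T.sub_tord[OF F(2)])
    have lC: "cf (C.sub G) {#v#} = \<phi> (cf G {#v#}) * ?l p v" if "G \<in> tord 1" for G v
      by (rule C.cf_sub_linear_diag[OF that yc_linear])
    have lT: "cf (T.sub G) {#v#} = \<phi>' (cf G {#v#}) * ?l p' v" if "G \<in> tord 1" for G v
      by (rule T.cf_sub_linear_diag[OF that trivial_linear[OF N.p_ge_3]])
    \<comment> \<open>Both linear parts are diagonal but only semilinear, since coefficients are
      moved by \<open>\<phi>\<close> and \<open>\<phi>'\<close>. The diagonal entries are integers,
      fixed by both maps, so the claim reduces to \<open>comm\<close>.\<close>
    have lin: "cf (Cm F) {#v#} = 0" for v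
    proof -
      have FK: "cf F {#v#} \<in> K" by (rule PA_cf[OF F(1)])
      have l: "?l m v \<in> K" "\<phi> (?l m v) = ?l m v" "\<phi>' (?l m v) = ?l m v" for m
        by (auto simp: K_of_nat K_zero \<phi>_of_nat \<phi>_zero N.\<phi>_of_nat N.\<phi>_zero)
      have "cf (C.sub (T.sub F)) {#v#} = \<phi> (\<phi>' (cf F {#v#})) * ?l p' v * ?l p v"
        unfolding lC[OF CF(2)] lT[OF F(2)] \<phi>_mult[OF N.\<phi>_closed[OF FK] l(1)] l(2) ..
      moreover have "cf (T.sub (C.sub F)) {#v#} = \<phi>' (\<phi> (cf F {#v#})) * ?l p v * ?l p' v"
        unfolding lT[OF CF(1)] lC[OF F(2)] N.\<phi>_mult[OF \<phi>_closed[OF FK] l(1)] l(3) ..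
      ultimately show ?thesis by (simp add: Cm_def comm[rule_format, OF FK])
    qed
    have 0: "Cm F \<in> tord 1" unfolding Cm_def by (intro tord_diff C.sub_tord T.sub_tord F)
    show ?thesis unfolding tord_def
    proof (intro CollectI allI impI)
      fix m :: "('n \<times> 'n) multiset" assume "size m < 2"
      then consider "size m = 0" | "size m = 1" by linarith
      then show "cf (Cm F) m = 0"
      proof cases
        case 1
        then show ?thesis using 0 by (simp add: tord_def)
      next
        case 2
        then obtain v where "m = {#v#}" using size_1_singleton_mset by blast
        then show ?thesis using lin by simp
      qed
    qed
  qed
  {
    fix F :: "('n \<times> 'n) mps" assume F: "F \<in> PA"
    obtain G where G: "G \<in> PA" "Cm F = of_nat n * G" using div_n[OF F] by (auto simp: pdiv_def)
    have "curvature A \<delta> \<delta>' p p' (cf F) = cf G"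
      using n0 by (simp add: curv[OF F] G(2) fun_eq_iff)
    moreover have "G \<in> tord 2" if "F \<in> tord 1"
      using Cm_tord[OF F that] n0 by (simp add: G(2) tord_def)
    ultimately show "\<exists>G\<in>PA. curvature A \<delta> \<delta>' p p' (cf F) = cf G \<and> (F \<in> tord 1 \<longrightarrow> G \<in> tord 2)"
      using G(1) by blast
  }
  let ?m = "{#(j, dual j), (dual j, j)#}"
  have "Cm (tv (j, j)) - cst (of_nat (p * p') / 2) * S j \<in> tord 3"
    unfolding Cm_def by (rule commutator_quadratic[OF C T.substitution_axioms N.p_ge_3])
  then have 1: "cf (Cm (tv (j, j))) ?m = of_nat (p * p') / 2 * (e (dual j) * e j)"
    by (simp add: tord_def S_coeff)
  have "e i \<noteq> 0" for i using e[of i] by auto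
  then have "cf (Cm (tv (j, j))) ?m \<noteq> 0"
    unfolding 1 using p_pos prime_gt_0_nat[OF N.prime_p] by simp
  then show "curvature A \<delta> \<delta>' p p' (cf (tv (j, j))) ?m \<noteq> 0" using n0 by (simp add: curv PA_tv)
qed

text \<open>\<open>T_quotient_map\<close> is a union over all members of a coset. Vanishing on
  \<open>I / I^2\<close> therefore needs the order bound for every member, whereas for non-vanishing
  on \<open>I / I^3\<close> it is enough that one element of the union lies outside
  \<open>I^3\<close>.\<close>

lemma curvature_quotients:
  fixes \<delta> \<delta>' :: "nat \<Rightarrow> ('n, complex) GL_hat \<Rightarrow> ('n, complex) GL_hat"
  assumes "frob_lift A K \<phi> yc p \<Phi>" "\<delta> p = d" "conn A K \<phi>' p' d'" "\<delta>' p' = d'"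
    and "\<And>i j. d' (GL_x A p' i j) = \<zero>\<^bsub>GL_completion A p'\<^esub>"
    and "\<forall>x\<in>K. \<phi> (\<phi>' x) = \<phi>' (\<phi> x)"
  shows "(\<forall>X\<in>T_quotient A 1. T_quotient_map A 1 (curvature A \<delta> \<delta>' p p') X = T_power A 2)
    \<and> (\<exists>X\<in>T_quotient A 2. T_quotient_map A 2 (curvature A \<delta> \<delta>' p p') X \<noteq> T_power A 3)
    \<and> (\<exists>f\<in>carrier P. curvature A \<delta> \<delta>' p p' f \<noteq> \<zero>\<^bsub>P\<^esub>)"
proof (intro conjI ballI)
  note aux = curvature_aux[where \<delta> = \<delta> and \<phi>' = \<phi>' and p' = p' and d' = d' and \<delta>' = \<delta>', OF assms]
  let ?R = "curvature A \<delta> \<delta>' p p'"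
  fix X :: "('n \<times> 'n, complex) pseries set" assume "X \<in> T_quotient A 1"
  then obtain F where F: "F \<in> PA" "F \<in> tord 1" "X = T_power A (1 + 1) +>\<^bsub>P\<^esub> cf F" by (rule T_quotientE)
  interpret I: ideal "T_power A 2 :: ('n \<times> 'n, complex) pseries set" P by (rule T_power_ideal)
  have X2: "X = T_power A 2 +>\<^bsub>P\<^esub> cf F" using F(3) by (simp add: numeral_2_eq_2)
  have "T_power A 2 +>\<^bsub>P\<^esub> ?R g = T_power A 2" if "g \<in> X" for g
  proof -
    obtain G where "G \<in> PA" "G \<in> tord 1" "g = cf G"
      using T_coset_mem_tord[OF F(1,2), of g 1] \<open>g \<in> X\<close> by (auto simp: X2 numeral_2_eq_2)
    then obtain H where "H \<in> PA" "?R g = cf H" "H \<in> tord 2" using aux(1) by blast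
    then show ?thesis using I.a_rcos_const T_power_cf by metis
  qed
  moreover have "cf F \<in> X" unfolding X2 by (rule I.a_rcos_self) (simp add: F)
  ultimately show "T_quotient_map A 1 ?R X = T_power A 2"
    unfolding T_quotient_map_def one_add_one by (intro UN_constant_eq) auto
next
  note aux = curvature_aux[where \<delta> = \<delta> and \<phi>' = \<phi>' and p' = p' and d' = d' and \<delta>' = \<delta>', OF assms]
  let ?R = "curvature A \<delta> \<delta>' p p'"
  fix j :: 'n
  interpret I: ideal "T_power A 3 :: ('n \<times> 'n, complex) pseries set" P by (rule T_power_ideal)
  \<comment> \<open>Any index serves: the witness is the diagonal variable at \<open>j\<close>, and
    its image is detected by the coefficient at \<open>?m\<close>, a monomial of degree
    \<open>2\<close>.\<close>
  define j where "j = (undefined :: 'n)"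
  let ?f = "cf (tv (j, j)) :: ('n \<times> 'n, complex) pseries"
  let ?m = "{#(j, dual j), (dual j, j)#}"
  have nz: "?R ?f ?m \<noteq> 0" by (rule aux(2))
  have fP: "?f \<in> carrier P" by (simp add: PA_tv)
  then show "\<exists>f\<in>carrier P. ?R f \<noteq> \<zero>\<^bsub>P\<^esub>" using nz by (intro bexI[of _ ?f]) (auto simp: pseries_simps)
  show "\<exists>X\<in>T_quotient A 2. T_quotient_map A 2 ?R X \<noteq> T_power A 3"
  proof
    show "T_power A 3 +>\<^bsub>P\<^esub> ?f \<in> T_quotient A 2"
      using T_ideal_cf[of "tv (j, j)"] tv_tord PA_tv by (auto simp: T_quotient_def)
    have "?f \<in> T_power A 3 +>\<^bsub>P\<^esub> ?f" by (rule I.a_rcos_self[OF fP])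
    moreover obtain G where G: "G \<in> PA" "?R ?f = cf G" using aux(1)[OF PA_tv] by blast
    moreover have "cf G \<in> T_power A 3 +>\<^bsub>P\<^esub> cf G" by (rule I.a_rcos_self) (simp add: G)
    ultimately have "cf G \<in> T_quotient_map A 2 ?R (T_power A 3 +>\<^bsub>P\<^esub> ?f)"
      unfolding T_quotient_map_def by (auto intro!: bexI[of _ ?f])
    moreover have "cf G \<notin> T_power A 3" using nz unfolding T_power_cf G(2) by (auto simp: tord_def intro!: exI[of _ ?m])
    ultimately show "T_quotient_map A 2 ?R (T_power A 3 +>\<^bsub>P\<^esub> ?f) \<noteq> T_power A 3" by blast
  qed
qed

end

lemma prime_not_dvd_even_ge_3:
  assumes "prime (p::nat)" "\<not> p dvd M * N" "even M"
  shows "p \<ge> 3"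
proof -
  have "p \<noteq> 2" using assms by auto
  then show ?thesis using prime_ge_2_nat[OF assms(1)] by simp
qed

theorem theorem3p6:
  fixes M N :: nat and \<zeta> :: complex and A :: "complex ring" and V :: "nat set"
    and \<phi> :: "nat \<Rightarrow> complex \<Rightarrow> complex"
    and q :: "('r::finite + 'r, complex) matrix"
    and \<delta> \<delta>bar :: "nat \<Rightarrow> ('r + 'r, complex) GL_hat \<Rightarrow> ('r + 'r, complex) GL_hat"
  assumes M: "even M" "M > 0"
    and N: "N \<ge> 1" "primitive_root_of_one N \<zeta>"
    and A: "A = cyclotomic_ring M \<zeta>"
    and V: "\<forall>p\<in>V. Factorial_Ring.prime p \<and> \<not> p dvd M * N"
    and \<phi>: "\<forall>p\<in>V. frobenius_lift A p (\<phi> p)"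
    and q: "q \<in> Units (mat_ring A)" "split_matrix q"
    and chern: "chern_connection A V \<phi> q \<delta>"
    and trivial: "trivial_connection A V \<phi> \<delta>bar"
  shows "\<forall>p\<in>V. \<forall>p'\<in>V.
      (\<forall>X\<in>T_quotient A 1. T_quotient_map A 1 (curvature A \<delta> \<delta>bar p p') X = T_power A 2)
    \<and> (\<exists>X\<in>T_quotient A 2. T_quotient_map A 2 (curvature A \<delta> \<delta>bar p p') X \<noteq> T_power A 3)
    \<and> (\<exists>f\<in>carrier (pseries_ring A). curvature A \<delta> \<delta>bar p p' f \<noteq> \<zero>\<^bsub>pseries_ring A\<^esub>)"
proof (intro ballI)
  fix p p' assume p: "p \<in> V" and p': "p' \<in> V"
  define K where "K = carrier A"
  interpret coeff_ring A K unfolding K_def A by (rule cyclotomic_coeff_ring)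
  have endo: "ring_endo A K (\<phi> l)" if "l \<in> V" for l
    by (rule ring_endo_hom[OF coeff_ring_axioms]) (use \<phi> that in \<open>auto simp: frobenius_lift_def\<close>)
  have conn: "conn A K (\<phi> l) l d"
    if l: "l \<in> V" and "p_derivation (GL_completion A l) l d" "extends_base A l (\<phi> l) (frob (GL_completion A l) l d)"
    for l and d :: "('r + 'r, complex) GL_hat \<Rightarrow> ('r + 'r, complex) GL_hat"
  proof -
    interpret E: ring_endo A K "\<phi> l" by (rule endo[OF l])
    have pr: "prime l" "\<not> l dvd M * N" using V l by auto
    show ?thesis
    proof
      show "prime l" by (rule pr)
      show "3 \<le> l" by (rule prime_not_dvd_even_ge_3[OF pr M(1)])
      show "x = 0" if "\<And>k. \<exists>c\<in>K. x = of_nat (l ^ k) * c" for x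
        using that cyclotomic_separated[OF M(2) N(2,1) pr(1) _ that[unfolded K_def A]] pr(2) by (meson dvd_mult2)
      show "1 / 2 \<in> K" unfolding K_def A by (rule cyclotomic_half[OF M])
      show "\<exists>c\<in>K. \<phi> l a = a ^ l + of_nat l * c" if a: "a \<in> K" for a
      proof -
        have "\<phi> l a \<ominus>\<^bsub>A\<^esub> a [^]\<^bsub>A\<^esub> l \<in> p_ideal A l 1" using \<phi> l a by (auto simp: frobenius_lift_def)
        moreover have "a ^ l \<in> K" using a by (induction l) (auto simp: K_one K_mult)
        ultimately obtain c where "c \<in> K" "\<phi> l a - a ^ l = of_nat l * c"
          using a by (auto simp: A_nat_pow A_minus E.\<phi>_closed A_p_ideal_iff)
        then show ?thesis by (intro bexI[of _ c]) (auto simp: algebra_simps)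
      qed
    qed (use that in auto)
  qed
  obtain \<epsilon> :: complex where \<epsilon>: "\<epsilon> = 1 \<or> \<epsilon> = - 1" "q = split_form \<epsilon>"
    using q(2) by (auto simp: split_matrix_def)
  \<comment> \<open>\<open>dual\<close> exchanges the two blocks of indices, and \<open>e\<close>
    records the sign of each block, so that \<open>q\<close> takes the shape required by
    \<open>chern_data\<close>.\<close>
  define dual :: "'r + 'r \<Rightarrow> 'r + 'r" where "dual = case_sum Inr Inl"
  define e :: "'r + 'r \<Rightarrow> complex" where "e = case_sum (\<lambda>_. 1) (\<lambda>_. \<epsilon>)"
  have "p_derivation (GL_completion A p) p (\<delta> p)" "extends_base A p (\<phi> p) (frob (GL_completion A p) p (\<delta> p))"
    using chern p by (auto simp: chern_connection_def adelic_connection_def Let_def)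
  then interpret C: conn A K "\<phi> p" p "\<delta> p" by (rule conn[OF p])
  interpret C: chern_data A K "\<phi> p" p "\<delta> p" dual e q
  proof
    show "dual (dual i) = i" for i by (cases i) (simp_all add: dual_def)
    show "dual i \<noteq> i" for i by (cases i) (simp_all add: dual_def)
    show "e i = 1 \<or> e i = - 1" for i using \<epsilon> by (cases i) (auto simp: e_def)
    show "q = (\<lambda>i j. if j = dual i then e i else 0)"
      unfolding \<epsilon>(2) by (auto simp: split_form_def dual_def e_def fun_eq_iff split: sum.split)
  qed
  obtain s where "binomial_sqrt (GL_completion A p) p (GL_scalar A p)
      (inv\<^bsub>C.Mat\<^esub> (mat_transpose (entrywise_pow (GL_completion A p) (GL_x A p) p) \<otimes>\<^bsub>C.Mat\<^esub>
          (\<lambda>i j. GL_scalar A p (\<phi> p (q i j))) \<otimes>\<^bsub>C.Mat\<^esub> entrywise_pow (GL_completion A p) (GL_x A p) p) \<otimes>\<^bsub>C.Mat\<^esub>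
        entrywise_pow (GL_completion A p) (mat_transpose (GL_x A p) \<otimes>\<^bsub>C.Mat\<^esub> (\<lambda>i j. GL_scalar A p (q i j)) \<otimes>\<^bsub>C.Mat\<^esub> GL_x A p) p) s"
    "(\<lambda>i j. frob (GL_completion A p) p (\<delta> p) (GL_x A p i j)) = entrywise_pow (GL_completion A p) (GL_x A p) p \<otimes>\<^bsub>C.Mat\<^esub> s"
    using chern p by (auto simp: chern_connection_def Let_def)
  then have lift: "frob_lift A K (\<phi> p) C.yc p C.\<Phi>" by (rule C.chern_lift)
  have "p_derivation (GL_completion A p') p' (\<delta>bar p')" "extends_base A p' (\<phi> p') (frob (GL_completion A p') p' (\<delta>bar p'))"
    and triv: "\<delta>bar p' (GL_x A p' i j) = \<zero>\<^bsub>GL_completion A p'\<^esub>" for i j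
    using trivial p' by (auto simp: trivial_connection_def adelic_connection_def)
  then have N': "conn A K (\<phi> p') p' (\<delta>bar p')" by (intro conn[OF p'])
  have comm: "\<forall>x\<in>K. \<phi> p (\<phi> p' x) = \<phi> p' (\<phi> p x)"
    using cyclotomic_endos_commute[OF M(2) N(2,1)] endo[OF p] endo[OF p'] by (simp add: K_def A)
  show "(\<forall>X\<in>T_quotient A 1. T_quotient_map A 1 (curvature A \<delta> \<delta>bar p p') X = T_power A 2)
    \<and> (\<exists>X\<in>T_quotient A 2. T_quotient_map A 2 (curvature A \<delta> \<delta>bar p p') X \<noteq> T_power A 3)
    \<and> (\<exists>f\<in>carrier (pseries_ring A). curvature A \<delta> \<delta>bar p p' f \<noteq> \<zero>\<^bsub>pseries_ring A\<^esub>)"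
    by (rule C.curvature_quotients[where \<delta> = \<delta> and \<phi>' = "\<phi> p'" and p' = p' and d' = "\<delta>bar p'" and \<delta>' = \<delta>bar, OF lift refl N' refl triv comm])
qed

end
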